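(* Let $K$ be an algebraically closed field of characteristic $p>0$, let $n=2$, let $r\ge1$, and let $\lambda=(\lambda_1,\lambda_2)\in\Lambda^+_r$ be arbitrary. Then there exists an integer $a\ge 0$ such that, for every degenerate $\mu\in\Lambda^+_{r+2a}$ (that is, $\mu=(r+2a,0)$) and every integer $k\ge a$, the $GL_2(K)$-module $P(\mu)\otimes E^{\otimes 2(k-a)}$ has no direct summand isomorphic to $P((\lambda_1+k,\lambda_2+k))$.
   Context: $\Lambda^+_m$ is the set of pairs $\lambda=(\lambda_1,\lambda_2)$ of integers with $\lambda_1\ge\lambda_2\ge0$ and $\lambda_1+\lambda_2=m$. Such a partition is degenerate if $\lambda_2=0$. $E=K^2$ is the natural $GL_2(K)$-module ($E^{\otimes0}=K$). A tilting module is a finite-dimensional polynomial $GL_2(K)$-module having both a filtration by Weyl modules and a filtration by dual Weyl modules; for $\lambda\in\Lambda^+_m$, $P(\lambda)$ denotes the indecomposable tilting module with highest weight $\lambda$. *)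

theory Defs
  imports "Jordan_Normal_Form.VS_Connect"
begin

text \<open>
  A finite-dimensional \<open>GL\<^sub>2(K)\<close>-module is given, after a choice of basis, by its dimension \<open>d\<close> and
  the matrix representation \<open>\<rho> : GL\<^sub>2(K) \<rightarrow> GL\<^sub>d(K)\<close>; the underlying space is \<open>carrier_vec d\<close>, on
  which \<open>g\<close> acts by \<open>v \<mapsto> \<rho> g *\<^sub>v v\<close>. Values of \<open>\<rho>\<close> outside \<open>GL\<^sub>2(K)\<close> are irrelevant.
\<close>

definition GL2 :: "'a::field mat set" where
  "GL2 = {g \<in> carrier_mat 2 2. det g \<noteq> 0}"

record 'a gl2_rep =
  rdim :: nat
  ract :: "'a mat \<Rightarrow> 'a mat"

abbreviation rspace :: "'a gl2_rep \<Rightarrow> 'a vec set" where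
  "rspace M \<equiv> carrier_vec (rdim M)"

text \<open>
  Functions on \<open>GL\<^sub>2(K)\<close> that are polynomial in the four matrix entries, and the regular functions,
  i.e. the elements of \<open>K[GL\<^sub>2] = K[x\<^sub>1\<^sub>1, x\<^sub>1\<^sub>2, x\<^sub>2\<^sub>1, x\<^sub>2\<^sub>2, 1/det]\<close> viewed as functions.
\<close>

definition polynomial_fun :: "('a::field mat \<Rightarrow> 'a) \<Rightarrow> bool" where
  "polynomial_fun f \<longleftrightarrow> (\<exists>(S :: (nat \<times> nat \<times> nat \<times> nat) set) c. finite S \<and>
     (\<forall>x\<in>GL2. f x = (\<Sum>(i, j, k, l)\<in>S. c (i, j, k, l) *
        x $$ (0,0) ^ i * x $$ (0,1) ^ j * x $$ (1,0) ^ k * x $$ (1,1) ^ l)))"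

definition regular_fun :: "('a::field mat \<Rightarrow> 'a) \<Rightarrow> bool" where
  "regular_fun f \<longleftrightarrow> (\<exists>q e. polynomial_fun q \<and> (\<forall>x\<in>GL2. f x = q x / det x ^ e))"

definition polynomial_module :: "'a::field gl2_rep \<Rightarrow> bool" where
  "polynomial_module M \<longleftrightarrow>
     (\<forall>g\<in>GL2. ract M g \<in> carrier_mat (rdim M) (rdim M)) \<and>
     ract M (1\<^sub>m 2) = 1\<^sub>m (rdim M) \<and>
     (\<forall>g\<in>GL2. \<forall>h\<in>GL2. ract M (g * h) = ract M g * ract M h) \<and>
     (\<forall>i<rdim M. \<forall>j<rdim M. polynomial_fun (\<lambda>g. ract M g $$ (i, j)))"

definition rep_iso :: "'a::field gl2_rep \<Rightarrow> 'a gl2_rep \<Rightarrow> bool" where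
  "rep_iso M N \<longleftrightarrow> rdim M = rdim N \<and>
     (\<exists>T \<in> carrier_mat (rdim N) (rdim M). invertible_mat T \<and>
        (\<forall>g\<in>GL2. T * ract M g = ract N g * T))"

definition direct_sum :: "'a::field gl2_rep \<Rightarrow> 'a gl2_rep \<Rightarrow> 'a gl2_rep" where
  "direct_sum M N = \<lparr>rdim = rdim M + rdim N,
     ract = (\<lambda>g. four_block_mat (ract M g) (0\<^sub>m (rdim M) (rdim N))
                                (0\<^sub>m (rdim N) (rdim M)) (ract N g))\<rparr>"

definition has_summand :: "'a::field gl2_rep \<Rightarrow> 'a gl2_rep \<Rightarrow> bool" where
  "has_summand M N \<longleftrightarrow> (\<exists>Q. polynomial_module Q \<and> rep_iso M (direct_sum N Q))"

definition indecomposable :: "'a::field gl2_rep \<Rightarrow> bool" where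
  "indecomposable M \<longleftrightarrow> rdim M \<noteq> 0 \<and>
     \<not> (\<exists>N Q. polynomial_module N \<and> polynomial_module Q \<and> rdim N \<noteq> 0 \<and> rdim Q \<noteq> 0 \<and>
            rep_iso M (direct_sum N Q))"

definition kronecker :: "'a::semiring_1 mat \<Rightarrow> 'a mat \<Rightarrow> 'a mat" where
  "kronecker A B = mat (dim_row A * dim_row B) (dim_col A * dim_col B)
     (\<lambda>(i, j). A $$ (i div dim_row B, j div dim_col B) * B $$ (i mod dim_row B, j mod dim_col B))"

definition tensor :: "'a::field gl2_rep \<Rightarrow> 'a gl2_rep \<Rightarrow> 'a gl2_rep" where
  "tensor M N = \<lparr>rdim = rdim M * rdim N, ract = (\<lambda>g. kronecker (ract M g) (ract N g))\<rparr>"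

definition natural_module :: "'a::field gl2_rep" where
  "natural_module = \<lparr>rdim = 2, ract = (\<lambda>g. g)\<rparr>"

definition trivial_module :: "'a::field gl2_rep" where
  "trivial_module = \<lparr>rdim = 1, ract = (\<lambda>g. 1\<^sub>m 1)\<rparr>"

fun tensor_power :: "'a::field gl2_rep \<Rightarrow> nat \<Rightarrow> 'a gl2_rep" where
  "tensor_power M 0 = trivial_module"
| "tensor_power M (Suc n) = tensor (tensor_power M n) M"

definition Lambda_plus :: "nat \<Rightarrow> (nat \<times> nat) set" where
  "Lambda_plus m = {(l1, l2). l1 \<ge> l2 \<and> l1 + l2 = m}"

definition degenerate :: "nat \<times> nat \<Rightarrow> bool" where
  "degenerate l \<longleftrightarrow> snd l = 0"

text \<open>
  The dual Weyl module \<open>\<nabla>(\<lambda>)\<close> is the induced module \<open>ind\<^sub>B\<^sup>G K\<^sub>\<lambda>\<close>, with \<open>B\<close> the lower triangular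
  matrices: the regular functions \<open>f\<close> on \<open>G = GL\<^sub>2(K)\<close> satisfying \<open>f(bx) = \<lambda>(b) f(x)\<close>, with \<open>G\<close> acting
  by right translation \<open>(gf)(x) = f(xg)\<close>. (With this choice of \<open>B\<close> its highest weight is \<open>\<lambda>\<close>.)
  Functions are normalised to be \<open>0\<close> outside \<open>G\<close>, so that equality of functions is equality on \<open>G\<close>.
\<close>

definition lower_Borel :: "'a::field mat set" where
  "lower_Borel = {b \<in> GL2. b $$ (0,1) = 0}"

definition induced_space :: "nat \<times> nat \<Rightarrow> ('a::field mat \<Rightarrow> 'a) set" where
  "induced_space l = {f. regular_fun f \<and> (\<forall>x. x \<notin> GL2 \<longrightarrow> f x = 0) \<and>
     (\<forall>b\<in>lower_Borel. \<forall>x\<in>GL2. f (b * x) = b $$ (0,0) ^ fst l * b $$ (1,1) ^ snd l * f x)}"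

definition is_dual_Weyl :: "nat \<times> nat \<Rightarrow> 'a::field gl2_rep \<Rightarrow> bool" where
  "is_dual_Weyl l M \<longleftrightarrow> polynomial_module M \<and>
     (\<exists>\<Phi>. bij_betw \<Phi> (rspace M) (induced_space l) \<and>
        (\<forall>u\<in>rspace M. \<forall>v\<in>rspace M. \<forall>x. \<Phi> (u + v) x = \<Phi> u x + \<Phi> v x) \<and>
        (\<forall>c. \<forall>v\<in>rspace M. \<forall>x. \<Phi> (c \<cdot>\<^sub>v v) x = c * \<Phi> v x) \<and>
        (\<forall>g\<in>GL2. \<forall>v\<in>rspace M. \<forall>x\<in>GL2. \<Phi> (ract M g *\<^sub>v v) x = \<Phi> v (x * g)))"

text \<open>
  The contravariant dual of \<open>M\<close> is the dual space with \<open>(g\<phi>)(v) = \<phi>(g\<^sup>T v)\<close>, written in the dual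
  basis. The Weyl module \<open>\<Delta>(\<lambda>)\<close> is the contravariant dual of \<open>\<nabla>(\<lambda>)\<close>.
\<close>

definition contravariant_dual :: "'a::field gl2_rep \<Rightarrow> 'a gl2_rep" where
  "contravariant_dual M = \<lparr>rdim = rdim M,
     ract = (\<lambda>g. transpose_mat (ract M (transpose_mat g)))\<rparr>"

definition is_Weyl :: "nat \<times> nat \<Rightarrow> 'a::field gl2_rep \<Rightarrow> bool" where
  "is_Weyl l M \<longleftrightarrow> polynomial_module M \<and> is_dual_Weyl l (contravariant_dual M)"

definition submodule_of :: "'a::field gl2_rep \<Rightarrow> 'a vec set \<Rightarrow> bool" where
  "submodule_of M W \<longleftrightarrow> VectorSpace.subspace class_ring W (module_vec TYPE('a) (rdim M)) \<and>
     (\<forall>g\<in>GL2. \<forall>w\<in>W. ract M g *\<^sub>v w \<in> W)"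

text \<open>\<open>W/U \<cong> N\<close>, for submodules \<open>U \<subseteq> W\<close> of \<open>M\<close>: there is a surjective \<open>G\<close>-homomorphism
  \<open>f : W \<rightarrow> N\<close> with kernel \<open>U\<close>.\<close>

definition quotient_iso ::
  "'a::field gl2_rep \<Rightarrow> 'a vec set \<Rightarrow> 'a vec set \<Rightarrow> 'a gl2_rep \<Rightarrow> bool" where
  "quotient_iso M W U N \<longleftrightarrow> (\<exists>f.
     (\<forall>u\<in>W. \<forall>v\<in>W. f (u + v) = f u + f v) \<and>
     (\<forall>c. \<forall>v\<in>W. f (c \<cdot>\<^sub>v v) = c \<cdot>\<^sub>v f v) \<and>
     (\<forall>g\<in>GL2. \<forall>v\<in>W. f (ract M g *\<^sub>v v) = ract N g *\<^sub>v f v) \<and>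
     f ` W = rspace N \<and> {v \<in> W. f v = 0\<^sub>v (rdim N)} = U)"

definition has_filtration :: "('a::field gl2_rep \<Rightarrow> bool) \<Rightarrow> 'a gl2_rep \<Rightarrow> bool" where
  "has_filtration F M \<longleftrightarrow> (\<exists>(n::nat) V.
     V 0 = {0\<^sub>v (rdim M)} \<and> V n = rspace M \<and>
     (\<forall>i\<le>n. submodule_of M (V i)) \<and>
     (\<forall>i<n. V i \<subseteq> V (Suc i) \<and> (\<exists>N. F N \<and> quotient_iso M (V (Suc i)) (V i) N)))"

definition tilting :: "'a::field gl2_rep \<Rightarrow> bool" where
  "tilting M \<longleftrightarrow> polynomial_module M \<and>
     has_filtration (\<lambda>N. \<exists>m. \<exists>l\<in>Lambda_plus m. is_Weyl l N) M \<and>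
     has_filtration (\<lambda>N. \<exists>m. \<exists>l\<in>Lambda_plus m. is_dual_Weyl l N) M"

text \<open>Weights of polynomial modules have non-negative entries, so pairs of naturals suffice.\<close>

definition weight_space :: "'a::field gl2_rep \<Rightarrow> nat \<times> nat \<Rightarrow> 'a vec set" where
  "weight_space M l = {v \<in> rspace M. \<forall>s t. s \<noteq> 0 \<longrightarrow> t \<noteq> 0 \<longrightarrow>
     ract M (mat_diag 2 (\<lambda>i. if i = 0 then s else t)) *\<^sub>v v = (s ^ fst l * t ^ snd l) \<cdot>\<^sub>v v}"

definition is_weight :: "'a::field gl2_rep \<Rightarrow> nat \<times> nat \<Rightarrow> bool" where
  "is_weight M l \<longleftrightarrow> (\<exists>v\<in>weight_space M l. v \<noteq> 0\<^sub>v (rdim M))"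

definition dominance_le :: "nat \<times> nat \<Rightarrow> nat \<times> nat \<Rightarrow> bool" where
  "dominance_le m l \<longleftrightarrow> fst m + snd m = fst l + snd l \<and> fst m \<le> fst l"

definition highest_weight :: "'a::field gl2_rep \<Rightarrow> nat \<times> nat \<Rightarrow> bool" where
  "highest_weight M l \<longleftrightarrow> is_weight M l \<and> (\<forall>m. is_weight M m \<longrightarrow> dominance_le m l)"

text \<open>\<open>M\<close> is (a copy of) \<open>P(\<lambda>)\<close>, which is defined only up to isomorphism.\<close>

definition is_P :: "nat \<times> nat \<Rightarrow> 'a::field gl2_rep \<Rightarrow> bool" where
  "is_P l M \<longleftrightarrow> tilting M \<and> indecomposable M \<and> highest_weight M l"

end

(*
  Let F be the subfield of q = p^s elements of K, with s large, and L(t) the lower unipotent matrix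
  with entry t. Choose a with r + 2a equal to q or q - 1.

  P(q - 1, 0) is the Steinberg module St and P(q, 0) is a summand of the tensor product of St and E.
  St is free over the group algebra of {L(t) | t in F}, so on P(mu) the identity has the form
  sum_t L(t) theta L(t)^(-1) for a linear map theta. This property passes to tensor products P(mu) (x) X
  and their summands, and it implies that every vector fixed by all L(t) is a norm sum_t L(t) y.
  On P(lambda_1 + k, lambda_2 + k) the weights show that the entries of L(t) are polynomials in t of
  degree at most lambda_1 - lambda_2 < q - 1, so the norm vanishes there, while a lowest weight vector is a
  nonzero fixed vector.

  To obtain theta without the theory of St: a vector v and a functional phi of highest weight (or the
  corresponding data for St (x) E, which the filtrations provide) give an explicit endomorphism of P(mu) that
  factors through St or St (x) E and does not vanish on v; by Fitting's lemma it is invertible.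
*)
theory Submission
  imports Defs "HOL-Computational_Algebra.Polynomial" "HOL-Computational_Algebra.Primes"
begin

text \<open>The sum r + 2a has the parity of r, and exactly one of q and q - 1 has that parity;
  hence the two cases. In the case q - 1 a highest weight vector and a highest weight functional
  suffice.

  The case q is the obstacle. A Borel-equivariant map out of St (x) E needs, besides v, a vector w
  of weight (q - 1, 1) with U(z) w = w + z v, where U(z) is upper unipotent. In the Weyl module of
  highest weight (q, 0) raising from that weight is multiplication by q = 0, so no such w exists
  there. A dual Weyl factor provides w, a Weyl factor provides the corresponding functional, and
  this is how both filtrations enter.

  St itself is never built: its role is played by forms of degree q - 1 in the first column of g.
  Since the binomial coefficients of q - 1 are the signs (-1)^i in K, pairing the coefficients of
  two such forms with these signs is invariant. The pairing becomes a sum of conjugates because, for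
  exponents up to 2(q - 1), the power sums over F are -1 at q - 1 and 2(q - 1) and 0 elsewhere. The
  same power sums make the norm vanish on entries of degree below q - 1.\<close>

section \<open>Power sums over finite subfields\<close>

lemma infinite_UNIV_alg_closed: "infinite (UNIV :: 'a::alg_closed_field set)"
proof
  assume fin: "finite (UNIV :: 'a set)"
  define P :: "'a poly" where "P = (\<Prod>a\<in>UNIV. [:-a, 1:]) + 1"
  have deg: "degree (\<Prod>a\<in>(UNIV::'a set). [:-a, 1:]) = card (UNIV :: 'a set)"
    by (subst degree_prod_eq_sum_degree) auto
  have "card (UNIV :: 'a set) > 0" using fin by (simp add: card_gt_0_iff)
  hence "degree P > 0" unfolding P_def using deg
    by (subst degree_add_eq_left) auto
  then obtain x where "poly P x = 0" using alg_closed_imp_poly_has_root by blast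
  moreover have "poly (\<Prod>a\<in>(UNIV::'a set). [:-a, 1:]) x = 0"
    using fin by (subst poly_prod, subst prod_zero_iff) auto
  ultimately show False by (simp add: P_def)
qed

lemma poly_eqI_infinite:
  fixes p q :: "'a::idom poly"
  assumes "infinite A" "\<And>x. x \<in> A \<Longrightarrow> poly p x = poly q x"
  shows "p = q"
proof (rule ccontr)
  assume "p \<noteq> q"
  hence "finite {x. poly (p - q) x = 0}" by (intro poly_roots_finite) auto
  moreover have "A \<subseteq> {x. poly (p - q) x = 0}" using assms by auto
  ultimately show False using assms(1) finite_subset by blast
qed

lemma infinite_nonzero: "infinite {x::'a::alg_closed_field. x \<noteq> 0}"
proof -
  have "{x::'a. x \<noteq> 0} = UNIV - {0}" by auto
  thus ?thesis using infinite_UNIV_alg_closed by (metis infinite_remove)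
qed

text \<open>Coefficient comparison is phrased for power sums rather than polynomials because the
  coefficients compared later are matrix entries; \<open>A\<close> will be the whole field or its
  nonzero elements.\<close>

lemma power_sum_coeff_eqI:
  fixes c d :: "nat \<Rightarrow> 'a::idom"
  assumes "infinite A" "\<And>z. z \<in> A \<Longrightarrow> (\<Sum>i\<le>n. z ^ i * c i) = (\<Sum>i\<le>n. z ^ i * d i)" "i \<le> n"
  shows "c i = d i"
proof -
  define P where "P c = (\<Sum>i\<le>n. monom (c i) i)" for c :: "nat \<Rightarrow> 'a"
  have P: "poly (P c) z = (\<Sum>i\<le>n. z ^ i * c i)" for z c
    by (simp add: P_def poly_sum poly_monom mult.commute)
  have "P c = P d" using assms by (intro poly_eqI_infinite[of A]) (auto simp: P)
  moreover have "coeff (P c) i = c i" for c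
    using assms(3) by (simp add: P_def coeff_sum)
  ultimately show ?thesis by metis
qed

text \<open>The derivative of X^q - X is -1 once q vanishes in the field, so all its roots are
  simple and there are q of them. For q a power of the characteristic the set is the subfield of q
  elements.\<close>

lemma card_fixed_points_power:
  fixes q :: nat
  assumes "q > 1" "(of_nat q :: 'a::alg_closed_field) = 0"
  shows "finite {t::'a. t ^ q = t}" "card {t::'a. t ^ q = t} = q"
proof -
  define P :: "'a poly" where "P = monom 1 q - monom 1 1"
  have deg: "degree P = q" unfolding P_def using assms(1)
    by (subst diff_conv_add_uminus, subst degree_add_eq_left) (auto simp: degree_monom_eq)
  have P0: "P \<noteq> 0" using deg assms(1) by auto
  have roots: "{t::'a. t ^ q = t} = {t. poly P t = 0}" by (auto simp: P_def poly_monom)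
  show fin: "finite {t::'a. t ^ q = t}" unfolding roots by (rule poly_roots_finite[OF P0])
  have deriv: "pderiv P = -1" unfolding P_def using assms(2)
    by (simp add: pderiv_diff pderiv_monom flip: one_pCons)
  obtain A where A: "size A = degree P" "P = Polynomial.smult (lead_coeff P) (\<Prod>x\<in>#A. [:-x, 1:])"
    using alg_closed_imp_factorization[OF P0] by blast
  define c where "c = lead_coeff P"
  have c: "c \<noteq> 0" "P = Polynomial.smult c (\<Prod>x\<in>#A. [:-x, 1:])"
    using A(2) P0 by (auto simp: c_def)
  \<comment> \<open>A repeated linear factor would force the derivative, which is -1, to vanish at
    \<open>a\<close>.\<close>
  have "count A a \<le> 1" for a
  proof (rule ccontr)
    assume "\<not> ?thesis"
    hence "a \<in># A" "a \<in># A - {#a#}"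
      by (auto simp: not_le in_diff_count count_greater_zero_iff[symmetric] simp del: count_greater_zero_iff)
    then obtain B where "A = add_mset a (add_mset a B)" by (metis insert_DiffM)
    hence "P = [:-a, 1:] * ([:-a, 1:] * Polynomial.smult c (\<Prod>x\<in>#B. [:-x, 1:]))"
      using c(2) by (simp add: mult_smult_right del: mult_pCons_left)
    then obtain Q where "P = [:-a, 1:] * ([:-a, 1:] * Q)" ..
    hence "poly (pderiv P) a = 0"
      by (simp add: pderiv_mult del: mult_pCons_left)
    thus False using deriv by simp
  qed
  hence "A = mset_set (set_mset A)"
    by (intro multiset_eqI) (metis One_nat_def Suc_leI count_eq_zero_iff count_greater_zero_iff
        count_mset_set' finite_set_mset le_antisym)
  hence "size A = card (set_mset A)" by (metis size_mset_set)
  also have "set_mset A = {t. poly P t = 0}"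
    using c(1) by (auto simp: c(2) poly_prod_mset prod_mset_zero_iff)
  finally show "card {t::'a. t ^ q = t} = q" using A(1) deg roots by simp
qed

text \<open>Multiplication by a nonzero element y permutes \<open>F\<close> and rescales the sum by
  y^n, so the sum vanishes as soon as some y^n differs from 1. The range reaches 2(q - 1) because
  products of two forms of degree q - 1 are summed over \<open>F\<close> later; there the value at
  the upper end matters.\<close>

lemma sum_powers_fixed_points:
  fixes q n :: nat
  defines "F \<equiv> {t::'a::alg_closed_field. t ^ q = t}"
  assumes q: "q > 1" "(of_nat q :: 'a) = 0" and n: "n \<le> 2 * (q - 1)"
  shows "(\<Sum>t\<in>F. t ^ n) = (if n = q - 1 \<or> n = 2 * (q - 1) then -1 else 0)"
proof -
  have fin: "finite F" and card: "card F = q"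
    using card_fixed_points_power[OF q] by (auto simp: F_def)
  have F0: "0 \<in> F" using q by (simp add: F_def)
  have unit: "t ^ (q - 1) = 1" if "t \<in> F" "t \<noteq> 0" for t
  proof -
    have "t * t ^ (q - 1) = t" using that q by (simp add: F_def flip: power_Suc)
    thus ?thesis using that by simp
  qed
  \<comment> \<open>The inequality is strict because at n = q - 1 the term for t = 0 would change
    from 0 to 0^0 = 1.\<close>
  have red: "(\<Sum>t\<in>F. t ^ n) = (\<Sum>t\<in>F. t ^ (n - (q - 1)))" if "n > q - 1" for n
  proof (rule sum.cong)
    fix t assume "t \<in> F"
    have "n = (q - 1) + (n - (q - 1))" using that by simp
    hence "t ^ n = t ^ (q - 1) * t ^ (n - (q - 1))" by (metis power_add)
    thus "t ^ n = t ^ (n - (q - 1))"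
      using unit[OF \<open>t \<in> F\<close>] that by (cases "t = 0") auto
  qed auto
  have top: "(\<Sum>t\<in>F. t ^ (q - 1)) = -1"
  proof -
    have "(\<Sum>t\<in>F. t ^ (q - 1)) = (\<Sum>t\<in>F - {0}. t ^ (q - 1))"
      by (rule sum.mono_neutral_right) (use fin q in auto)
    also have "\<dots> = (\<Sum>t\<in>F - {0}. 1)" by (rule sum.cong) (use unit in auto)
    also have "\<dots> = of_nat (q - 1)" using card F0 fin by simp
    also have "\<dots> = -1" using q by (simp add: of_nat_diff)
    finally show ?thesis .
  qed
  have small: "(\<Sum>t\<in>F. t ^ n) = 0" if "n < q - 1" for n
  proof (cases "n = 0")
    case True
    thus ?thesis using card q by simp
  next
    case False
    \<comment> \<open>The equation y^n = 1 has at most n < q - 1 solutions, fewer than the nonzero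
      elements of \<open>F\<close>.\<close>
    have "\<exists>y\<in>F - {0}. y ^ n \<noteq> 1"
    proof (rule ccontr)
      assume "\<not> ?thesis"
      hence sub: "F - {0} \<subseteq> {y. poly (monom 1 n - 1) y = 0}" by (auto simp: poly_monom)
      have deg: "degree (monom 1 n - 1 :: 'a poly) = n" using False
        by (subst diff_conv_add_uminus, subst degree_add_eq_left) (auto simp: degree_monom_eq)
      hence ne: "(monom 1 n - 1 :: 'a poly) \<noteq> 0" using False by auto
      have "q - 1 = card (F - {0})" using card F0 fin by simp
      also have "\<dots> \<le> card {y. poly (monom 1 n - 1 :: 'a poly) y = 0}"
        by (intro card_mono poly_roots_finite ne sub)
      also have "\<dots> \<le> n" using card_poly_roots_bound[OF ne] deg by simp
      finally show False using that by simp
    qed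
    then obtain y where y: "y \<in> F" "y \<noteq> 0" "y ^ n \<noteq> 1" by auto
    have closed: "a * t \<in> F" if "a \<in> F" "t \<in> F" for a t
      using that by (simp add: F_def power_mult_distrib)
    have "bij_betw (\<lambda>t. y * t) F F"
      unfolding bij_betw_def
    proof
      show inj: "inj_on (\<lambda>t. y * t) F" using y(2) by (auto simp: inj_on_def)
      show "(\<lambda>t. y * t) ` F = F"
        using closed[OF y(1)] by (intro endo_inj_surj[OF fin _ inj]) auto
    qed
    hence "(\<Sum>t\<in>F. t ^ n) = (\<Sum>t\<in>F. (y * t) ^ n)"
      by (rule sum.reindex_bij_betw[symmetric])
    also have "\<dots> = y ^ n * (\<Sum>t\<in>F. t ^ n)" by (simp add: power_mult_distrib sum_distrib_left)
    finally have "(y ^ n - 1) * (\<Sum>t\<in>F. t ^ n) = 0" by (simp add: algebra_simps)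
    thus ?thesis using y(3) by simp
  qed
  consider "n < q - 1" | "n = q - 1" | "n > q - 1" "n < 2 * (q - 1)" | "n = 2 * (q - 1)" "n > q - 1"
    using n q by linarith
  thus ?thesis
  proof cases
    case 3
    thus ?thesis using red[of n] small[of "n - (q - 1)"] by simp
  next
    case 4
    hence "n - (q - 1) = q - 1" by simp
    thus ?thesis using red[of n] top 4 by simp
  qed (use top small q in auto)
qed

text \<open>By the Frobenius the middle coefficients of (1 + X)^q vanish, and Pascal's rule then
  makes neighbouring entries of row q - 1 opposite. These signs will be the entries of the invariant
  form on St; they are what distinguishes the degree q - 1.\<close>

lemma binomial_prime_power_minus_one:
  fixes p s q i :: nat
  assumes char: "CHAR('a::field) = p" "p > 0" "q = p ^ s" and "i \<le> q - 1"
  shows "(of_nat ((q - 1) choose i) :: 'a) = (-1) ^ i"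
proof -
  have prime: "prime CHAR('a)" using char by (intro prime_CHAR_semidom) auto
  have q0: "q > 0" using char by simp
  have mid: "(of_nat (q choose j) :: 'a) = 0" if "0 < j" "j < q" for j
  proof -
    have "([:1, 1:] :: 'a poly) ^ q = ([:0, 1:] + 1) ^ q" by (simp add: one_pCons)
    also have "\<dots> = [:0, 1:] ^ q + 1"
      using freshmans_dream'[of q s "[:0, 1:] :: 'a poly" 1] prime char by simp
    finally have "coeff ([:1, 1:] ^ q) j = coeff ([:0, 1:] ^ q + 1 :: 'a poly) j" by simp
    moreover have "coeff ([:1, 1:] ^ q :: 'a poly) j = of_nat (q choose j)"
      using that by (subst coeff_linear_poly_power) auto
    moreover have "coeff ([:0, 1:] ^ q + 1 :: 'a poly) j = 0"
      using that by (simp add: coeff_linear_poly_power)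
    ultimately show ?thesis by simp
  qed
  show ?thesis using \<open>i \<le> q - 1\<close>
  proof (induction i)
    case (Suc i)
    have "q choose Suc i = ((q - 1) choose i) + ((q - 1) choose Suc i)"
      using q0 by (metis Suc_diff_1 binomial_Suc_Suc)
    hence "(of_nat (q choose Suc i) :: 'a) = of_nat ((q - 1) choose i) + of_nat ((q - 1) choose Suc i)"
      by simp
    moreover have "(of_nat (q choose Suc i) :: 'a) = 0" using Suc.prems q0 by (intro mid) auto
    ultimately have "of_nat ((q - 1) choose Suc i) = - (of_nat ((q - 1) choose i) :: 'a)"
      by (metis add_eq_0_iff)
    thus ?case using Suc by simp
  qed simp
qed

section \<open>Polynomial matrix functions on \<open>GL\<^sub>2\<close>\<close>

definition mat2 :: "'a \<Rightarrow> 'a \<Rightarrow> 'a \<Rightarrow> 'a \<Rightarrow> 'a mat" where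
  "mat2 a b c d = mat 2 2 (\<lambda>(i, j). if i = 0 then (if j = 0 then a else b) else (if j = 0 then c else d))"

lemma mat2_carrier [simp]: "mat2 a b c d \<in> carrier_mat 2 2"
  by (simp add: mat2_def)

lemma mat2_dim [simp]: "dim_row (mat2 a b c d) = 2" "dim_col (mat2 a b c d) = 2"
  by (simp_all add: mat2_def)

lemma mat2_index [simp]:
  "mat2 a b c d $$ (0, 0) = a" "mat2 a b c d $$ (0, Suc 0) = b"
  "mat2 a b c d $$ (Suc 0, 0) = c" "mat2 a b c d $$ (Suc 0, Suc 0) = d"
  by (simp_all add: mat2_def)

lemma mat2_eta: "g \<in> carrier_mat 2 2 \<Longrightarrow> mat2 (g $$ (0,0)) (g $$ (0,1)) (g $$ (1,0)) (g $$ (1,1)) = g"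
  by (intro eq_matI) (auto simp: mat2_def less_2_cases_iff)

lemma mat2_mult:
  fixes a :: "'a::semiring_0"
  shows "mat2 a b c d * mat2 a' b' c' d' =
    mat2 (a * a' + b * c') (a * b' + b * d') (c * a' + d * c') (c * b' + d * d')"
  by (intro eq_matI) (auto simp: less_2_cases_iff scalar_prod_def numeral_2_eq_2 mat2_def)

lemma det_mat2 [simp]: "det (mat2 a b c d :: 'a::comm_ring_1 mat) = a * d - b * c"
  by (subst laplace_expansion_column[of _ 2 0])
     (auto simp: numeral_2_eq_2 cofactor_def det_single mat_delete_def lessThan_Suc mat2_def algebra_simps)

lemma mat2_one: "mat2 1 0 0 1 = (1\<^sub>m 2 :: 'a::{zero,one} mat)"
  by (intro eq_matI) (auto simp: less_2_cases_iff mat2_def)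

lemma mat2_eq_iff [simp]: "mat2 a b c d = mat2 a' b' c' d' \<longleftrightarrow> a = a' \<and> b = b' \<and> c = c' \<and> d = d'"
  by (metis mat2_index)

lemma transpose_mat2 [simp]: "transpose_mat (mat2 a b c d) = mat2 a c b d"
  by (intro eq_matI) (auto simp: less_2_cases_iff mat2_def)

lemma mat_diag_mat2: "mat_diag 2 (\<lambda>i. if i = 0 then s else t) = mat2 s 0 0 (t::'a::zero)"
  by (intro eq_matI) (auto simp: less_2_cases_iff mat2_def mat_diag_def)

lemma mat2_in_GL2 [simp]: "mat2 a b c d \<in> GL2 \<longleftrightarrow> a * d - b * c \<noteq> (0::'a::field)"
  by (simp add: GL2_def)

lemma GL2_cases:
  assumes "g \<in> GL2"
  obtains a b c d where "g = mat2 a b c d" "a * d - b * c \<noteq> (0::'a::field)"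
proof (rule that)
  have "g \<in> carrier_mat 2 2" using assms by (simp add: GL2_def)
  thus "g = mat2 (g $$ (0,0)) (g $$ (0,1)) (g $$ (1,0)) (g $$ (1,1))" by (rule mat2_eta[symmetric])
  hence "mat2 (g $$ (0,0)) (g $$ (0,1)) (g $$ (1,0)) (g $$ (1,1)) \<in> GL2" using assms by simp
  thus "g $$ (0,0) * g $$ (1,1) - g $$ (0,1) * g $$ (1,0) \<noteq> 0" by (simp only: mat2_in_GL2 not_False_eq_True)
qed

lemma GL2_mult: "g \<in> GL2 \<Longrightarrow> h \<in> GL2 \<Longrightarrow> g * h \<in> GL2"
  by (auto simp: GL2_def det_mult)

lemma GL2_transpose [simp]: "g \<in> GL2 \<Longrightarrow> transpose_mat g \<in> GL2"
  by (auto simp: GL2_def det_transpose)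

lemma GL2_carrier: "g \<in> GL2 \<Longrightarrow> g \<in> carrier_mat 2 2"
  by (simp add: GL2_def)

section \<open>Unipotent elements and finite sums of matrices\<close>

abbreviation lower_unip :: "'a::field \<Rightarrow> 'a mat" where "lower_unip z \<equiv> mat2 1 0 z 1"
abbreviation upper_unip :: "'a::field \<Rightarrow> 'a mat" where "upper_unip z \<equiv> mat2 1 z 0 1"
abbreviation weyl :: "'a::field mat" where "weyl \<equiv> mat2 0 1 1 0"

text \<open>Matrices of all sizes share one type, so a sum over an index set has no canonical zero;
  the dimensions are therefore arguments.\<close>

definition mat_sum :: "nat \<Rightarrow> nat \<Rightarrow> ('i \<Rightarrow> 'a::comm_monoid_add mat) \<Rightarrow> 'i set \<Rightarrow> 'a mat" where
  "mat_sum n m F S = mat n m (\<lambda>ij. \<Sum>t\<in>S. F t $$ ij)"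

lemma mat_sum_carrier [simp]: "mat_sum n m F S \<in> carrier_mat n m"
  by (simp add: mat_sum_def)

lemma mat_sum_dim [simp]: "dim_row (mat_sum n m F S) = n" "dim_col (mat_sum n m F S) = m"
  by (simp_all add: mat_sum_def)

lemma mat_sum_index [simp]:
  "i < n \<Longrightarrow> j < m \<Longrightarrow> mat_sum n m F S $$ (i, j) = (\<Sum>t\<in>S. F t $$ (i, j))"
  by (simp add: mat_sum_def)

lemma mat_sum_cong: "S = S' \<Longrightarrow> (\<And>t. t \<in> S' \<Longrightarrow> F t = F' t) \<Longrightarrow> mat_sum n m F S = mat_sum n m F' S'"
  by (auto simp: mat_sum_def intro!: cong_mat sum.cong)

lemma mult_index_sum:
  "A \<in> carrier_mat n k \<Longrightarrow> B \<in> carrier_mat k m \<Longrightarrow> i < n \<Longrightarrow> j < m \<Longrightarrow>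
    (A * B) $$ (i, j) = (\<Sum>l<k. A $$ (i, l) * B $$ (l, j))"
  by (auto simp: scalar_prod_def atLeast0LessThan)

lemma mult_mat_sum:
  fixes A :: "'a::semiring_0 mat"
  assumes "A \<in> carrier_mat k n" "\<And>t. t \<in> S \<Longrightarrow> F t \<in> carrier_mat n m"
  shows "A * mat_sum n m F S = mat_sum k m (\<lambda>t. A * F t) S"
proof (rule eq_matI)
  fix i j assume ij: "i < dim_row (mat_sum k m (\<lambda>t. A * F t) S)" "j < dim_col (mat_sum k m (\<lambda>t. A * F t) S)"
  hence "(A * mat_sum n m F S) $$ (i, j) = (\<Sum>l<n. A $$ (i, l) * (\<Sum>t\<in>S. F t $$ (l, j)))"
    using assms(1) by (subst mult_index_sum) auto
  also have "\<dots> = (\<Sum>t\<in>S. \<Sum>l<n. A $$ (i, l) * F t $$ (l, j))"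
    by (subst sum.swap) (simp add: sum_distrib_left)
  also have "\<dots> = (\<Sum>t\<in>S. (A * F t) $$ (i, j))"
    using assms ij by (intro sum.cong refl mult_index_sum[symmetric]) auto
  finally show "(A * mat_sum n m F S) $$ (i, j) = mat_sum k m (\<lambda>t. A * F t) S $$ (i, j)"
    using ij by simp
qed (use assms in auto)

lemma mat_sum_mult:
  fixes A :: "'a::semiring_0 mat"
  assumes "A \<in> carrier_mat m k" "\<And>t. t \<in> S \<Longrightarrow> F t \<in> carrier_mat n m"
  shows "mat_sum n m F S * A = mat_sum n k (\<lambda>t. F t * A) S"
proof (rule eq_matI)
  fix i j assume ij: "i < dim_row (mat_sum n k (\<lambda>t. F t * A) S)" "j < dim_col (mat_sum n k (\<lambda>t. F t * A) S)"
  hence "(mat_sum n m F S * A) $$ (i, j) = (\<Sum>l<m. (\<Sum>t\<in>S. F t $$ (i, l)) * A $$ (l, j))"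
    using assms(1) by (subst mult_index_sum) auto
  also have "\<dots> = (\<Sum>t\<in>S. \<Sum>l<m. F t $$ (i, l) * A $$ (l, j))"
    by (subst sum.swap) (simp add: sum_distrib_right)
  also have "\<dots> = (\<Sum>t\<in>S. (F t * A) $$ (i, j))"
    using assms ij by (intro sum.cong refl mult_index_sum[symmetric]) auto
  finally show "(mat_sum n m F S * A) $$ (i, j) = mat_sum n k (\<lambda>t. F t * A) S $$ (i, j)"
    using ij by simp
qed (use assms in auto)

lemma transpose_mat_sum:
  assumes "\<And>t. t \<in> S \<Longrightarrow> F t \<in> carrier_mat n m"
  shows "transpose_mat (mat_sum n m F S) = mat_sum m n (\<lambda>t. transpose_mat (F t)) S"
proof (rule eq_matI)
  fix i j assume ij: "i < dim_row (mat_sum m n (\<lambda>t. transpose_mat (F t)) S)"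
    "j < dim_col (mat_sum m n (\<lambda>t. transpose_mat (F t)) S)"
  have "transpose_mat (F t) $$ (i, j) = F t $$ (j, i)" if "t \<in> S" for t
    using ij assms[OF that] by simp
  thus "transpose_mat (mat_sum n m F S) $$ (i, j) = mat_sum m n (\<lambda>t. transpose_mat (F t)) S $$ (i, j)"
    using ij by simp
qed auto

section \<open>Polynomial functions of one variable and matrices of such functions\<close>

definition poly_fun :: "('a::comm_semiring_0 \<Rightarrow> 'a) \<Rightarrow> bool" where
  "poly_fun f \<longleftrightarrow> (\<exists>p. \<forall>z. f z = poly p z)"

named_theorems poly_fun_intros

lemma poly_funE:
  assumes "poly_fun f"
  obtains p where "f = poly p"
  using assms unfolding poly_fun_def by auto

lemma poly_fun_const [poly_fun_intros]: "poly_fun (\<lambda>z. c)"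
  unfolding poly_fun_def by (rule exI[of _ "[:c:]"]) simp

lemma poly_fun_ident [poly_fun_intros]: "poly_fun (\<lambda>z::'a::comm_semiring_1. z)"
  unfolding poly_fun_def by (rule exI[of _ "[:0, 1:]"]) simp

lemma poly_fun_add [poly_fun_intros]: "poly_fun f \<Longrightarrow> poly_fun g \<Longrightarrow> poly_fun (\<lambda>z. f z + g z)"
  unfolding poly_fun_def by (metis poly_add)

lemma poly_fun_mult [poly_fun_intros]: "poly_fun f \<Longrightarrow> poly_fun g \<Longrightarrow> poly_fun (\<lambda>z. f z * g z)"
  unfolding poly_fun_def by (metis poly_mult)

lemma poly_fun_uminus [poly_fun_intros]:
  "poly_fun f \<Longrightarrow> poly_fun (\<lambda>z. - f z :: 'a::comm_ring)"
  unfolding poly_fun_def by (metis poly_minus)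

lemma poly_fun_diff [poly_fun_intros]:
  "poly_fun f \<Longrightarrow> poly_fun g \<Longrightarrow> poly_fun (\<lambda>z. f z - g z :: 'a::comm_ring)"
  unfolding poly_fun_def by (metis poly_diff)

lemma poly_fun_power [poly_fun_intros]:
  "poly_fun f \<Longrightarrow> poly_fun (\<lambda>z. f z ^ k :: 'a::comm_semiring_1)"
  unfolding poly_fun_def by (metis poly_power)

lemma poly_fun_sum [poly_fun_intros]:
  "(\<And>i. i \<in> S \<Longrightarrow> poly_fun (f i)) \<Longrightarrow> poly_fun (\<lambda>z. \<Sum>i\<in>S. f i z)"
  by (induction S rule: infinite_finite_induct) (auto intro: poly_fun_intros)

lemma poly_fun_eqI:
  fixes f g :: "'a::idom \<Rightarrow> 'a"
  assumes "poly_fun f" "poly_fun g" "infinite A" "\<And>z. z \<in> A \<Longrightarrow> f z = g z"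
  shows "f z = g z"
proof -
  obtain p q where "f = poly p" "g = poly q" using assms(1,2) by (elim poly_funE)
  thus ?thesis using poly_eqI_infinite[OF assms(3), of p q] assms(4) by auto
qed

text \<open>Polynomiality of z^e f(1/z) bounds the pole of f at infinity by e. The degree bounds for
  unipotent actions below all come from here; the reflected function is supplied by the second chart
  of the projective line or by scaling with the torus.\<close>

lemma poly_fun_bounded_degree:
  fixes f g :: "'a::alg_closed_field \<Rightarrow> 'a"
  assumes f: "poly_fun f" and g: "poly_fun g"
    and refl: "\<And>z. z \<noteq> 0 \<Longrightarrow> g z = z ^ e * f (inverse z)"
  shows "\<exists>c. \<forall>z. f z = (\<Sum>i\<le>e. z ^ i * c i)"
proof -
  obtain p where p: "f = poly p" using f by (rule poly_funE)
  obtain p' where p': "g = poly p'" using g by (rule poly_funE)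
  \<comment> \<open>Multiplying by a power of z turns the hypothesis into an identity of
    polynomials. The coefficient of z^e is the leading coefficient of \<open>p\<close> on the right,
    but 0 on the left if \<open>degree p > e\<close>.\<close>
  have eq: "monom 1 (degree p) * p' = monom 1 e * reflect_poly p"
  proof (rule poly_eqI_infinite[OF infinite_nonzero])
    fix z :: 'a assume "z \<in> {x. x \<noteq> 0}"
    thus "poly (monom 1 (degree p) * p') z = poly (monom 1 e * reflect_poly p) z"
      using refl[of z] by (simp add: poly_monom poly_reflect_poly_nz p p')
  qed
  have "degree p \<le> e"
  proof (rule ccontr)
    assume "\<not> degree p \<le> e"
    hence "coeff (monom 1 (degree p) * p') e = 0" by (simp add: coeff_monom_mult)
    hence "lead_coeff p = 0" unfolding eq by (simp add: coeff_monom_mult)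
    thus False using \<open>\<not> degree p \<le> e\<close> by simp
  qed
  hence "f z = (\<Sum>i\<le>e. z ^ i * coeff p i)" for z
    unfolding p poly_altdef
    by (intro sum.mono_neutral_cong_left) (auto simp: coeff_eq_0)
  thus ?thesis by blast
qed

definition poly_mat :: "nat \<Rightarrow> nat \<Rightarrow> ('a::comm_semiring_0 \<Rightarrow> 'a mat) \<Rightarrow> bool" where
  "poly_mat n m F \<longleftrightarrow> (\<forall>z. F z \<in> carrier_mat n m) \<and> (\<forall>i<n. \<forall>j<m. poly_fun (\<lambda>z. F z $$ (i, j)))"

lemma poly_mat_const: "A \<in> carrier_mat n m \<Longrightarrow> poly_mat n m (\<lambda>z. A)"
  by (auto simp: poly_mat_def intro: poly_fun_intros)

lemma poly_mat_mult:
  assumes "poly_mat n k F" "poly_mat k m G"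
  shows "poly_mat n m (\<lambda>z. F z * G z)"
proof -
  have FG: "F z \<in> carrier_mat n k" "G z \<in> carrier_mat k m" for z
    using assms by (auto simp: poly_mat_def)
  show ?thesis unfolding poly_mat_def
  proof (intro conjI allI impI)
    fix i j assume ij: "i < n" "j < m"
    have "(\<lambda>z. (F z * G z) $$ (i, j)) = (\<lambda>z. \<Sum>l<k. F z $$ (i, l) * G z $$ (l, j))"
      using mult_index_sum[OF FG ij] by auto
    moreover have "poly_fun \<dots>"
      using assms ij by (intro poly_fun_intros) (auto simp: poly_mat_def)
    ultimately show "poly_fun (\<lambda>z. (F z * G z) $$ (i, j))" by simp
  qed (use FG in \<open>auto intro: mult_carrier_mat\<close>)
qed

lemma poly_mat_smult:
  assumes "poly_fun c" "poly_mat n m F"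
  shows "poly_mat n m (\<lambda>z. c z \<cdot>\<^sub>m F z)"
proof -
  have F: "F z \<in> carrier_mat n m" for z using assms by (auto simp: poly_mat_def)
  show ?thesis using assms F unfolding poly_mat_def
    by (auto intro!: poly_fun_intros simp: carrier_matD[OF F])
qed

lemma poly_mat_sum:
  assumes "\<And>t. t \<in> S \<Longrightarrow> poly_mat n m (F t)"
  shows "poly_mat n m (\<lambda>z. mat_sum n m (\<lambda>t. F t z) S)"
  using assms unfolding poly_mat_def by (auto intro!: poly_fun_intros)

lemma poly_mat_eqI:
  fixes F G :: "'a::idom \<Rightarrow> 'a mat"
  assumes F: "poly_mat n m F" and G: "poly_mat n m G"
    and "infinite A" "\<And>z. z \<in> A \<Longrightarrow> F z = G z"
  shows "F z = G z"
proof (rule eq_matI)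
  have dims: "F z \<in> carrier_mat n m" "G z \<in> carrier_mat n m" using F G by (auto simp: poly_mat_def)
  show "dim_row (F z) = dim_row (G z)" "dim_col (F z) = dim_col (G z)" using dims by auto
  fix i j assume "i < dim_row (G z)" "j < dim_col (G z)"
  hence "i < n" "j < m" using dims by auto
  thus "F z $$ (i, j) = G z $$ (i, j)"
    using F G assms(3) poly_fun_eqI[of "\<lambda>z. F z $$ (i, j)" "\<lambda>z. G z $$ (i, j)" A z]
    by (simp add: poly_mat_def assms(4))
qed

text \<open>The curve has to stay inside \<open>GL2\<close> for every z because
  \<open>polynomial_fun\<close> says nothing about other arguments. The curves inserted later
  therefore have constant determinant.\<close>

lemma polynomial_fun_poly_fun:
  fixes f :: "'a::field mat \<Rightarrow> 'a"
  assumes "polynomial_fun f" "poly_fun a" "poly_fun b" "poly_fun c" "poly_fun d"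
    and "\<And>z. a z * d z - b z * c z \<noteq> 0"
  shows "poly_fun (\<lambda>z. f (mat2 (a z) (b z) (c z) (d z)))"
proof -
  obtain S k where f: "\<And>x. x \<in> GL2 \<Longrightarrow> f x = (\<Sum>(i, j, l, m)\<in>S. k (i, j, l, m) *
        x $$ (0,0) ^ i * x $$ (0,1) ^ j * x $$ (1,0) ^ l * x $$ (1,1) ^ m)"
    using assms(1) unfolding polynomial_fun_def by blast
  have "(\<lambda>z. f (mat2 (a z) (b z) (c z) (d z))) =
    (\<lambda>z. \<Sum>(i, j, l, m)\<in>S. k (i, j, l, m) * a z ^ i * b z ^ j * c z ^ l * d z ^ m)"
    using assms(6) by (subst f) auto
  moreover have "poly_fun \<dots>"
    unfolding case_prod_unfold using assms by (intro poly_fun_intros) auto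
  ultimately show ?thesis by simp
qed

section \<open>Matrix coefficients of polynomial modules and the contravariant dual\<close>

lemma
  assumes "polynomial_module M"
  shows ract_carrier: "g \<in> GL2 \<Longrightarrow> ract M g \<in> carrier_mat (rdim M) (rdim M)"
    and ract_one: "ract M (1\<^sub>m 2) = 1\<^sub>m (rdim M)"
    and ract_mult: "g \<in> GL2 \<Longrightarrow> h \<in> GL2 \<Longrightarrow> ract M (g * h) = ract M g * ract M h"
    and ract_polynomial: "i < rdim M \<Longrightarrow> j < rdim M \<Longrightarrow> polynomial_fun (\<lambda>g. ract M g $$ (i, j))"
  using assms unfolding polynomial_module_def by blast+

lemma ract_poly_mat:
  assumes "polynomial_module M" "poly_fun a" "poly_fun b" "poly_fun c" "poly_fun d"
    and "\<And>z. a z * d z - b z * c z \<noteq> 0"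
  shows "poly_mat (rdim M) (rdim M) (\<lambda>z. ract M (mat2 (a z) (b z) (c z) (d z)))"
  unfolding poly_mat_def
proof (intro conjI allI impI)
  fix i j assume "i < rdim M" "j < rdim M"
  from polynomial_fun_poly_fun[OF ract_polynomial[OF assms(1) this] assms(2-5)]
  show "poly_fun (\<lambda>z. ract M (mat2 (a z) (b z) (c z) (d z)) $$ (i, j))" using assms(6) by auto
qed (use assms in \<open>auto intro: ract_carrier\<close>)

lemma mat_assoc:
  fixes A :: "'a::semiring_0 mat"
  assumes "dim_col A = dim_row B" "dim_col B = dim_row C"
  shows "(A * B) * C = A * (B * C)"
  by (rule assoc_mult_mat[of A "dim_row A" "dim_row B" B "dim_row C" C "dim_col C"])
     (use assms in \<open>auto intro!: carrier_matI\<close>)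

lemma ract_dim:
  assumes "polynomial_module M" "g \<in> GL2"
  shows "dim_row (ract M g) = rdim M" "dim_col (ract M g) = rdim M"
  using ract_carrier[OF assms] by auto

lemma polynomial_fun_transpose:
  assumes "polynomial_fun f"
  shows "polynomial_fun (\<lambda>g. f (transpose_mat g))"
proof -
  obtain S k where S: "finite S" and f: "\<And>x. x \<in> GL2 \<Longrightarrow> f x = (\<Sum>(i, j, l, m)\<in>S. k (i, j, l, m) *
        x $$ (0,0) ^ i * x $$ (0,1) ^ j * x $$ (1,0) ^ l * x $$ (1,1) ^ m)"
    using assms unfolding polynomial_fun_def by blast
  define h :: "nat \<times> nat \<times> nat \<times> nat \<Rightarrow> nat \<times> nat \<times> nat \<times> nat" where "h = (\<lambda>(i, j, l, m). (i, l, j, m))"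
  have h: "inj_on h S" by (auto simp: h_def inj_on_def)
  show ?thesis unfolding polynomial_fun_def
  proof (rule exI[of _ "h ` S"], rule exI[of _ "\<lambda>x. k (h x)"], intro conjI ballI)
    fix x :: "'a mat" assume x: "x \<in> GL2"
    hence "x \<in> carrier_mat 2 2" by (rule GL2_carrier)
    thus "f (transpose_mat x) = (\<Sum>(i, j, l, m)\<in>h ` S. k (h (i, j, l, m)) *
        x $$ (0,0) ^ i * x $$ (0,1) ^ j * x $$ (1,0) ^ l * x $$ (1,1) ^ m)"
      using x by (subst sum.reindex[OF h], subst f) (auto simp: h_def algebra_simps intro!: sum.cong)
  qed (use S in auto)
qed

lemma contravariant_dual_simps [simp]:
  "rdim (contravariant_dual M) = rdim M"
  "ract (contravariant_dual M) g = transpose_mat (ract M (transpose_mat g))"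
  by (simp_all add: contravariant_dual_def)

text \<open>Functionals on M are vectors of this module, and lower triangular matrices become upper
  triangular ones. Statements about highest weight functionals thus follow from those about highest
  weight vectors.\<close>

lemma polynomial_module_contravariant_dual:
  assumes "polynomial_module M"
  shows "polynomial_module (contravariant_dual M)"
  unfolding polynomial_module_def
proof (intro conjI ballI allI impI)
  fix g h :: "'a mat" assume g: "g \<in> GL2" and h: "h \<in> GL2"
  have "transpose_mat (g * h) = transpose_mat h * transpose_mat g"
    using g h by (intro transpose_mult[of _ 2 2 _ 2] GL2_carrier)
  thus "ract (contravariant_dual M) (g * h) = ract (contravariant_dual M) g * ract (contravariant_dual M) h"
    using g h assms ract_carrier[OF assms]
    by (simp add: ract_mult transpose_mult[of _ "rdim M" "rdim M" _ "rdim M"])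
next
  fix i j assume ij: "i < rdim (contravariant_dual M)" "j < rdim (contravariant_dual M)"
  have "polynomial_fun (\<lambda>g. ract M (transpose_mat g) $$ (j, i))"
    using ij assms by (intro polynomial_fun_transpose[of "\<lambda>g. ract M g $$ (j, i)"] ract_polynomial) auto
  hence "\<exists>S c. finite S \<and> (\<forall>x\<in>GL2. ract M (transpose_mat x) $$ (j, i) = (\<Sum>(i, j, k, l)\<in>S. c (i, j, k, l) *
        x $$ (0,0) ^ i * x $$ (0,1) ^ j * x $$ (1,0) ^ k * x $$ (1,1) ^ l))"
    unfolding polynomial_fun_def .
  moreover have "transpose_mat (ract M (transpose_mat x)) $$ (i, j) = ract M (transpose_mat x) $$ (j, i)"
    if "x \<in> GL2" for x using ij assms that by (auto simp: ract_dim)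
  ultimately show "polynomial_fun (\<lambda>g. ract (contravariant_dual M) g $$ (i, j))"
    unfolding polynomial_fun_def by auto
qed (use assms ract_carrier[OF assms] in \<open>auto simp: ract_one\<close>)

lemma smult_mult_mat_dims:
  fixes A :: "'a::comm_semiring_0 mat"
  assumes "dim_col A = dim_row B"
  shows "(k \<cdot>\<^sub>m A) * B = k \<cdot>\<^sub>m (A * B)" "A * (k \<cdot>\<^sub>m B) = k \<cdot>\<^sub>m (A * B)"
proof -
  have A: "A \<in> carrier_mat (dim_row A) (dim_row B)" by (rule carrier_matI) (rule refl, rule assms)
  have B: "B \<in> carrier_mat (dim_row B) (dim_col B)" by (rule carrier_matI) (rule refl)+
  show "(k \<cdot>\<^sub>m A) * B = k \<cdot>\<^sub>m (A * B)" by (rule mult_smult_assoc_mat[OF A B])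
  show "A * (k \<cdot>\<^sub>m B) = k \<cdot>\<^sub>m (A * B)" by (rule mult_smult_distrib[OF A B])
qed

text \<open>\<open>V\<close> is a linear map from S to M that intertwines the upper Borel up to the
  character a^e. Hence g V g^(-1), with g acting on M and its inverse on S, depends only on the
  first column of g and is homogeneous of degree e in it. Regularity on both charts of the
  projective line makes it a form of degree e, and the \<open>B i\<close> are its coefficients: a
  concrete Frobenius reciprocity.\<close>

lemma borel_eigenvector_expansion:
  fixes M S :: "'a::alg_closed_field gl2_rep"
  assumes M: "polynomial_module M" and S: "polynomial_module S"
    and V: "V \<in> carrier_mat (rdim M) (rdim S)"
    and eig: "\<And>a b d. a \<noteq> 0 \<Longrightarrow> d \<noteq> 0 \<Longrightarrow>
      ract M (mat2 a b 0 d) * V = a ^ e \<cdot>\<^sub>m (V * ract S (mat2 a b 0 d))"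
  shows "\<exists>B. (\<forall>i. B i \<in> carrier_mat (rdim M) (rdim S)) \<and>
    (\<forall>g\<in>GL2. ract M g * V =
      mat_sum (rdim M) (rdim S) (\<lambda>i. (g $$ (0,0) ^ (e - i) * g $$ (1,0) ^ i) \<cdot>\<^sub>m B i) {..e} * ract S g)"
proof -
  define n c where "n = rdim M" and "c = rdim S"
  have [simp]: "dim_row V = n" "dim_col V = c" using V by (auto simp: n_def c_def)
  note [simp] = M S ract_carrier[OF M, folded n_def] ract_carrier[OF S, folded c_def]
    ract_dim[OF M, folded n_def] ract_dim[OF S, folded c_def]
  \<comment> \<open>\<open>Q\<close> gives the values at first columns (1, z) and \<open>Q'\<close>
    those at first columns (z, 1), the two charts of the projective line.\<close>
  define Q where "Q z = ract M (lower_unip z) * (V * ract S (lower_unip (-z)))" for z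
  define Q' where "Q' z = ract M (mat2 z 1 1 0) * (V * ract S (mat2 0 1 1 (-z)))" for z
  have Q: "poly_mat n c Q" unfolding Q_def n_def c_def
    by (intro poly_mat_mult[OF ract_poly_mat[OF M] poly_mat_mult[OF poly_mat_const[OF V] ract_poly_mat[OF S]]]
        poly_fun_intros) auto
  have Q': "poly_mat n c Q'" unfolding Q'_def n_def c_def
    by (intro poly_mat_mult[OF ract_poly_mat[OF M] poly_mat_mult[OF poly_mat_const[OF V] ract_poly_mat[OF S]]]
        poly_fun_intros) auto
  have Q_carrier [simp]: "Q z \<in> carrier_mat n c" "Q' z \<in> carrier_mat n c" for z
    using Q Q' by (auto simp: poly_mat_def)
  have expand: "ract M g * V = g $$ (0,0) ^ e \<cdot>\<^sub>m (Q (g $$ (1,0) / g $$ (0,0)) * ract S g)"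
    if g: "g \<in> GL2" and g0: "g $$ (0,0) \<noteq> 0" for g
  proof -
    obtain a b c' d where gm: "g = mat2 a b c' d" and det: "a * d - b * c' \<noteq> 0" using g by (rule GL2_cases)
    have a: "a \<noteq> 0" using g0 gm by simp
    define y where "y = c' / a"
    define h where "h = mat2 a b 0 ((a * d - b * c') / a)"
    have gh: "g = lower_unip y * h" using a
      by (simp add: gm h_def y_def mat2_mult field_simps)
    have hg: "h = lower_unip (-y) * g" using a
      by (simp add: gm h_def y_def mat2_mult field_simps)
    have h [simp]: "h \<in> GL2" using a det by (simp add: h_def)
    have "ract M g * V = ract M (lower_unip y) * (ract M h * V)"
      unfolding gh by (simp add: ract_mult mat_assoc)
    also have "ract M h * V = a ^ e \<cdot>\<^sub>m (V * ract S h)"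
      using eig[of a "(a * d - b * c') / a" b] a det by (simp add: h_def)
    also have "ract S h = ract S (lower_unip (-y)) * ract S g"
      unfolding hg using g by (simp add: ract_mult)
    finally show ?thesis
      using g by (simp add: gm y_def Q_def smult_mult_mat_dims mat_assoc)
  qed
  have "Q' z = z ^ e \<cdot>\<^sub>m Q (inverse z)" if z: "z \<noteq> 0" for z
  proof -
    have "mat2 z 1 1 0 * mat2 0 1 1 (-z) = 1\<^sub>m 2" by (simp add: mat2_mult mat2_one)
    hence inv: "ract S (mat2 z 1 1 0) * ract S (mat2 0 1 1 (-z)) = 1\<^sub>m c"
      using ract_mult[OF S, of "mat2 z 1 1 0" "mat2 0 1 1 (-z)"] by (simp add: ract_one c_def)
    have "Q' z = (ract M (mat2 z 1 1 0) * V) * ract S (mat2 0 1 1 (-z))"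
      by (simp add: Q'_def mat_assoc)
    also have "\<dots> = z ^ e \<cdot>\<^sub>m (Q (inverse z) * (ract S (mat2 z 1 1 0) * ract S (mat2 0 1 1 (-z))))"
      using z carrier_matD[OF Q_carrier(1)]
      by (subst expand) (auto simp: smult_mult_mat_dims mat_assoc divide_inverse)
    finally show ?thesis using inv by (simp add: right_mult_one_mat[OF Q_carrier(1)])
  qed
  hence refl: "Q' z $$ (i, j) = z ^ e * Q (inverse z) $$ (i, j)" if "z \<noteq> 0" "i < n" "j < c" for i j z
    using that carrier_matD[OF Q_carrier(1)] by simp
  have "\<exists>k. \<forall>z. Q z $$ (i, j) = (\<Sum>l\<le>e. z ^ l * k l)" if "i < n" "j < c" for i j
    using Q Q' that refl
    by (intro poly_fun_bounded_degree[of _ "\<lambda>z. Q' z $$ (i, j)"]) (auto simp: poly_mat_def)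
  then obtain k where k: "\<And>i j z. i < n \<Longrightarrow> j < c \<Longrightarrow> Q z $$ (i, j) = (\<Sum>l\<le>e. z ^ l * k i j l)"
    by metis
  define B where "B l = mat n c (\<lambda>(i, j). k i j l)" for l
  have [simp]: "B l \<in> carrier_mat n c" "dim_row (B l) = n" "dim_col (B l) = c" for l by (auto simp: B_def)
  define R where "R g = mat_sum n c (\<lambda>i. (g $$ (0,0) ^ (e - i) * g $$ (1,0) ^ i) \<cdot>\<^sub>m B i) {..e}" for g
  have [simp]: "dim_row (R g) = n" "dim_col (R g) = c" for g by (auto simp: R_def)
  have generic: "ract M g * V = R g * ract S g" if g: "g \<in> GL2" "g $$ (0,0) \<noteq> 0" for g
  proof -
    let ?a = "g $$ (0,0)" let ?y = "g $$ (1,0) / g $$ (0,0)"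
    have "?a ^ e \<cdot>\<^sub>m Q ?y = R g"
    proof (rule eq_matI)
      fix i j assume "i < dim_row (R g)" "j < dim_col (R g)"
      hence ij: "i < n" "j < c" by auto
      have "?a ^ e * (\<Sum>l\<le>e. ?y ^ l * k i j l) = (\<Sum>l\<le>e. (?a ^ (e - l) * g $$ (1,0) ^ l) * k i j l)"
        unfolding sum_distrib_left
      proof (rule sum.cong)
        fix l assume "l \<in> {..e}"
        hence "?a ^ e = ?a ^ (e - l) * ?a ^ l" by (simp flip: power_add)
        thus "?a ^ e * (?y ^ l * k i j l) = ?a ^ (e - l) * g $$ (1,0) ^ l * k i j l"
          using g by (simp add: power_divide)
      qed auto
      thus "(?a ^ e \<cdot>\<^sub>m Q ?y) $$ (i, j) = R g $$ (i, j)"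
        using ij carrier_matD[OF Q_carrier(1)] by (simp add: R_def k B_def)
    qed (auto simp: carrier_matD[OF Q_carrier(1)])
    hence "R g * ract S g = ?a ^ e \<cdot>\<^sub>m (Q ?y * ract S g)"
      using g carrier_matD[OF Q_carrier(1)] by (metis smult_mult_mat_dims(1) ract_dim(1)[OF S] c_def)
    thus ?thesis using expand[OF g] by simp
  qed
  have "ract M g * V = R g * ract S g" if g: "g \<in> GL2" for g
  proof (cases "g $$ (0,0) = 0")
    case True
    obtain a b c' d where gm: "g = mat2 a b c' d" and det: "a * d - b * c' \<noteq> 0" using g by (rule GL2_cases)
    have a: "a = 0" "b \<noteq> 0" using True gm det by auto
    \<comment> \<open>Adding z times the second column to the first keeps the determinant, gives
      \<open>g\<close> at z = 0 and makes the upper left entry b z nonzero otherwise. The identity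
      for g with vanishing corner follows by polynomial continuation.\<close>
    define G where "G z = mat2 (b * z) b (c' + d * z) d" for z
    have GG: "(b * z) * d - b * (c' + d * z) \<noteq> 0" for z using det a by (simp add: algebra_simps)
    hence G [simp]: "G z \<in> GL2" for z by (simp add: G_def)
    have MG: "poly_mat n n (\<lambda>z. ract M (G z))" "poly_mat c c (\<lambda>z. ract S (G z))"
      unfolding G_def n_def c_def using GG
      by (auto intro!: ract_poly_mat[OF M] ract_poly_mat[OF S] poly_fun_intros)
    have "poly_mat n c (\<lambda>z. R (G z))" unfolding R_def G_def
      by (intro poly_mat_sum poly_mat_smult poly_mat_const) (auto intro!: poly_fun_intros)
    note RG = poly_mat_mult[OF this MG(2)]
    have "V \<in> carrier_mat n c" using V by (simp add: n_def c_def)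
    note MV = poly_mat_mult[OF MG(1) poly_mat_const[OF this]]
    have "ract M (G 0) * V = R (G 0) * ract S (G 0)"
    proof (rule poly_mat_eqI[OF MV RG infinite_nonzero])
      fix z :: 'a assume "z \<in> {x. x \<noteq> 0}"
      thus "ract M (G z) * V = R (G z) * ract S (G z)" using a by (intro generic[OF G]) (simp add: G_def)
    qed
    moreover have "G 0 = g" by (simp add: G_def gm a)
    ultimately show ?thesis by simp
  qed (use generic g in auto)
  thus ?thesis unfolding R_def n_def c_def by (intro exI[of _ B]) (auto simp: B_def n_def c_def)
qed

section \<open>The Steinberg factorization\<close>

lemma transpose_smult: "transpose_mat (k \<cdot>\<^sub>m X) = k \<cdot>\<^sub>m transpose_mat X"
  by (rule eq_matI) auto

lemma one_smult_mat: "(1::'a::monoid_mult) \<cdot>\<^sub>m X = X"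
  by (rule eq_matI) auto

text \<open>The matrix of g on the e-th symmetric power of E: substitute the rows of g for the two
  variables in the monomial of index i and read off the coefficient of index j.\<close>

definition sym_coeff :: "nat \<Rightarrow> 'a::comm_ring_1 mat \<Rightarrow> nat \<Rightarrow> nat \<Rightarrow> 'a" where
  "sym_coeff e g i j =
    coeff ([:g $$ (0,0), g $$ (0,1):] ^ (e - i) * [:g $$ (1,0), g $$ (1,1):] ^ i) j"

lemma sym_coeff_sum:
  fixes g :: "'a::field mat"
  assumes "i \<le> e"
  shows "(\<Sum>j\<le>e. z ^ j * sym_coeff e g i j) =
    (g $$ (0,0) + z * g $$ (0,1)) ^ (e - i) * (g $$ (1,0) + z * g $$ (1,1)) ^ i"
proof -
  let ?P = "[:g $$ (0,0), g $$ (0,1):] ^ (e - i) * [:g $$ (1,0), g $$ (1,1):] ^ i"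
  have deg: "degree ([:a, b:] ^ k) \<le> k" for a b :: 'a and k
  proof -
    have "degree ([:a, b:] ^ k) \<le> degree [:a, b:] * k" by (rule degree_power_le)
    also have "\<dots> \<le> 1 * k" by (rule mult_le_mono1) simp
    finally show ?thesis by simp
  qed
  have "degree ?P \<le> (e - i) + i"
    by (rule order_trans[OF degree_mult_le add_mono[OF deg deg]])
  hence "degree ?P \<le> e" using assms by simp
  hence "poly ?P z = (\<Sum>j\<le>e. z ^ j * coeff ?P j)"
    unfolding poly_altdef by (intro sum.mono_neutral_cong_left) (auto simp: coeff_eq_0 mult.commute)
  thus ?thesis by (simp add: sym_coeff_def)
qed

text \<open>Contravariant self-duality of St: the diagonal form with entries (-1)^i intertwines the
  symmetric power with its contravariant dual. In general the inverse binomial coefficients would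
  stand on the diagonal; the hypothesis \<open>binom\<close> makes them signs.\<close>

lemma sym_coeff_transpose:
  fixes g :: "'a::alg_closed_field mat"
  assumes g: "g \<in> carrier_mat 2 2"
    and binom: "\<And>i. i \<le> e \<Longrightarrow> (of_nat (e choose i) :: 'a) = (-1) ^ i"
    and ij: "i \<le> e" "j \<le> e"
  shows "(-1) ^ j * sym_coeff e g i j = (-1) ^ i * sym_coeff e (transpose_mat g) j i"
proof -
  let ?P = "[:g $$ (0,0), g $$ (0,1):]" and ?Q = "[:g $$ (1,0), g $$ (1,1):]"
  \<comment> \<open>Both sides are, up to the sign \<open>(-1) ^ (i + j)\<close>, the coefficient of \<open>y\<^sup>i x\<^sup>j\<close> in the
    \<open>e\<close>-th power of the bilinear form of \<open>g\<close> at \<open>(1, y)\<close> and \<open>(1, x)\<close>.\<close>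
  have "(-1) ^ i * sym_coeff e g i j = (-1) ^ j * sym_coeff e (transpose_mat g) j i"
  proof (rule power_sum_coeff_eqI[OF infinite_UNIV_alg_closed _ ij(1)])
    fix y :: 'a
    have "(\<Sum>i\<le>e. y ^ i * ((-1) ^ i * sym_coeff e g i j)) =
      coeff (\<Sum>i\<le>e. of_nat (e choose i) * ([:y:] * ?Q) ^ i * ?P ^ (e - i)) j"
      unfolding coeff_sum
    proof (rule sum.cong)
      fix i assume "i \<in> {..e}"
      hence "coeff (of_nat (e choose i) * ([:y:] * ?Q) ^ i * ?P ^ (e - i)) j =
        coeff (Polynomial.smult ((-1) ^ i * y ^ i) (?P ^ (e - i) * ?Q ^ i)) j"
      proof -
        have "([:y:] * ?Q) ^ i = Polynomial.smult (y ^ i) (?Q ^ i)" by (subst smult_power[symmetric]) (simp add: mult.commute)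
        moreover have "of_nat (e choose i) = [:(-1) ^ i :: 'a:]"
          using binom[of i] \<open>i \<in> {..e}\<close> by (simp add: of_nat_poly)
        ultimately show ?thesis by (simp add: mult.commute)
      qed
      thus "y ^ i * ((-1) ^ i * sym_coeff e g i j) =
        coeff (of_nat (e choose i) * ([:y:] * ?Q) ^ i * ?P ^ (e - i)) j"
        by (simp add: sym_coeff_def mult_ac)
    qed auto
    also have "\<dots> = coeff (([:y:] * ?Q + ?P) ^ e) j" by (simp only: binomial_ring)
    also have "[:y:] * ?Q + ?P = [:g $$ (0,0) + y * g $$ (1,0), g $$ (0,1) + y * g $$ (1,1):]"
      by (simp add: add.commute)
    also have "coeff (\<dots> ^ e) j =
      (-1) ^ j * ((g $$ (0,0) + y * g $$ (1,0)) ^ (e - j) * (g $$ (0,1) + y * g $$ (1,1)) ^ j)"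
      using binom[OF ij(2)] ij(2) by (simp add: coeff_linear_poly_power mult_ac)
    also have "\<dots> = (-1) ^ j * (\<Sum>i\<le>e. y ^ i * sym_coeff e (transpose_mat g) j i)"
      using g by (subst sym_coeff_sum[OF ij(2)]) simp
    finally show "(\<Sum>i\<le>e. y ^ i * ((-1) ^ i * sym_coeff e g i j)) =
      (\<Sum>i\<le>e. y ^ i * ((-1) ^ j * sym_coeff e (transpose_mat g) j i))"
      by (simp add: sum_distrib_left mult_ac)
  qed
  thus ?thesis by (cases "even i"; cases "even j") (auto dest: arg_cong[where f = uminus])
qed

text \<open>
  The maps \<open>B\<close> and \<open>C\<close> encode homomorphisms \<open>St \<otimes> S \<rightarrow> M\<close> and \<open>M \<rightarrow> St \<otimes> S\<close> with \<open>St\<close> the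
  Steinberg module of highest weight \<open>q - 1\<close>; \<open>A\<close> is their composite, via the self-duality of \<open>St\<close>.
\<close>
theorem steinberg_factorization:
  fixes M S :: "'a::alg_closed_field gl2_rep" and q e :: nat
  defines "F \<equiv> {t::'a. t ^ q = t}"
  assumes M: "polynomial_module M" and S: "polynomial_module S"
    and q: "q > 1" "(of_nat q :: 'a) = 0" "e = q - 1"
    and binom: "\<And>i. i \<le> e \<Longrightarrow> (of_nat (e choose i) :: 'a) = (-1) ^ i"
    and V: "V \<in> carrier_mat (rdim M) (rdim S)" and \<Phi>: "\<Phi> \<in> carrier_mat (rdim S) (rdim M)"
    and V_eig: "\<And>a b d. a \<noteq> 0 \<Longrightarrow> d \<noteq> 0 \<Longrightarrow>
      ract M (mat2 a b 0 d) * V = a ^ e \<cdot>\<^sub>m (V * ract S (mat2 a b 0 d))"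
    and \<Phi>_eig: "\<And>a b d. a \<noteq> 0 \<Longrightarrow> d \<noteq> 0 \<Longrightarrow>
      \<Phi> * ract M (mat2 a 0 b d) = a ^ e \<cdot>\<^sub>m (ract S (mat2 a 0 b d) * \<Phi>)"
  obtains A \<theta> where "A \<in> carrier_mat (rdim M) (rdim M)" "\<theta> \<in> carrier_mat (rdim M) (rdim M)"
    and "\<And>g. g \<in> GL2 \<Longrightarrow> A * ract M g = ract M g * A"
    and "A = mat_sum (rdim M) (rdim M)
      (\<lambda>t. ract M (lower_unip t) * \<theta> * ract M (lower_unip (-t))) F"
    and "\<And>x. x \<in> carrier_vec (rdim M) \<Longrightarrow>
      (\<And>z. \<Phi> *\<^sub>v (ract M (upper_unip z) *\<^sub>v x) = ract S (upper_unip z) *\<^sub>v (\<Phi> *\<^sub>v x)) \<Longrightarrow>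
      A *\<^sub>v x = V *\<^sub>v (\<Phi> *\<^sub>v x)"
proof -
  define n c where "n = rdim M" and "c = rdim S"
  have [simp]: "dim_row V = n" "dim_col V = c" "dim_row \<Phi> = c" "dim_col \<Phi> = n"
    using V \<Phi> by (auto simp: n_def c_def)
  note [simp] = M S ract_carrier[OF M, folded n_def] ract_carrier[OF S, folded c_def]
    ract_dim[OF M, folded n_def] ract_dim[OF S, folded c_def]
  obtain B where B: "\<And>i. B i \<in> carrier_mat n c" and expB: "\<And>g. g \<in> GL2 \<Longrightarrow> ract M g * V =
      mat_sum n c (\<lambda>i. (g $$ (0,0) ^ (e - i) * g $$ (1,0) ^ i) \<cdot>\<^sub>m B i) {..e} * ract S g"
    using borel_eigenvector_expansion[OF M S V V_eig] unfolding n_def c_def by blast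
  \<comment> \<open>Transposition turns \<open>\<Phi>\<close> into an eigenvector for the upper
    Borel in the contravariant dual, so the same expansion applies to it; the \<open>C i\<close> are
    the transposed coefficients.\<close>
  have "ract (contravariant_dual M) (mat2 a b 0 d) * transpose_mat \<Phi> =
    a ^ e \<cdot>\<^sub>m (transpose_mat \<Phi> * ract (contravariant_dual S) (mat2 a b 0 d))" if "a \<noteq> 0" "d \<noteq> 0" for a b d
  proof -
    have g: "mat2 a 0 b d \<in> GL2" using that by simp
    have "transpose_mat (\<Phi> * ract M (mat2 a 0 b d)) = transpose_mat (a ^ e \<cdot>\<^sub>m (ract S (mat2 a 0 b d) * \<Phi>))"
      using \<Phi>_eig[OF that] by simp
    thus ?thesis
      using \<Phi> ract_carrier[OF M g] ract_carrier[OF S g]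
      by (simp add: transpose_smult transpose_mult[of _ "rdim S" "rdim M" _ "rdim M"] transpose_mult[of _ "rdim S" "rdim S" _ "rdim M"])
  qed
  from borel_eigenvector_expansion[OF polynomial_module_contravariant_dual[OF M]
      polynomial_module_contravariant_dual[OF S] _ this]
  obtain C' where C': "\<And>i. C' i \<in> carrier_mat n c" and expC': "\<And>g. g \<in> GL2 \<Longrightarrow>
      transpose_mat (ract M (transpose_mat g)) * transpose_mat \<Phi> =
      mat_sum n c (\<lambda>i. (g $$ (0,0) ^ (e - i) * g $$ (1,0) ^ i) \<cdot>\<^sub>m C' i) {..e} *
        transpose_mat (ract S (transpose_mat g))"
    using \<Phi> unfolding n_def c_def by auto
  define C where "C i = transpose_mat (C' i)" for i
  have C: "C i \<in> carrier_mat c n" for i using C' by (simp add: C_def)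
  have [simp]: "dim_row (B i) = n" "dim_col (B i) = c" "dim_row (C i) = c" "dim_col (C i) = n" for i
    using B[of i] C[of i] by auto
  have expC: "\<Phi> * ract M g =
      ract S g * mat_sum c n (\<lambda>i. (g $$ (0,0) ^ (e - i) * g $$ (0,1) ^ i) \<cdot>\<^sub>m C i) {..e}" if g: "g \<in> GL2" for g
  proof -
    have carr: "g \<in> carrier_mat 2 2" "\<Phi> \<in> carrier_mat c n"
      using g \<Phi> by (auto simp: GL2_carrier c_def n_def)
    have "transpose_mat (\<Phi> * ract M g) = transpose_mat (ract M g) * transpose_mat \<Phi>"
      using g carr by (intro transpose_mult) auto
    also have "\<dots> = mat_sum n c (\<lambda>i. (g $$ (0,0) ^ (e - i) * g $$ (0,1) ^ i) \<cdot>\<^sub>m C' i) {..e} *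
        transpose_mat (ract S g)"
      using expC'[of "transpose_mat g"] g carr by simp
    also have "mat_sum n c (\<lambda>i. (g $$ (0,0) ^ (e - i) * g $$ (0,1) ^ i) \<cdot>\<^sub>m C' i) {..e} =
      transpose_mat (mat_sum c n (\<lambda>i. (g $$ (0,0) ^ (e - i) * g $$ (0,1) ^ i) \<cdot>\<^sub>m C i) {..e})"
      using C C' by (subst transpose_mat_sum) (auto simp: C_def transpose_smult intro!: mat_sum_cong)
    also have "\<dots> * transpose_mat (ract S g) =
      transpose_mat (ract S g * mat_sum c n (\<lambda>i. (g $$ (0,0) ^ (e - i) * g $$ (0,1) ^ i) \<cdot>\<^sub>m C i) {..e})"
      using g by (intro transpose_mult[symmetric]) auto
    finally show ?thesis by (metis transpose_transpose)
  qed
  have cancel: "ract S (lower_unip z) * ract S (lower_unip (-z)) = 1\<^sub>m c"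
    "ract S (lower_unip (-z)) * ract S (lower_unip z) = 1\<^sub>m c"
    "ract S (upper_unip z) * ract S (upper_unip (-z)) = 1\<^sub>m c"
    "ract S (upper_unip (-z)) * ract S (upper_unip z) = 1\<^sub>m c"
    "ract S weyl * ract S weyl = 1\<^sub>m c" for z
    using ract_one[OF S] by (simp_all flip: ract_mult[OF S] add: mat2_mult mat2_one c_def)
  \<comment> \<open>\<open>Bs x y\<close> is the value of the form attached to \<open>V\<close> at
    the column (x, y), and \<open>Cs x y\<close> that of the form attached to \<open>\<Phi>\<close>
    at the row (x, y).\<close>
  define Bs where "Bs x y = mat_sum n c (\<lambda>i. (x ^ (e - i) * y ^ i) \<cdot>\<^sub>m B i) {..e}" for x y
  define Cs where "Cs x y = mat_sum c n (\<lambda>i. (x ^ (e - i) * y ^ i) \<cdot>\<^sub>m C i) {..e}" for x y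
  have [simp]: "dim_row (Bs x y) = n" "dim_col (Bs x y) = c" "dim_row (Cs x y) = c" "dim_col (Cs x y) = n" for x y
    by (simp_all add: Bs_def Cs_def)
  have one: "X * 1\<^sub>m c = X" if "dim_col X = c" for X :: "'a mat" using that by simp
  have one': "1\<^sub>m c * X = X" if "dim_row X = c" for X :: "'a mat" using that by simp
  have Bs: "ract M (lower_unip z) * V = Bs 1 z * ract S (lower_unip z)" for z
    using expB[of "lower_unip z"] by (simp add: Bs_def)
  have Cs: "\<Phi> * ract M (upper_unip z) = ract S (upper_unip z) * Cs 1 z" for z
    using expC[of "upper_unip z"] by (simp add: Cs_def)
  have Bs': "Bs 1 z = ract M (lower_unip z) * (V * ract S (lower_unip (-z)))" for z
  proof -
    have "Bs 1 z = Bs 1 z * (ract S (lower_unip z) * ract S (lower_unip (-z)))"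
      by (simp add: cancel one)
    also have "\<dots> = (ract M (lower_unip z) * V) * ract S (lower_unip (-z))"
      unfolding Bs by (simp add: mat_assoc)
    finally show ?thesis by (simp add: mat_assoc)
  qed
  \<comment> \<open>Left multiplication by g moves the column (1, z) to g(1, z); this is the
    equivariance of the map from St (x) S to M.\<close>
  have gB: "ract M g * Bs 1 z = Bs (g $$ (0,0) + z * g $$ (0,1)) (g $$ (1,0) + z * g $$ (1,1)) * ract S g"
    if g: "g \<in> GL2" for g z
  proof -
    have gl: "g * lower_unip z \<in> GL2" using g by (intro GL2_mult) auto
    obtain a b c' d where gm: "g = mat2 a b c' d" using g by (rule GL2_cases)
    have "ract M g * Bs 1 z = (ract M (g * lower_unip z) * V) * ract S (lower_unip (-z))"
      using g by (simp add: Bs' ract_mult mat_assoc)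
    also have "\<dots> = (Bs (a + z * b) (c' + z * d) * ract S (g * lower_unip z)) * ract S (lower_unip (-z))"
      unfolding Bs_def by (subst expB[OF gl]) (simp add: gm mat2_mult mult.commute)
    also have "\<dots> = Bs (a + z * b) (c' + z * d) * ract S g"
      using g by (simp add: ract_mult mat_assoc cancel one)
    finally show ?thesis by (simp add: gm)
  qed
  have Cs': "Cs 1 z = ract S (upper_unip (-z)) * (\<Phi> * ract M (upper_unip z))" for z
  proof -
    have "ract S (upper_unip (-z)) * (\<Phi> * ract M (upper_unip z)) =
      (ract S (upper_unip (-z)) * ract S (upper_unip z)) * Cs 1 z"
      unfolding Cs by (simp add: mat_assoc)
    thus ?thesis by (simp add: cancel one')
  qed
  have Cg: "Cs 1 z * ract M g = ract S g * Cs (g $$ (0,0) + z * g $$ (1,0)) (g $$ (0,1) + z * g $$ (1,1))"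
    if g: "g \<in> GL2" for g z
  proof -
    have gl: "upper_unip z * g \<in> GL2" using g by (intro GL2_mult) auto
    obtain a b c' d where gm: "g = mat2 a b c' d" using g by (rule GL2_cases)
    have "Cs 1 z * ract M g = ract S (upper_unip (-z)) * (\<Phi> * ract M (upper_unip z * g))"
      using g by (simp add: Cs' ract_mult mat_assoc)
    also have "\<dots> = ract S (upper_unip (-z)) * (ract S (upper_unip z * g) * Cs (a + z * c') (b + z * d))"
      unfolding Cs_def by (subst expC[OF gl]) (simp add: gm mat2_mult)
    also have "\<dots> = (ract S (upper_unip (-z)) * ract S (upper_unip z)) * (ract S g * Cs (a + z * c') (b + z * d))"
      using g by (simp add: ract_mult mat_assoc)
    finally show ?thesis using g by (simp add: gm cancel one')
  qed
  \<comment> \<open>Comparing powers of z shows that the \<open>B j\<close> transform by the matrix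
    of the symmetric power, twisted by the action on S.\<close>
  have gB_coeff: "(ract M g * B j) $$ (a, b) = (\<Sum>i\<le>e. sym_coeff e g i j * (B i * ract S g) $$ (a, b))"
    if g: "g \<in> GL2" and ab: "a < n" "b < c" and j: "j \<le> e" for g a b j
  proof (rule power_sum_coeff_eqI[OF infinite_UNIV_alg_closed _ j])
    fix z :: 'a
    have "(\<Sum>j\<le>e. z ^ j * (ract M g * B j) $$ (a, b)) = (ract M g * Bs 1 z) $$ (a, b)"
      unfolding Bs_def using g B ab by (subst mult_mat_sum) (auto simp: smult_mult_mat_dims)
    also have "\<dots> = (\<Sum>i\<le>e. ((g $$ (0,0) + z * g $$ (0,1)) ^ (e - i) *
        (g $$ (1,0) + z * g $$ (1,1)) ^ i) * (B i * ract S g) $$ (a, b))"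
      unfolding gB[OF g] unfolding Bs_def using g B ab
      by (subst mat_sum_mult[OF ract_carrier[OF S g, folded c_def]]) (auto simp: smult_mult_mat_dims)
    also have "\<dots> = (\<Sum>i\<le>e. \<Sum>j\<le>e. z ^ j * (sym_coeff e g i j * (B i * ract S g) $$ (a, b)))"
      by (intro sum.cong refl) (simp add: sym_coeff_sum sum_distrib_right[symmetric] mult.assoc[symmetric])
    also have "\<dots> = (\<Sum>j\<le>e. z ^ j * (\<Sum>i\<le>e. sym_coeff e g i j * (B i * ract S g) $$ (a, b)))"
      by (subst sum.swap) (simp add: sum_distrib_left)
    finally show "(\<Sum>j\<le>e. z ^ j * (ract M g * B j) $$ (a, b)) = \<dots>" .
  qed
  have Cg_coeff: "(C j * ract M g) $$ (a, b) =
      (\<Sum>i\<le>e. sym_coeff e (transpose_mat g) i j * (ract S g * C i) $$ (a, b))"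
    if g: "g \<in> GL2" and ab: "a < c" "b < n" and j: "j \<le> e" for g a b j
  proof (rule power_sum_coeff_eqI[OF infinite_UNIV_alg_closed _ j])
    fix z :: 'a
    have "(\<Sum>j\<le>e. z ^ j * (C j * ract M g) $$ (a, b)) = (Cs 1 z * ract M g) $$ (a, b)"
      unfolding Cs_def using g C ab
      by (subst mat_sum_mult[OF ract_carrier[OF M g, folded n_def]]) (auto simp: smult_mult_mat_dims)
    also have "\<dots> = (\<Sum>i\<le>e. ((g $$ (0,0) + z * g $$ (1,0)) ^ (e - i) *
        (g $$ (0,1) + z * g $$ (1,1)) ^ i) * (ract S g * C i) $$ (a, b))"
      unfolding Cg[OF g] unfolding Cs_def using g C ab
      by (subst mult_mat_sum) (auto simp: smult_mult_mat_dims)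
    also have "\<dots> = (\<Sum>i\<le>e. \<Sum>j\<le>e. z ^ j * (sym_coeff e (transpose_mat g) i j * (ract S g * C i) $$ (a, b)))"
      using GL2_carrier[OF g]
      by (intro sum.cong refl) (simp add: sym_coeff_sum sum_distrib_right[symmetric] mult.assoc[symmetric])
    also have "\<dots> = (\<Sum>j\<le>e. z ^ j * (\<Sum>i\<le>e. sym_coeff e (transpose_mat g) i j * (ract S g * C i) $$ (a, b)))"
      by (subst sum.swap) (simp add: sum_distrib_left)
    finally show "(\<Sum>j\<le>e. z ^ j * (C j * ract M g) $$ (a, b)) = \<dots>" .
  qed
  \<comment> \<open>The signs are those of the invariant form on St, so \<open>A\<close> is the
    composite M -> St (x) S -> M and commutes with the group.\<close>
  define A where "A = mat_sum n n (\<lambda>i. (-1) ^ i \<cdot>\<^sub>m (B i * C i)) {..e}"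
  define X where "X g i j a b = (B i * (ract S g * C j)) $$ (a, b)" for g i j a b
  have gA: "(ract M g * A) $$ (a, b) = (\<Sum>j\<le>e. \<Sum>i\<le>e. (-1) ^ j * sym_coeff e g i j * X g i j a b)"
    if g: "g \<in> GL2" and ab: "a < n" "b < n" for g a b
  proof -
    have "(ract M g * A) $$ (a, b) = (\<Sum>j\<le>e. (-1) ^ j * ((ract M g * B j) * C j) $$ (a, b))"
      unfolding A_def using g B C ab
      by (subst mult_mat_sum) (auto simp: smult_mult_mat_dims mat_assoc intro!: carrier_matI)
    also have "\<dots> = (\<Sum>j\<le>e. \<Sum>i\<le>e. (-1) ^ j * sym_coeff e g i j * X g i j a b)"
    proof (rule sum.cong)
      fix j assume j: "j \<in> {..e}"
      have "((ract M g * B j) * C j) $$ (a, b) = (\<Sum>l<c. (ract M g * B j) $$ (a, l) * C j $$ (l, b))"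
        using g B C ab by (intro mult_index_sum[of _ n _ _ n]) (auto intro!: carrier_matI)
      also have "\<dots> = (\<Sum>l<c. \<Sum>i\<le>e. sym_coeff e g i j * ((B i * ract S g) $$ (a, l) * C j $$ (l, b)))"
        using gB_coeff[OF g ab(1)] j by (simp add: sum_distrib_right mult.assoc)
      also have "\<dots> = (\<Sum>i\<le>e. sym_coeff e g i j * (\<Sum>l<c. (B i * ract S g) $$ (a, l) * C j $$ (l, b)))"
        by (subst sum.swap) (simp add: sum_distrib_left)
      also have "\<dots> = (\<Sum>i\<le>e. sym_coeff e g i j * X g i j a b)"
      proof (intro sum.cong refl arg_cong2[of _ _ _ _ "(*)"])
        fix i
        have "(\<Sum>l<c. (B i * ract S g) $$ (a, l) * C j $$ (l, b)) = ((B i * ract S g) * C j) $$ (a, b)"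
          using g B C ab by (intro mult_index_sum[of _ n _ _ n, symmetric]) (auto intro!: carrier_matI)
        thus "(\<Sum>l<c. (B i * ract S g) $$ (a, l) * C j $$ (l, b)) = X g i j a b"
          using g by (simp add: X_def mat_assoc)
      qed
      finally show "(-1) ^ j * ((ract M g * B j) * C j) $$ (a, b) =
        (\<Sum>i\<le>e. (-1) ^ j * sym_coeff e g i j * X g i j a b)"
        by (simp add: sum_distrib_left mult.assoc)
    qed auto
    finally show ?thesis .
  qed
  have Ag: "(A * ract M g) $$ (a, b) =
      (\<Sum>i\<le>e. \<Sum>j\<le>e. (-1) ^ i * sym_coeff e (transpose_mat g) j i * X g i j a b)"
    if g: "g \<in> GL2" and ab: "a < n" "b < n" for g a b
  proof -
    have "(A * ract M g) $$ (a, b) = (\<Sum>i\<le>e. (-1) ^ i * (B i * (C i * ract M g)) $$ (a, b))"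
      unfolding A_def using g B C ab
      by (subst mat_sum_mult[OF ract_carrier[OF M g, folded n_def]])
         (auto simp: smult_mult_mat_dims mat_assoc intro!: carrier_matI)
    also have "\<dots> = (\<Sum>i\<le>e. \<Sum>j\<le>e. (-1) ^ i * sym_coeff e (transpose_mat g) j i * X g i j a b)"
    proof (rule sum.cong)
      fix i assume i: "i \<in> {..e}"
      have "(B i * (C i * ract M g)) $$ (a, b) = (\<Sum>l<c. B i $$ (a, l) * (C i * ract M g) $$ (l, b))"
        using g B C ab by (intro mult_index_sum[of _ n _ _ n]) (auto intro!: carrier_matI)
      also have "\<dots> = (\<Sum>l<c. \<Sum>j\<le>e. sym_coeff e (transpose_mat g) j i * (B i $$ (a, l) * (ract S g * C j) $$ (l, b)))"
        using Cg_coeff[OF g _ ab(2)] i by (simp add: sum_distrib_left mult.left_commute)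
      also have "\<dots> = (\<Sum>j\<le>e. sym_coeff e (transpose_mat g) j i * (\<Sum>l<c. B i $$ (a, l) * (ract S g * C j) $$ (l, b)))"
        by (subst sum.swap) (simp add: sum_distrib_left)
      also have "\<dots> = (\<Sum>j\<le>e. sym_coeff e (transpose_mat g) j i * X g i j a b)"
      proof (intro sum.cong refl arg_cong2[of _ _ _ _ "(*)"])
        fix j
        show "(\<Sum>l<c. B i $$ (a, l) * (ract S g * C j) $$ (l, b)) = X g i j a b"
          unfolding X_def using g B C ab by (intro mult_index_sum[of _ n _ _ n, symmetric]) (auto intro!: carrier_matI)
      qed
      finally show "(-1) ^ i * (B i * (C i * ract M g)) $$ (a, b) =
        (\<Sum>j\<le>e. (-1) ^ i * sym_coeff e (transpose_mat g) j i * X g i j a b)"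
        by (simp add: sum_distrib_left mult.assoc)
    qed auto
    finally show ?thesis .
  qed
  have A [simp]: "A \<in> carrier_mat n n" "dim_row A = n" "dim_col A = n" by (simp_all add: A_def)
  have commute: "A * ract M g = ract M g * A" if g: "g \<in> GL2" for g
  proof (rule eq_matI)
    fix a b assume "a < dim_row (ract M g * A)" "b < dim_col (ract M g * A)"
    hence ab: "a < n" "b < n" using g by auto
    show "(A * ract M g) $$ (a, b) = (ract M g * A) $$ (a, b)"
      unfolding gA[OF g ab] Ag[OF g ab]
    proof (subst (2) sum.swap, intro sum.cong refl)
      fix i j assume "i \<in> {..e}" "j \<in> {..e}"
      hence "(-1) ^ j * sym_coeff e g i j = (-1) ^ i * sym_coeff e (transpose_mat g) j i"
        by (intro sym_coeff_transpose[OF GL2_carrier[OF g] binom]) auto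
      thus "(-1) ^ i * sym_coeff e (transpose_mat g) j i * X g i j a b =
        (-1) ^ j * sym_coeff e g i j * X g i j a b" by simp
    qed
  qed (use g in auto)

  \<comment> \<open>Summing the conjugates of the term with \<open>weyl\<close> produces the power
    sums of exponents i + (e - j). Exponent e occurs for i = j and gives \<open>A\<close> up to
    sign; exponent 2e occurs for i = e, j = 0 and leaves a multiple of B_e C_0. The conjugates of
    \<open>V * \<Phi>\<close> sum to exactly that stray term, which the difference cancels.\<close>
  define \<theta> where "\<theta> = V * \<Phi> + (-1) \<cdot>\<^sub>m (V * (ract S weyl * (\<Phi> * ract M weyl)))"
  have \<theta> [simp]: "\<theta> \<in> carrier_mat n n" "dim_row \<theta> = n" "dim_col \<theta> = n"
    by (auto simp: \<theta>_def intro!: carrier_matI)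
  have C0: "C 0 = \<Phi>"
  proof -
    have "Cs 1 0 = \<Phi>" using Cs[of 0] ract_one[OF M] ract_one[OF S]
      by (simp add: mat2_one n_def[symmetric] c_def[symmetric])
    moreover have "Cs 1 0 = C 0"
    proof (rule eq_matI)
      fix a b assume ab: "a < dim_row (C 0)" "b < dim_col (C 0)"
      have "(\<Sum>i\<le>e. 0 ^ i * C i $$ (a, b)) = (\<Sum>i\<in>{0}. 0 ^ i * C i $$ (a, b))"
        by (rule sum.mono_neutral_right) auto
      thus "Cs 1 0 $$ (a, b) = C 0 $$ (a, b)" using ab by (simp add: Cs_def)
    qed auto
    ultimately show ?thesis by simp
  qed
  have B0: "B 0 = V"
  proof -
    have "Bs 1 0 = V" using Bs[of 0] ract_one[OF M] ract_one[OF S]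
      by (simp add: mat2_one n_def[symmetric] c_def[symmetric])
    moreover have "Bs 1 0 = B 0"
    proof (rule eq_matI)
      fix a b assume ab: "a < dim_row (B 0)" "b < dim_col (B 0)"
      have "(\<Sum>i\<le>e. 0 ^ i * B i $$ (a, b)) = (\<Sum>i\<in>{0}. 0 ^ i * B i $$ (a, b))"
        by (rule sum.mono_neutral_right) auto
      thus "Bs 1 0 $$ (a, b) = B 0 $$ (a, b)" using ab by (simp add: Bs_def)
    qed auto
    ultimately show ?thesis by simp
  qed
  have low\<Phi>: "ract S (lower_unip t) * (\<Phi> * ract M (lower_unip (-t))) = \<Phi>" for t
  proof -
    have "\<Phi> * ract M (lower_unip (-t)) = ract S (lower_unip (-t)) * \<Phi>"
      using \<Phi>_eig[of 1 1 "-t"] by (simp add: one_smult_mat)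
    hence "ract S (lower_unip t) * (\<Phi> * ract M (lower_unip (-t))) =
      (ract S (lower_unip t) * ract S (lower_unip (-t))) * \<Phi>" by (simp add: mat_assoc)
    thus ?thesis by (simp add: cancel one')
  qed
  have trace1: "ract M (lower_unip t) * (V * (\<Phi> * ract M (lower_unip (-t)))) = Bs 1 t * \<Phi>" for t
  proof -
    have "ract M (lower_unip t) * (V * (\<Phi> * ract M (lower_unip (-t)))) =
      (ract M (lower_unip t) * V) * (\<Phi> * ract M (lower_unip (-t)))" by (simp add: mat_assoc)
    thus ?thesis unfolding Bs by (simp add: mat_assoc low\<Phi>)
  qed
  \<comment> \<open>The first row of \<open>weyl * lower_unip (-t)\<close> is (-t, 1), hence the
    argument of \<open>Cs\<close>.\<close>
  have trace2: "ract M (lower_unip t) * (V * (ract S weyl * (\<Phi> * (ract M weyl * ract M (lower_unip (-t)))))) =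
      Bs 1 t * Cs (-t) 1" for t
  proof -
    have wl: "weyl * lower_unip (-t) = mat2 (-t) 1 1 0" by (simp add: mat2_mult)
    have "ract M weyl * ract M (lower_unip (-t)) = ract M (mat2 (-t) 1 1 0)"
      using ract_mult[OF M, of weyl "lower_unip (-t)"] by (simp add: wl)
    hence "\<Phi> * (ract M weyl * ract M (lower_unip (-t))) = ract S (mat2 (-t) 1 1 0) * Cs (-t) 1"
      using expC[of "mat2 (-t) 1 1 0"] by (simp add: Cs_def)
    also have "ract S (mat2 (-t) 1 1 0) = ract S weyl * ract S (lower_unip (-t))"
      using ract_mult[OF S, of weyl "lower_unip (-t)"] by (simp add: wl)
    finally have *: "ract S weyl * (\<Phi> * (ract M weyl * ract M (lower_unip (-t)))) =
      (ract S weyl * ract S weyl) * (ract S (lower_unip (-t)) * Cs (-t) 1)"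
      by (simp add: mat_assoc)
    have "ract M (lower_unip t) * (V * (ract S (lower_unip (-t)) * Cs (-t) 1)) =
      (ract M (lower_unip t) * V) * (ract S (lower_unip (-t)) * Cs (-t) 1)" by (simp add: mat_assoc)
    also have "\<dots> = Bs 1 t * ((ract S (lower_unip t) * ract S (lower_unip (-t))) * Cs (-t) 1)"
      unfolding Bs by (simp add: mat_assoc)
    finally show ?thesis unfolding * by (simp add: cancel one')
  qed
  have trace: "A = mat_sum n n (\<lambda>t. ract M (lower_unip t) * \<theta> * ract M (lower_unip (-t))) F"
  proof (rule eq_matI)
    fix a b assume "a < dim_row (mat_sum n n (\<lambda>t. ract M (lower_unip t) * \<theta> * ract M (lower_unip (-t))) F)"
      "b < dim_col (mat_sum n n (\<lambda>t. ract M (lower_unip t) * \<theta> * ract M (lower_unip (-t))) F)"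
    hence ab: "a < n" "b < n" by auto
    define Y where "Y i j = (B i * C j) $$ (a, b)" for i j
    have Y: "Y i j = (\<Sum>l<c. B i $$ (a, l) * C j $$ (l, b))" for i j
      unfolding Y_def using B C ab by (intro mult_index_sum)
    have BC: "(Bs x y * Cs x' y') $$ (a, b) =
      (\<Sum>i\<le>e. \<Sum>j\<le>e. x ^ (e - i) * y ^ i * (x' ^ (e - j) * y' ^ j) * Y i j)" for x y x' y'
    proof -
      have "(Bs x y * Cs x' y') $$ (a, b) = (\<Sum>l<c. Bs x y $$ (a, l) * Cs x' y' $$ (l, b))"
        using ab by (intro mult_index_sum[of _ n _ _ n]) (auto intro!: carrier_matI)
      also have "\<dots> = (\<Sum>l<c. \<Sum>i\<le>e. \<Sum>j\<le>e. x ^ (e - i) * y ^ i * (x' ^ (e - j) * y' ^ j) * (B i $$ (a, l) * C j $$ (l, b)))"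
        using ab by (simp add: Bs_def Cs_def sum_product) (simp add: mult_ac)
      also have "\<dots> = (\<Sum>i\<le>e. \<Sum>j\<le>e. \<Sum>l<c. x ^ (e - i) * y ^ i * (x' ^ (e - j) * y' ^ j) * (B i $$ (a, l) * C j $$ (l, b)))"
        by (rule trans[OF sum.swap], rule sum.cong[OF refl], rule sum.swap)
      finally show ?thesis by (simp add: Y sum_distrib_left)
    qed
    have A_ab: "A $$ (a, b) = (\<Sum>i\<le>e. (-1) ^ i * Y i i)" using ab by (simp add: A_def Y_def)
    have B\<Phi>: "(Bs 1 t * \<Phi>) $$ (a, b) = (\<Sum>i\<le>e. t ^ i * Y i 0)" for t
      unfolding Bs_def C0[symmetric] Y_def using B C ab
      by (subst mat_sum_mult[OF C[of 0]]) (auto simp: smult_mult_mat_dims)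
    have summand: "(ract M (lower_unip t) * \<theta> * ract M (lower_unip (-t))) $$ (a, b) =
      (\<Sum>i\<le>e. t ^ i * Y i 0) - (\<Sum>i\<le>e. \<Sum>j\<le>e. (-1) ^ (e - j) * (t ^ (i + (e - j)) * Y i j))" for t
    proof -
      have "ract M (lower_unip t) * \<theta> * ract M (lower_unip (-t)) =
        (ract M (lower_unip t) * (V * \<Phi>) + (-1) \<cdot>\<^sub>m (ract M (lower_unip t) * (V * (ract S weyl * (\<Phi> * ract M weyl)))))
         * ract M (lower_unip (-t))"
        unfolding \<theta>_def
        by (subst mult_add_distrib_mat[of _ n n _ n]) (auto simp: smult_mult_mat_dims intro!: carrier_matI)
      also have "\<dots> = ract M (lower_unip t) * (V * \<Phi>) * ract M (lower_unip (-t)) +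
        (-1) \<cdot>\<^sub>m (ract M (lower_unip t) * (V * (ract S weyl * (\<Phi> * ract M weyl))) * ract M (lower_unip (-t)))"
        by (subst add_mult_distrib_mat[of _ n n _ _ n]) (auto simp: smult_mult_mat_dims intro!: carrier_matI)
      also have "\<dots> = Bs 1 t * \<Phi> + (-1) \<cdot>\<^sub>m (Bs 1 t * Cs (-t) 1)"
        by (simp add: mat_assoc trace1 trace2)
      finally have "(ract M (lower_unip t) * \<theta> * ract M (lower_unip (-t))) $$ (a, b) =
        (Bs 1 t * \<Phi>) $$ (a, b) - (Bs 1 t * Cs (-t) 1) $$ (a, b)"
        using ab by simp
      also have "(Bs 1 t * Cs (-t) 1) $$ (a, b) =
        (\<Sum>i\<le>e. \<Sum>j\<le>e. (-1) ^ (e - j) * (t ^ (i + (e - j)) * Y i j))"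
        unfolding BC by (intro sum.cong refl) (simp only: power_add, simp add: power_minus[of t] mult_ac)
      finally show ?thesis by (simp add: B\<Phi>)
    qed
    have pow: "(\<Sum>t\<in>F. t ^ k) = (if k = e \<or> k = 2 * e then -1 else 0)" if "k \<le> 2 * e" for k
      using sum_powers_fixed_points[OF q(1,2), of k] that q(3) unfolding F_def by simp
    have e: "e > 0" using q by simp
    \<comment> \<open>This also holds in characteristic 2, where e is odd but -1 = 1; it is the last
      binomial coefficient.\<close>
    have sgn: "(-1) ^ e = (1::'a)" using binom[of e] by simp
    have sgn': "(-1) ^ (e - i) = ((-1) ^ i :: 'a)" if "i \<le> e" for i
    proof -
      have "(-1) ^ (e - i) * (-1) ^ i = (1::'a)" using that sgn by (simp flip: power_add)
      hence "((-1) ^ (e - i) * (-1) ^ i) * (-1) ^ i = ((-1) ^ i :: 'a)" by simp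
      moreover have "(-1) ^ i * (-1) ^ i = (1::'a)" by (simp flip: power_mult_distrib)
      ultimately show ?thesis by (simp add: mult.assoc)
    qed
    have "(\<Sum>t\<in>F. \<Sum>i\<le>e. t ^ i * Y i 0) = (\<Sum>i\<le>e. (\<Sum>t\<in>F. t ^ i) * Y i 0)"
      by (subst sum.swap) (simp add: sum_distrib_right)
    also have "\<dots> = (\<Sum>i\<le>e. if i = e then - Y e 0 else 0)"
      using e by (intro sum.cong refl) (simp add: pow)
    also have "\<dots> = - Y e 0" by simp
    finally have first: "(\<Sum>t\<in>F. \<Sum>i\<le>e. t ^ i * Y i 0) = - Y e 0" .
    have "(\<Sum>t\<in>F. \<Sum>i\<le>e. \<Sum>j\<le>e. (-1) ^ (e - j) * (t ^ (i + (e - j)) * Y i j)) =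
      (\<Sum>i\<le>e. \<Sum>t\<in>F. \<Sum>j\<le>e. (-1) ^ (e - j) * (t ^ (i + (e - j)) * Y i j))"
      by (rule sum.swap)
    also have "\<dots> = (\<Sum>i\<le>e. \<Sum>j\<le>e. (-1) ^ (e - j) * ((\<Sum>t\<in>F. t ^ (i + (e - j))) * Y i j))"
      by (rule sum.cong[OF refl], subst sum.swap) (simp add: sum_distrib_left sum_distrib_right)
    \<comment> \<open>Since e > 0 the exceptional exponents e and 2e are distinct. Exponent 0, from
      i = 0 and j = e, contributes q = 0.\<close>
    also have "\<dots> = (\<Sum>i\<le>e. \<Sum>j\<le>e. (if j = i then - ((-1) ^ i * Y i i) else 0) +
      (if j = 0 then (if i = e then - Y e 0 else 0) else 0))"
      using e by (intro sum.cong refl) (auto simp: pow sgn sgn')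
    also have "\<dots> = (\<Sum>i\<le>e. - ((-1) ^ i * Y i i) + (if i = e then - Y e 0 else 0))"
      by (intro sum.cong refl) (simp add: sum.distrib)
    also have "\<dots> = - A $$ (a, b) - Y e 0"
      by (simp only: sum.distrib sum_negf A_ab) simp
    finally have second: "(\<Sum>t\<in>F. \<Sum>i\<le>e. \<Sum>j\<le>e. (-1) ^ (e - j) * (t ^ (i + (e - j)) * Y i j)) =
      - A $$ (a, b) - Y e 0" .
    show "A $$ (a, b) = mat_sum n n (\<lambda>t. ract M (lower_unip t) * \<theta> * ract M (lower_unip (-t))) F $$ (a, b)"
      using ab by (simp only: mat_sum_index summand sum_subtractf first second) simp
  qed (auto simp: A_def)

  \<comment> \<open>If \<open>\<Phi>\<close> respects the upper unipotents on x, then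
    \<open>Cs 1 z\<close> applied to x does not depend on z. Only its constant coefficient
    \<open>C 0 = \<Phi>\<close> survives, and in \<open>A\<close> it is followed by
    \<open>B 0 = V\<close>.\<close>
  have apply_A: "A *\<^sub>v x = V *\<^sub>v (\<Phi> *\<^sub>v x)"
    if x: "x \<in> carrier_vec n"
      and inv: "\<And>z. \<Phi> *\<^sub>v (ract M (upper_unip z) *\<^sub>v x) = ract S (upper_unip z) *\<^sub>v (\<Phi> *\<^sub>v x)" for x
  proof -
    have \<Phi>c: "\<Phi> \<in> carrier_mat c n" using \<Phi> by (simp add: n_def c_def)
    have Cx: "C i *\<^sub>v x = (if i = 0 then \<Phi> *\<^sub>v x else 0\<^sub>v c)" if "i \<le> e" for i
    proof (rule eq_vecI)
      fix a assume "a < dim_vec (if i = 0 then \<Phi> *\<^sub>v x else 0\<^sub>v c)"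
      hence a: "a < c" by (simp split: if_splits)
      have "(C i *\<^sub>v x) $ a = (if i = 0 then (\<Phi> *\<^sub>v x) $ a else 0)"
      proof (rule power_sum_coeff_eqI[OF infinite_UNIV_alg_closed _ that])
        fix z :: 'a
        have "Cs 1 z *\<^sub>v x = ract S (upper_unip (-z)) *\<^sub>v (\<Phi> *\<^sub>v (ract M (upper_unip z) *\<^sub>v x))"
          unfolding Cs' using x \<Phi>c
          by (simp add: assoc_mult_mat_vec[of _ c c _ n] assoc_mult_mat_vec[of _ c n _ n] mult_carrier_mat[of _ c n])
        also have "\<dots> = (ract S (upper_unip (-z)) * ract S (upper_unip z)) *\<^sub>v (\<Phi> *\<^sub>v x)"
          using x \<Phi>c by (simp add: inv assoc_mult_mat_vec[of _ c c _ c])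
        also have "\<dots> = \<Phi> *\<^sub>v x" using x \<Phi>c by (simp add: cancel)
        finally have "(Cs 1 z *\<^sub>v x) $ a = (\<Phi> *\<^sub>v x) $ a" by simp
        moreover have "(Cs 1 z *\<^sub>v x) $ a = (\<Sum>i\<le>e. z ^ i * (C i *\<^sub>v x) $ a)"
        proof -
          have "(Cs 1 z *\<^sub>v x) $ a = (\<Sum>l<n. (\<Sum>i\<le>e. z ^ i * C i $$ (a, l)) * x $ l)"
            using a x by (auto simp: scalar_prod_def Cs_def atLeast0LessThan intro!: sum.cong)
          also have "\<dots> = (\<Sum>i\<le>e. z ^ i * (\<Sum>l<n. C i $$ (a, l) * x $ l))"
            by (simp add: sum_distrib_right sum_distrib_left mult.assoc) (rule sum.swap)
          also have "\<dots> = (\<Sum>i\<le>e. z ^ i * (C i *\<^sub>v x) $ a)"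
            using a x by (auto simp: scalar_prod_def atLeast0LessThan intro!: sum.cong)
          finally show ?thesis .
        qed
        moreover have "(\<Sum>i\<le>e. z ^ i * (if i = 0 then (\<Phi> *\<^sub>v x) $ a else 0)) = (\<Phi> *\<^sub>v x) $ a"
        proof -
          have "(\<Sum>i\<le>e. z ^ i * (if i = 0 then (\<Phi> *\<^sub>v x) $ a else 0)) =
            (\<Sum>i\<in>{0}. z ^ i * (if i = 0 then (\<Phi> *\<^sub>v x) $ a else 0))"
            by (rule sum.mono_neutral_right) auto
          thus ?thesis by simp
        qed
        ultimately show "(\<Sum>i\<le>e. z ^ i * (C i *\<^sub>v x) $ a) = (\<Sum>i\<le>e. z ^ i * (if i = 0 then (\<Phi> *\<^sub>v x) $ a else 0))"
          by simp
      qed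
      thus "(C i *\<^sub>v x) $ a = (if i = 0 then \<Phi> *\<^sub>v x else 0\<^sub>v c) $ a" using a by simp
    qed simp
    show ?thesis
    proof (rule eq_vecI)
      fix a assume "a < dim_vec (V *\<^sub>v (\<Phi> *\<^sub>v x))"
      hence a: "a < n" by simp
      have "(A *\<^sub>v x) $ a = (\<Sum>l<n. (\<Sum>i\<le>e. (-1) ^ i * (B i * C i) $$ (a, l)) * x $ l)"
        using a x by (auto simp: scalar_prod_def A_def atLeast0LessThan intro!: sum.cong)
      also have "\<dots> = (\<Sum>i\<le>e. (-1) ^ i * (\<Sum>l<n. (B i * C i) $$ (a, l) * x $ l))"
        by (simp add: sum_distrib_right sum_distrib_left mult.assoc) (rule sum.swap)
      also have "\<dots> = (\<Sum>i\<le>e. (-1) ^ i * ((B i * C i) *\<^sub>v x) $ a)"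
      proof (intro sum.cong refl arg_cong2[of _ _ _ _ "(*)"])
        fix i
        show "(\<Sum>l<n. (B i * C i) $$ (a, l) * x $ l) = ((B i * C i) *\<^sub>v x) $ a"
          using a x by (simp add: scalar_prod_def[of "row (B i * C i) a" x] atLeast0LessThan del: index_mult_mat(1))
      qed
      also have "\<dots> = (\<Sum>i\<le>e. if i = 0 then (V *\<^sub>v (\<Phi> *\<^sub>v x)) $ a else 0)"
      proof (intro sum.cong refl)
        fix i assume "i \<in> {..e}"
        thus "(-1) ^ i * ((B i * C i) *\<^sub>v x) $ a = (if i = 0 then (V *\<^sub>v (\<Phi> *\<^sub>v x)) $ a else 0)"
          using a x row_carrier_vec[OF a B[of i]] by (simp add: assoc_mult_mat_vec[OF B C x] Cx B0)
      qed
      finally show "(A *\<^sub>v x) $ a = (V *\<^sub>v (\<Phi> *\<^sub>v x)) $ a" by simp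
    qed simp
  qed
  show ?thesis
    using A(1) \<theta>(1) commute trace apply_A unfolding n_def by (rule that)
qed

section \<open>Endomorphisms of indecomposable modules\<close>

definition submat :: "'a mat \<Rightarrow> nat \<Rightarrow> nat \<Rightarrow> nat \<Rightarrow> nat \<Rightarrow> 'a mat" where
  "submat X i0 j0 r c = mat r c (\<lambda>(i, j). X $$ (i + i0, j + j0))"

lemma submat_carrier [simp]: "submat X i0 j0 r c \<in> carrier_mat r c"
  by (simp add: submat_def)

lemma submat_dim [simp]: "dim_row (submat X i0 j0 r c) = r" "dim_col (submat X i0 j0 r c) = c"
  by (simp_all add: submat_def)

lemma submat_index [simp]: "i < r \<Longrightarrow> j < c \<Longrightarrow> submat X i0 j0 r c $$ (i, j) = X $$ (i + i0, j + j0)"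
  by (simp add: submat_def)

lemma four_block_submat:
  assumes "X \<in> carrier_mat n n" "k \<le> n"
  shows "X = four_block_mat (submat X 0 0 k k) (submat X 0 k k (n - k))
    (submat X k 0 (n - k) k) (submat X k k (n - k) (n - k))"
  by (rule eq_matI) (use assms in auto)

lemma diagonal_blocks_mult:
  fixes A :: "'a::semiring_0 mat"
  assumes "A \<in> carrier_mat k k" "D \<in> carrier_mat m m" "A' \<in> carrier_mat k k" "D' \<in> carrier_mat m m"
  shows "four_block_mat A (0\<^sub>m k m) (0\<^sub>m m k) D * four_block_mat A' (0\<^sub>m k m) (0\<^sub>m m k) D' =
    four_block_mat (A * A') (0\<^sub>m k m) (0\<^sub>m m k) (D * D')"
proof -
  have "A * A' \<in> carrier_mat k k" "D * D' \<in> carrier_mat m m" using assms by auto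
  thus ?thesis using assms
    by (subst mult_four_block_mat[of _ k k _ m _ m _ _ k _ m]) auto
qed

lemma det_nonzero_inverse:
  fixes A :: "'a::field mat"
  assumes "A \<in> carrier_mat n n" "det A \<noteq> 0"
  obtains B where "B \<in> carrier_mat n n" "A * B = 1\<^sub>m n" "B * A = 1\<^sub>m n"
proof -
  have "A \<in> Units (ring_mat TYPE('a) n ())" using assms by (rule det_non_zero_imp_unit)
  thus ?thesis using that by (auto simp: Units_def ring_mat_def)
qed

lemma polynomial_fun_add:
  assumes "polynomial_fun f" "polynomial_fun g"
  shows "polynomial_fun (\<lambda>x. f x + g x)"
proof -
  obtain S k where S: "finite S" and f: "\<And>x. x \<in> GL2 \<Longrightarrow> f x = (\<Sum>(i, j, l, m)\<in>S. k (i, j, l, m) *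
        x $$ (0,0) ^ i * x $$ (0,1) ^ j * x $$ (1,0) ^ l * x $$ (1,1) ^ m)"
    using assms(1) unfolding polynomial_fun_def by blast
  obtain S' k' where S': "finite S'" and g: "\<And>x. x \<in> GL2 \<Longrightarrow> g x = (\<Sum>(i, j, l, m)\<in>S'. k' (i, j, l, m) *
        x $$ (0,0) ^ i * x $$ (0,1) ^ j * x $$ (1,0) ^ l * x $$ (1,1) ^ m)"
    using assms(2) unfolding polynomial_fun_def by blast
  define h where "h = (\<lambda>s. (if s \<in> S then k s else 0) + (if s \<in> S' then k' s else 0))"
  define mon :: "'a mat \<Rightarrow> nat \<times> nat \<times> nat \<times> nat \<Rightarrow> 'a" where
    "mon x = (\<lambda>(i, j, l, m). x $$ (0,0) ^ i * x $$ (0,1) ^ j * x $$ (1,0) ^ l * x $$ (1,1) ^ m)" for x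
  have conv: "(\<Sum>(i, j, l, m)\<in>T. c (i, j, l, m) *
        x $$ (0,0) ^ i * x $$ (0,1) ^ j * x $$ (1,0) ^ l * x $$ (1,1) ^ m) = (\<Sum>s\<in>T. c s * mon x s)"
    for T c x by (auto simp: mon_def mult_ac intro!: sum.cong)
  have "f x + g x = (\<Sum>s\<in>S \<union> S'. h s * mon x s)" if "x \<in> GL2" for x
  proof -
    have "(\<Sum>s\<in>S. k s * mon x s) = (\<Sum>s\<in>S \<union> S'. (if s \<in> S then k s else 0) * mon x s)"
      using S S' by (intro sum.mono_neutral_cong_left) auto
    moreover have "(\<Sum>s\<in>S'. k' s * mon x s) = (\<Sum>s\<in>S \<union> S'. (if s \<in> S' then k' s else 0) * mon x s)"
      using S S' by (intro sum.mono_neutral_cong_left) auto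
    ultimately show ?thesis using f[OF that, unfolded conv] g[OF that, unfolded conv]
      by (simp add: h_def distrib_right sum.distrib)
  qed
  thus ?thesis unfolding polynomial_fun_def conv
    by (intro exI[of _ "S \<union> S'"] exI[of _ h]) (use S S' in auto)
qed

lemma polynomial_fun_cmult:
  assumes "polynomial_fun f"
  shows "polynomial_fun (\<lambda>x. c * f x)"
proof -
  obtain S k where S: "finite S" and f: "\<And>x. x \<in> GL2 \<Longrightarrow> f x = (\<Sum>(i, j, l, m)\<in>S. k (i, j, l, m) *
        x $$ (0,0) ^ i * x $$ (0,1) ^ j * x $$ (1,0) ^ l * x $$ (1,1) ^ m)"
    using assms(1) unfolding polynomial_fun_def by blast
  show ?thesis unfolding polynomial_fun_def
    by (intro exI[of _ S] exI[of _ "\<lambda>s. c * k s"])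
       (use S f in \<open>auto simp: sum_distrib_left mult.assoc intro!: sum.cong\<close>)
qed

lemma polynomial_fun_sum:
  assumes "\<And>i. i \<in> I \<Longrightarrow> polynomial_fun (f i)"
  shows "polynomial_fun (\<lambda>x. \<Sum>i\<in>I. f i x)"
proof -
  have zero: "polynomial_fun (\<lambda>x::'b mat. 0)"
    unfolding polynomial_fun_def by (intro exI[of _ "{}"]) auto
  show ?thesis using assms
    by (induction I rule: infinite_finite_induct) (auto intro: zero polynomial_fun_add)
qed

lemma polynomial_fun_cong:
  assumes "\<And>x. x \<in> GL2 \<Longrightarrow> f x = g x" "polynomial_fun f"
  shows "polynomial_fun g"
  using assms unfolding polynomial_fun_def by simp

lemma polynomial_module_conjugate:
  assumes M: "polynomial_module M"
    and P: "P \<in> carrier_mat (rdim M) (rdim M)" "P' \<in> carrier_mat (rdim M) (rdim M)"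
    and inv: "P * P' = 1\<^sub>m (rdim M)" "P' * P = 1\<^sub>m (rdim M)"
  shows "polynomial_module \<lparr>rdim = rdim M, ract = (\<lambda>g. P * ract M g * P')\<rparr>"
  unfolding polynomial_module_def gl2_rep.simps
proof (intro conjI ballI allI impI)
  let ?n = "rdim M"
  note dims = carrier_matD[OF P(1)] carrier_matD[OF P(2)] ract_dim[OF M]
  fix g h :: "'a mat" assume gh: "g \<in> GL2" "h \<in> GL2"
  have "P * ract M g * P' * (P * ract M h * P') = P * (ract M g * ((P' * P) * (ract M h * P')))"
    using gh by (simp add: dims mat_assoc)
  also have "\<dots> = P * ract M (g * h) * P'"
    unfolding inv using gh by (simp add: dims mat_assoc ract_mult[OF M] left_mult_one_mat')
  finally show "P * ract M (g * h) * P' = P * ract M g * P' * (P * ract M h * P')" ..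
next
  fix i j assume ij: "i < rdim M" "j < rdim M"
  have "polynomial_fun (\<lambda>g. \<Sum>a<rdim M. \<Sum>b<rdim M. (P $$ (i, a) * P' $$ (b, j)) * ract M g $$ (a, b))"
    by (intro polynomial_fun_sum polynomial_fun_cmult ract_polynomial[OF M]) auto
  thus "polynomial_fun (\<lambda>g. (P * ract M g * P') $$ (i, j))"
  proof (rule polynomial_fun_cong[rotated])
    fix g :: "'a mat" assume g: "g \<in> GL2"
    have "(P * ract M g * P') $$ (i, j) = (\<Sum>a<rdim M. P $$ (i, a) * (\<Sum>b<rdim M. ract M g $$ (a, b) * P' $$ (b, j)))"
      using P ract_carrier[OF M g] ij
      by (simp add: mult_index_sum[of _ "rdim M" "rdim M" _ "rdim M"] del: index_mult_mat)
    thus "(\<Sum>a<rdim M. \<Sum>b<rdim M. (P $$ (i, a) * P' $$ (b, j)) * ract M g $$ (a, b)) =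
      (P * ract M g * P') $$ (i, j)"
      by (simp add: sum_distrib_left mult_ac)
  qed
qed (use assms ract_carrier[OF M] ract_one[OF M] in \<open>auto intro!: mult_carrier_mat\<close>)

text \<open>Simultaneous block diagonal form is what a direct sum decomposition amounts to. The
  agreement is on \<open>GL2\<close> only, since values of \<open>ract\<close> elsewhere are
  arbitrary.\<close>

lemma polynomial_module_blocks:
  assumes M: "polynomial_module M" and k: "k \<le> rdim M"
    and offdiag: "\<And>g i j. g \<in> GL2 \<Longrightarrow> i < k \<Longrightarrow> k \<le> j \<Longrightarrow> j < rdim M \<Longrightarrow>
      ract M g $$ (i, j) = 0 \<and> ract M g $$ (j, i) = 0"
  obtains N Q where "polynomial_module N" "polynomial_module Q" "rdim N = k" "rdim Q = rdim M - k"
    "\<And>g. g \<in> GL2 \<Longrightarrow> ract (direct_sum N Q) g = ract M g"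
proof -
  let ?n = "rdim M"
  define N where "N = \<lparr>rdim = k, ract = (\<lambda>g. submat (ract M g) 0 0 k k)\<rparr>"
  define Q where "Q = \<lparr>rdim = ?n - k, ract = (\<lambda>g. submat (ract M g) k k (?n - k) (?n - k))\<rparr>"
  have blocks: "ract M g = four_block_mat (ract N g) (0\<^sub>m k (?n - k)) (0\<^sub>m (?n - k) k) (ract Q g)"
    if g: "g \<in> GL2" for g
  proof -
    have "submat (ract M g) 0 k k (?n - k) = 0\<^sub>m k (?n - k)"
      "submat (ract M g) k 0 (?n - k) k = 0\<^sub>m (?n - k) k"
      using offdiag[OF g] by (auto intro!: eq_matI)
    thus ?thesis using four_block_submat[OF ract_carrier[OF M g] k] by (simp add: N_def Q_def)
  qed
  have [simp]: "ract N g \<in> carrier_mat k k" "ract Q g \<in> carrier_mat (?n - k) (?n - k)" for g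
    by (auto simp: N_def Q_def)
  have mult: "ract N (g * h) = ract N g * ract N h \<and> ract Q (g * h) = ract Q g * ract Q h"
    if g: "g \<in> GL2" and h: "h \<in> GL2" for g h
  proof -
    have "ract M (g * h) = four_block_mat (ract N g * ract N h) (0\<^sub>m k (?n - k)) (0\<^sub>m (?n - k) k) (ract Q g * ract Q h)"
      unfolding ract_mult[OF M g h] blocks[OF g] blocks[OF h]
      by (rule diagonal_blocks_mult[of _ k _ "?n - k"]) auto
    hence *: "ract M (g * h) $$ (i, j) = four_block_mat (ract N g * ract N h) (0\<^sub>m k (?n - k)) (0\<^sub>m (?n - k) k) (ract Q g * ract Q h) $$ (i, j)"
      for i j by simp
    have dims: "dim_row (ract N g * ract N h) = k" "dim_col (ract N g * ract N h) = k"
      "dim_row (ract Q g * ract Q h) = ?n - k" "dim_col (ract Q g * ract Q h) = ?n - k"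
      by (simp_all add: N_def Q_def)
    have "ract N (g * h) = ract N g * ract N h"
    proof (rule eq_matI)
      fix i j assume "i < dim_row (ract N g * ract N h)" "j < dim_col (ract N g * ract N h)"
      hence ij: "i < k" "j < k" using dims by auto
      have "ract N (g * h) $$ (i, j) = ract M (g * h) $$ (i, j)" using ij by (simp add: N_def)
      also have "\<dots> = (ract N g * ract N h) $$ (i, j)"
        unfolding * using ij by (subst index_mat_four_block(1)) (simp_all only: dims, simp_all)
      finally show "ract N (g * h) $$ (i, j) = (ract N g * ract N h) $$ (i, j)" .
    qed (simp_all add: N_def)
    moreover have "ract Q (g * h) = ract Q g * ract Q h"
    proof (rule eq_matI)
      fix i j assume "i < dim_row (ract Q g * ract Q h)" "j < dim_col (ract Q g * ract Q h)"
      hence ij: "i < ?n - k" "j < ?n - k" using dims by auto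
      have "ract Q (g * h) $$ (i, j) = ract M (g * h) $$ (i + k, j + k)" using ij by (simp add: Q_def)
      also have "\<dots> = (ract Q g * ract Q h) $$ (i, j)"
        unfolding * using ij k by (subst index_mat_four_block(1)) (simp_all only: dims, simp_all)
      finally show "ract Q (g * h) $$ (i, j) = (ract Q g * ract Q h) $$ (i, j)" .
    qed (simp_all add: Q_def)
    ultimately show ?thesis ..
  qed
  show ?thesis
  proof
    show "rdim N = k" "rdim Q = ?n - k" by (simp_all add: N_def Q_def)
    show "ract (direct_sum N Q) g = ract M g" if "g \<in> GL2" for g
      using blocks[OF that] by (simp add: direct_sum_def N_def Q_def)
    show "polynomial_module N" unfolding polynomial_module_def
    proof (intro conjI allI ballI impI)
      show "ract N (1\<^sub>m 2) = 1\<^sub>m (rdim N)" using k by (auto simp: N_def ract_one[OF M] intro!: eq_matI)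
      fix i j assume "i < rdim N" "j < rdim N"
      thus "polynomial_fun (\<lambda>g. ract N g $$ (i, j))"
        using k ract_polynomial[OF M, of i j] by (simp add: N_def)
    qed (use mult in \<open>auto simp: N_def\<close>)
    show "polynomial_module Q" unfolding polynomial_module_def
    proof (intro conjI allI ballI impI)
      show "ract Q (1\<^sub>m 2) = 1\<^sub>m (rdim Q)" using k by (auto simp: Q_def ract_one[OF M] intro!: eq_matI)
      fix i j assume "i < rdim Q" "j < rdim Q"
      thus "polynomial_fun (\<lambda>g. ract Q g $$ (i, j))"
        using k ract_polynomial[OF M, of "i + k" "j + k"] by (simp add: Q_def)
    qed (use mult in \<open>auto simp: Q_def\<close>)
  qed
qed

lemma unipotent_blocks_inverse:
  fixes X :: "'a::ring_1 mat"
  assumes X: "X \<in> carrier_mat k m"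
  defines "T \<equiv> \<lambda>X. four_block_mat (1\<^sub>m k) X (0\<^sub>m m k) (1\<^sub>m m)"
  shows "T X * T (- X) = 1\<^sub>m (k + m)" "T (- X) * T X = 1\<^sub>m (k + m)"
proof -
  have *: "T Y * T Z = T (Z + Y)" if "Y \<in> carrier_mat k m" "Z \<in> carrier_mat k m" for Y Z
    unfolding T_def using that
    by (subst mult_four_block_mat[of _ k k _ m _ m _ _ k _ m]) auto
  have "T (0\<^sub>m k m) = 1\<^sub>m (k + m)" unfolding T_def by (rule four_block_one_mat)
  moreover have "- X + X = 0\<^sub>m k m" "X + - X = 0\<^sub>m k m"
    using X by (auto intro!: eq_matI)
  ultimately show "T X * T (- X) = 1\<^sub>m (k + m)" "T (- X) * T X = 1\<^sub>m (k + m)"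
    using *[of X "- X"] *[of "- X" X] X by simp_all
qed

text \<open>
  Fitting's lemma: among the matrices \<open>C\<close> that share the properties of \<open>A\<close> and are closed under
  squaring, one of minimal rank \<open>k\<close> is similar to \<open>diag(B, 0)\<close> with \<open>B\<close> invertible of size \<open>k\<close>.
\<close>
lemma indecomposable_endomorphism_invertible:
  fixes M :: "'a::field gl2_rep"
  assumes M: "polynomial_module M" and indec: "indecomposable M"
    and A: "A \<in> carrier_mat (rdim M) (rdim M)"
    and comm: "\<And>g. g \<in> GL2 \<Longrightarrow> A * ract M g = ract M g * A"
    and v: "v \<in> carrier_vec (rdim M)" "v \<noteq> 0\<^sub>v (rdim M)" and eig: "A *\<^sub>v v = c \<cdot>\<^sub>v v" "c \<noteq> 0"
  shows "\<exists>A'. A' \<in> carrier_mat (rdim M) (rdim M) \<and> A' * A = 1\<^sub>m (rdim M) \<and>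
    (\<forall>g\<in>GL2. A' * ract M g = ract M g * A')"
proof -
  define n where "n = rdim M"
  note [simp] = M ract_carrier[OF M, folded n_def] ract_dim[OF M, folded n_def]
  have A_dim [simp]: "dim_row A = n" "dim_col A = n" using A by (auto simp: n_def)
  \<comment> \<open>The eigenvector keeps \<open>C\<close> nonzero under squaring. The factor
    \<open>X\<close> records that \<open>C\<close> is a left multiple of \<open>A\<close>, so that
    inverting \<open>C\<close> will invert \<open>A\<close>.\<close>
  define good where "good C \<longleftrightarrow> C \<in> carrier_mat n n \<and> (\<forall>g\<in>GL2. C * ract M g = ract M g * C) \<and>
    (\<exists>d. d \<noteq> 0 \<and> C *\<^sub>v v = d \<cdot>\<^sub>v v) \<and> (\<exists>X\<in>carrier_mat n n. C = X * A)" for C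
  have good_A: "good A" unfolding good_def using A comm eig
    by (auto simp: n_def intro!: bexI[of _ "1\<^sub>m (rdim M)"])
  have good_square: "good (C * C)" if C: "good C" for C
  proof -
    have Cc: "C \<in> carrier_mat n n" using C by (simp add: good_def)
    note [simp] = carrier_matD[OF Cc]
    obtain d where d: "d \<noteq> 0" "C *\<^sub>v v = d \<cdot>\<^sub>v v" using C by (auto simp: good_def)
    obtain X where X: "X \<in> carrier_mat n n" "C = X * A" using C by (auto simp: good_def)
    have "C * C * ract M g = ract M g * (C * C)" if g: "g \<in> GL2" for g
    proof -
      have "C * C * ract M g = C * (ract M g * C)" using C g by (simp add: good_def mat_assoc)
      also have "\<dots> = (C * ract M g) * C" using g by (simp add: mat_assoc)
      also have "\<dots> = (ract M g * C) * C" using C g by (simp add: good_def)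
      finally show ?thesis using g by (simp add: mat_assoc)
    qed
    moreover have "C * C *\<^sub>v v = (d * d) \<cdot>\<^sub>v v"
      using v Cc d(2) by (simp add: n_def assoc_mult_mat_vec[of _ n n _ n] mult_mat_vec[OF Cc] smult_smult_assoc)
    moreover have "C * C = (C * X) * A" using X(1) by (subst X(2)) (simp add: mat_assoc)
    moreover have "C * X \<in> carrier_mat n n" "C * C \<in> carrier_mat n n" using Cc X(1) by auto
    moreover have "d * d \<noteq> 0" using d(1) by simp
    ultimately show ?thesis unfolding good_def by blast
  qed
  \<comment> \<open>Rank at most k is expressed up to similarity: after conjugation all rows from
    index k on vanish. This form yields the block shape of \<open>D\<close> directly.\<close>
  define rank_le where "rank_le k \<longleftrightarrow> k \<le> n \<and> (\<exists>C P P'. good C \<and> P \<in> carrier_mat n n \<and> P' \<in> carrier_mat n n \<and>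
    P * P' = 1\<^sub>m n \<and> P' * P = 1\<^sub>m n \<and> (\<forall>i j. k \<le> i \<longrightarrow> i < n \<longrightarrow> j < n \<longrightarrow> (P * C * P') $$ (i, j) = 0))" for k
  have "rank_le n" unfolding rank_le_def
    by (rule conjI, simp, rule exI[of _ A], rule exI[of _ "1\<^sub>m n"], rule exI[of _ "1\<^sub>m n"])
       (auto simp: good_A)
  define k where "k = (LEAST k. rank_le k)"
  have rk: "rank_le k" unfolding k_def by (rule LeastI[of _ n]) fact
  have least: "\<not> rank_le k'" if "k' < k" for k' using that not_less_Least unfolding k_def by blast
  obtain C P P' where C: "good C" and P: "P \<in> carrier_mat n n" "P' \<in> carrier_mat n n"
    and PP': "P * P' = 1\<^sub>m n" "P' * P = 1\<^sub>m n"
    and rows: "\<And>i j. k \<le> i \<Longrightarrow> i < n \<Longrightarrow> j < n \<Longrightarrow> (P * C * P') $$ (i, j) = 0" and kn: "k \<le> n"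
    using rk unfolding rank_le_def by blast
  have Cc: "C \<in> carrier_mat n n" using C by (simp add: good_def)
  note [simp] = carrier_matD[OF Cc] carrier_matD[OF P(1)] carrier_matD[OF P(2)]
  define D where "D = P * C * P'"
  have Dc: "D \<in> carrier_mat n n" using P Cc by (simp add: D_def)
  note [simp] = carrier_matD[OF Dc]
  define B1 B2 where "B1 = submat D 0 0 k k" and "B2 = submat D 0 k k (n - k)"
  have [simp]: "B1 \<in> carrier_mat k k" "B2 \<in> carrier_mat k (n - k)"
    "dim_row B1 = k" "dim_col B1 = k" "dim_row B2 = k" "dim_col B2 = n - k"
    by (simp_all add: B1_def B2_def)
  define blk where "blk X Y = four_block_mat X Y (0\<^sub>m (n - k) k) (0\<^sub>m (n - k) (n - k))" for X Y :: "'a mat"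
  have D_blk: "D = blk B1 B2"
    unfolding blk_def by (rule eq_matI) (use kn rows[folded D_def] in \<open>auto simp: B1_def B2_def\<close>)
  \<comment> \<open>If \<open>B1\<close> were singular, a row operation would clear row k - 1 of
    \<open>P0 * B1\<close>, hence also of \<open>P0 * B1 * B2\<close>. So the square of
    \<open>C\<close> would have fewer than k nonzero rows. Squaring is essential: \<open>B2\<close>
    may keep that row of \<open>D\<close> itself nonzero.\<close>
  have "det B1 \<noteq> 0"
  proof
    assume "det B1 = 0"
    then obtain P0 where P0: "P0 \<in> Units (ring_mat TYPE('a) k ())" "row (P0 * B1) (k - 1) = 0\<^sub>v k" "0 < k"
      using det_zero_imp_zero_row[of B1 k "()"] by auto
    then obtain P0' where P0': "P0' \<in> carrier_mat k k" "P0 * P0' = 1\<^sub>m k" "P0' * P0 = 1\<^sub>m k" "P0 \<in> carrier_mat k k"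
      by (auto simp: Units_def ring_mat_def)
    note [simp] = carrier_matD[OF P0'(1)] carrier_matD[OF P0'(4)]
    define R where "R = four_block_mat P0 (0\<^sub>m k (n - k)) (0\<^sub>m (n - k) k) (1\<^sub>m (n - k))"
    define R' where "R' = four_block_mat P0' (0\<^sub>m k (n - k)) (0\<^sub>m (n - k) k) (1\<^sub>m (n - k))"
    have Rdim [simp]: "dim_row R = n" "dim_col R = n" "dim_row R' = n" "dim_col R' = n"
      using kn by (simp_all add: R_def R'_def)
    have Rc: "R \<in> carrier_mat n n" "R' \<in> carrier_mat n n" by (auto intro: carrier_matI)
    have RR': "R * R' = 1\<^sub>m n" "R' * R = 1\<^sub>m n"
      using kn P0' by (simp_all add: R_def R'_def diagonal_blocks_mult[of _ k _ "n - k"])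
    have "R * D = four_block_mat (P0 * B1) (P0 * B2) (0\<^sub>m (n - k) k) (0\<^sub>m (n - k) (n - k))"
    proof -
      have "P0 * B1 \<in> carrier_mat k k" "P0 * B2 \<in> carrier_mat k (n - k)" using P0'(4) by auto
      thus ?thesis unfolding R_def D_blk blk_def using P0'(4)
        by (subst mult_four_block_mat[of _ k k _ "n - k" _ "n - k" _ _ k _ "n - k"]) auto
    qed
    hence RD_D: "R * D * D = four_block_mat (P0 * B1 * B1) (P0 * B1 * B2) (0\<^sub>m (n - k) k) (0\<^sub>m (n - k) (n - k))"
    proof -
      assume RD: "R * D = four_block_mat (P0 * B1) (P0 * B2) (0\<^sub>m (n - k) k) (0\<^sub>m (n - k) (n - k))"
      have c: "P0 * B1 \<in> carrier_mat k k" "P0 * B2 \<in> carrier_mat k (n - k)" using P0'(4) by auto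
      hence "P0 * B1 * B1 \<in> carrier_mat k k" "P0 * B1 * B2 \<in> carrier_mat k (n - k)" by auto
      thus ?thesis unfolding RD unfolding D_blk blk_def using c
        by (subst mult_four_block_mat[of _ k k _ "n - k" _ "n - k" _ _ k _ "n - k"]) auto
    qed
    have RDD: "(R * D * D) $$ (i, j) = 0" if "k - 1 \<le> i" "i < n" "j < n" for i j
    proof (cases "i < k")
      case True
      hence i: "i = k - 1" using that by simp
      have zero: "row (P0 * B1 * Y) (k - 1) = 0\<^sub>v m" if "Y \<in> carrier_mat k m" for Y m
      proof (rule eq_vecI)
        fix j assume "j < dim_vec (0\<^sub>v m)"
        thus "row (P0 * B1 * Y) (k - 1) $ j = 0\<^sub>v m $ j"
          using P0(2,3) carrier_matD[OF that] col_carrier_vec[OF _ that, of j] by simp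
      qed (simp add: carrier_matD[OF that])
      have e1: "(P0 * B1 * B1) $$ (k - 1, j) = 0" if "j < k" for j
        using arg_cong[OF zero[of B1 k], of "\<lambda>w. w $ j"] that P0(3) by simp
      have e2: "(P0 * B1 * B2) $$ (k - 1, j) = 0" if "j < n - k" for j
        using arg_cong[OF zero[of B2 "n - k"], of "\<lambda>w. w $ j"] that P0(3) by simp
      show ?thesis unfolding RD_D i using that P0(3) kn e1[of j] e2[of "j - k"]
        by (subst index_mat_four_block(1)) auto
    next
      case False
      thus ?thesis unfolding RD_D using that kn by (subst index_mat_four_block(1)) auto
    qed
    have "(R * P) * (C * C) * (P' * R') = R * ((P * (C * (1\<^sub>m n * (C * P')))) * R')"
      by (simp add: mat_assoc)
    also have "\<dots> = R * D * D * R'" unfolding PP'(2)[symmetric] D_def by (simp add: mat_assoc)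
    finally have conj: "(R * P) * (C * C) * (P' * R') = R * D * D * R'" .
    have "(R * P) * (P' * R') = R * ((P * P') * R')" by (simp add: mat_assoc)
    hence inv1: "(R * P) * (P' * R') = 1\<^sub>m n" by (simp add: PP' RR')
    have "(P' * R') * (R * P) = P' * ((R' * R) * P)" by (simp add: mat_assoc)
    hence inv2: "(P' * R') * (R * P) = 1\<^sub>m n" by (simp add: PP' RR')
    have "((R * P) * (C * C) * (P' * R')) $$ (i, j) = 0" if "k - 1 \<le> i" "i < n" "j < n" for i j
    proof -
      have "R * D * D \<in> carrier_mat n n" by (rule carrier_matI) auto
      from mult_index_sum[OF this Rc(2) that(2,3)] show ?thesis unfolding conj
        using RDD[OF that(1,2)] by simp
    qed
    moreover have "R * P \<in> carrier_mat n n" "P' * R' \<in> carrier_mat n n" "k - 1 \<le> n"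
      using kn by (auto intro!: carrier_matI)
    ultimately have "rank_le (k - 1)" unfolding rank_le_def
      using good_square[OF C] inv1 inv2 by blast
    thus False using least[of "k - 1"] P0(3) by simp
  qed
  then obtain B1' where B1': "B1' \<in> carrier_mat k k" "B1 * B1' = 1\<^sub>m k" "B1' * B1 = 1\<^sub>m k"
    using det_nonzero_inverse[of B1 k] by auto
  note [simp] = carrier_matD[OF B1'(1)]
  \<comment> \<open>Conjugation by this unipotent block matrix removes \<open>B2\<close>:
    \<open>T\<close> fixes \<open>D\<close> from the left because the lower rows of \<open>D\<close>
    vanish, and \<open>T'\<close> from the right clears the upper right block.\<close>
  define T where "T = four_block_mat (1\<^sub>m k) (B1' * B2) (0\<^sub>m (n - k) k) (1\<^sub>m (n - k))"
  define T' where "T' = four_block_mat (1\<^sub>m k) (- (B1' * B2)) (0\<^sub>m (n - k) k) (1\<^sub>m (n - k))"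
  have Tdim [simp]: "dim_row T = n" "dim_col T = n" "dim_row T' = n" "dim_col T' = n"
    using kn by (simp_all add: T_def T'_def)
  have Tc: "T \<in> carrier_mat n n" "T' \<in> carrier_mat n n" by (auto intro: carrier_matI)
  have BB: "B1' * B2 \<in> carrier_mat k (n - k)" using B1' by auto
  have TT': "T * T' = 1\<^sub>m n" "T' * T = 1\<^sub>m n"
    using unipotent_blocks_inverse[OF BB] kn by (simp_all add: T_def T'_def)
  have TD: "T * D = D" unfolding T_def D_blk blk_def using BB
    by (subst mult_four_block_mat[of _ k k _ "n - k" _ "n - k" _ _ k _ "n - k"]) auto
  have "B1 * (B1' * B2) = (B1 * B1') * B2" by (simp add: mat_assoc)
  hence BBB: "B1 * (B1' * B2) = B2" using B1'(2) by simp
  have B1_neg: "B1 * - (B1' * B2) + B2 = 0\<^sub>m k (n - k)"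
  proof -
    have "B1 * - (B1' * B2) = - B2" by (subst uminus_mult_right_mat) (simp_all add: BBB)
    thus ?thesis by (simp add: uminus_l_inv_mat[of _ k "n - k"])
  qed
  have DT': "D * T' = blk B1 (0\<^sub>m k (n - k))" unfolding T'_def D_blk blk_def using BB
    by (subst mult_four_block_mat[of _ k k _ "n - k" _ "n - k" _ _ k _ "n - k"])
       (auto simp: BBB B1_neg)
  define U U' where "U = T * P" and "U' = P' * T'"
  have Udim [simp]: "dim_row U = n" "dim_col U = n" "dim_row U' = n" "dim_col U' = n"
    by (simp_all add: U_def U'_def)
  have Uc: "U \<in> carrier_mat n n" "U' \<in> carrier_mat n n" by (auto intro: carrier_matI)
  have "U * U' = T * ((P * P') * T')" by (simp add: U_def U'_def mat_assoc)
  hence UU': "U * U' = 1\<^sub>m n" by (simp add: PP' TT')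
  have "U' * U = P' * ((T' * T) * P)" by (simp add: U_def U'_def mat_assoc)
  hence U'U: "U' * U = 1\<^sub>m n" by (simp add: PP' TT')
  define E where "E = blk B1 (0\<^sub>m k (n - k))"
  have Edim [simp]: "dim_row E = n" "dim_col E = n" using kn by (simp_all add: E_def blk_def)
  have Ec: "E \<in> carrier_mat n n" by (rule carrier_matI) auto
  have "U * C * U' = (T * D) * T'" by (simp add: U_def U'_def D_def mat_assoc)
  hence UCU': "U * C * U' = E" by (simp add: TD DT' E_def)
  have E_index: "E $$ (i, j) = (if i < k \<and> j < k then B1 $$ (i, j) else 0)" if "i < n" "j < n" for i j
    using that kn by (auto simp: E_def blk_def)
  define M' where "M' = \<lparr>rdim = rdim M, ract = (\<lambda>g. U * ract M g * U')\<rparr>"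
  have M': "polynomial_module M'" unfolding M'_def
    by (rule polynomial_module_conjugate) (use Uc UU' U'U in \<open>auto simp: n_def\<close>)
  have M'dim [simp]: "dim_row (ract M' g) = n" "dim_col (ract M' g) = n" for g by (simp_all add: M'_def)
  have M'c: "ract M' g \<in> carrier_mat n n" for g by (rule carrier_matI) auto
  have commE: "E * ract M' g = ract M' g * E" if g: "g \<in> GL2" for g
  proof -
    have "E * ract M' g = U * (C * ((U' * U) * (ract M g * U')))"
      unfolding UCU'[symmetric] using g by (simp add: M'_def mat_assoc)
    also have "\<dots> = U * ((C * ract M g) * U')" unfolding U'U using g by (simp add: mat_assoc)
    also have "\<dots> = U * (ract M g * ((U' * U) * (C * U')))"
      unfolding U'U using C g by (simp add: good_def mat_assoc)
    also have "\<dots> = ract M' g * E"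
      unfolding UCU'[symmetric] using g by (simp add: M'_def mat_assoc)
    finally show ?thesis .
  qed
  \<comment> \<open>Commuting with diag(B1, 0) forces B1 X = 0 for the upper right block X of the
    action and Y B1 = 0 for the lower left block Y; \<open>B1\<close> is invertible.\<close>
  have offdiag: "ract M' g $$ (i, j) = 0 \<and> ract M' g $$ (j, i) = 0"
    if g: "g \<in> GL2" and i: "i < k" and j: "k \<le> j" "j < n" for g i j
  proof
    let ?X = "ract M' g"
    have "(B1 * submat ?X 0 k k (n - k)) = 0\<^sub>m k (n - k)"
    proof (rule eq_matI)
      fix a b assume "a < dim_row (0\<^sub>m k (n - k))" "b < dim_col (0\<^sub>m k (n - k))"
      hence ab: "a < k" "b < n - k" by auto
      have "(B1 * submat ?X 0 k k (n - k)) $$ (a, b) = (\<Sum>l<k. B1 $$ (a, l) * ?X $$ (l, b + k))"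
        using ab by (subst mult_index_sum[of _ k k _ "n - k"]) auto
      also have "\<dots> = (\<Sum>l<n. E $$ (a, l) * ?X $$ (l, b + k))"
        using ab kn by (intro sum.mono_neutral_cong_left) (auto simp: E_index)
      also have "\<dots> = (?X * E) $$ (a, b + k)"
        using ab kn unfolding commE[OF g, symmetric] by (subst mult_index_sum[OF Ec M'c]) auto
      also have "\<dots> = (\<Sum>l<n. ?X $$ (a, l) * E $$ (l, b + k))"
        using ab kn by (subst mult_index_sum[OF M'c Ec]) auto
      also have "\<dots> = 0" using ab kn by (intro sum.neutral) (auto simp: E_index)
      finally show "(B1 * submat ?X 0 k k (n - k)) $$ (a, b) = 0\<^sub>m k (n - k) $$ (a, b)" using ab by simp
    qed auto
    hence "B1' * (B1 * submat ?X 0 k k (n - k)) = B1' * 0\<^sub>m k (n - k)" by simp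
    hence "(B1' * B1) * submat ?X 0 k k (n - k) = 0\<^sub>m k (n - k)" using B1'(1) by (simp add: mat_assoc)
    hence "submat ?X 0 k k (n - k) = 0\<^sub>m k (n - k)" unfolding B1'(3) by simp
    hence "submat ?X 0 k k (n - k) $$ (i, j - k) = 0" using i j by simp
    thus "?X $$ (i, j) = 0" using i j by simp
    have "(submat ?X k 0 (n - k) k * B1) = 0\<^sub>m (n - k) k"
    proof (rule eq_matI)
      fix a b assume "a < dim_row (0\<^sub>m (n - k) k)" "b < dim_col (0\<^sub>m (n - k) k)"
      hence ab: "a < n - k" "b < k" by auto
      have "(submat ?X k 0 (n - k) k * B1) $$ (a, b) = (\<Sum>l<k. ?X $$ (a + k, l) * B1 $$ (l, b))"
        using ab by (subst mult_index_sum[of _ "n - k" k _ k]) auto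
      also have "\<dots> = (\<Sum>l<n. ?X $$ (a + k, l) * E $$ (l, b))"
        using ab kn by (intro sum.mono_neutral_cong_left) (auto simp: E_index)
      also have "\<dots> = (E * ?X) $$ (a + k, b)"
        using ab kn unfolding commE[OF g] by (subst mult_index_sum[OF M'c Ec]) auto
      also have "\<dots> = (\<Sum>l<n. E $$ (a + k, l) * ?X $$ (l, b))"
        using ab kn by (subst mult_index_sum[OF Ec M'c]) auto
      also have "\<dots> = 0" using ab kn by (intro sum.neutral) (auto simp: E_index)
      finally show "(submat ?X k 0 (n - k) k * B1) $$ (a, b) = 0\<^sub>m (n - k) k $$ (a, b)" using ab by simp
    qed auto
    hence "(submat ?X k 0 (n - k) k * B1) * B1' = 0\<^sub>m (n - k) k * B1'" by simp
    hence "submat ?X k 0 (n - k) k * (B1 * B1') = 0\<^sub>m (n - k) k" using B1'(1) by (simp add: mat_assoc)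
    hence "submat ?X k 0 (n - k) k = 0\<^sub>m (n - k) k" unfolding B1'(2) by simp
    hence "submat ?X k 0 (n - k) k $$ (j - k, i) = 0" using i j by simp
    thus "?X $$ (j, i) = 0" using i j by simp
  qed
  have "k \<noteq> 0"
  proof
    assume "k = 0"
    hence "E = 0\<^sub>m n n" by (intro eq_matI) (auto simp: E_index)
    moreover have "C = (U' * U) * C * (U' * U)" by (simp add: U'U)
    hence "C = U' * E * U" unfolding UCU'[symmetric] by (simp add: mat_assoc)
    ultimately have "C = 0\<^sub>m n n" by simp
    moreover obtain d where d: "d \<noteq> 0" "C *\<^sub>v v = d \<cdot>\<^sub>v v" using C by (auto simp: good_def)
    moreover have "0\<^sub>m n n *\<^sub>v v = 0\<^sub>v n" using v(1) by (intro eq_vecI) (auto simp: n_def)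
    ultimately have "d \<cdot>\<^sub>v v = 0\<^sub>v n" by simp
    moreover have "v = inverse d \<cdot>\<^sub>v (d \<cdot>\<^sub>v v)" using d(1) by (simp add: smult_smult_assoc)
    moreover have "inverse d \<cdot>\<^sub>v 0\<^sub>v n = 0\<^sub>v n" by (rule eq_vecI) auto
    ultimately have "v = 0\<^sub>v n" by simp
    thus False using v(2) by (simp add: n_def)
  qed
  moreover have "k = n \<or> k = 0"
  proof (rule ccontr)
    assume "\<not> (k = n \<or> k = 0)"
    obtain N Q where NQ: "polynomial_module N" "polynomial_module Q" "rdim N = k" "rdim Q = n - k"
      "\<And>g. g \<in> GL2 \<Longrightarrow> ract (direct_sum N Q) g = ract M' g"
      using polynomial_module_blocks[OF M', of k] offdiag kn by (auto simp: M'_def n_def)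
    have "rep_iso M (direct_sum N Q)" unfolding rep_iso_def
    proof (intro conjI bexI[of _ U] ballI)
      show "rdim M = rdim (direct_sum N Q)" using NQ kn by (simp add: direct_sum_def n_def)
      show "U \<in> carrier_mat (rdim (direct_sum N Q)) (rdim M)"
        using NQ kn Uc by (simp add: direct_sum_def n_def)
      show "invertible_mat U" unfolding invertible_mat_def inverts_mat_def
        using UU' U'U by (auto intro!: exI[of _ U'])
      fix g :: "'a mat" assume g: "g \<in> GL2"
      have "ract M' g * U = U * (ract M g * (U' * U))" using g by (simp add: M'_def mat_assoc)
      thus "U * ract M g = ract (direct_sum N Q) g * U" using g by (simp add: NQ(5) U'U)
    qed
    moreover have "rdim N \<noteq> 0" "rdim Q \<noteq> 0" using NQ \<open>\<not> (k = n \<or> k = 0)\<close> kn by auto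
    ultimately show False using indec NQ(1,2) unfolding indecomposable_def by blast
  qed
  ultimately have k: "k = n" by simp
  have EB: "E = B1" using k by (intro eq_matI) (auto simp: E_index)
  obtain X where X: "X \<in> carrier_mat n n" "C = X * A" using C by (auto simp: good_def)
  note [simp] = carrier_matD[OF X(1)]
  \<comment> \<open>This is the inverse of \<open>C\<close> times \<open>X\<close>, written in the
    coordinates in which \<open>C\<close> becomes \<open>B1\<close>.\<close>
  define A' where "A' = U' * (B1' * (U * X))"
  have [simp]: "dim_row A' = n" "dim_col A' = n" by (simp_all add: A'_def k)
  have A'c: "A' \<in> carrier_mat n n" by (rule carrier_matI) auto
  have B1'n: "B1' * E = 1\<^sub>m n" using B1'(3) by (simp add: EB k)
  have "A' * A = U' * (B1' * (U * (C * (U' * U))))"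
    using X(2) by (simp add: A'_def mat_assoc k U'U)
  also have "\<dots> = U' * ((B1' * (U * C * U')) * U)" by (simp add: mat_assoc k)
  also have "\<dots> = 1\<^sub>m n" unfolding UCU' B1'n by (simp add: U'U)
  finally have A'A: "A' * A = 1\<^sub>m n" .
  have AA': "A * A' = 1\<^sub>m n" by (rule mat_mult_left_right_inverse[OF A'c _ A'A]) (use A in \<open>simp add: n_def\<close>)
  have "A' * ract M g = ract M g * A'" if g: "g \<in> GL2" for g
  proof -
    have "A' * ract M g = A' * (ract M g * (A * A'))" using g by (simp add: AA')
    also have "\<dots> = A' * ((A * ract M g) * A')" unfolding comm[OF g] using g by (simp add: mat_assoc)
    also have "\<dots> = (A' * A) * (ract M g * A')" using g by (simp add: mat_assoc)
    finally show ?thesis using g by (simp add: A'A)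
  qed
  thus ?thesis using A'c A'A by (auto simp: n_def)
qed

section \<open>Weights\<close>

lemma weight_space_iff:
  "x \<in> weight_space M (a, b) \<longleftrightarrow> x \<in> rspace M \<and>
    (\<forall>s t. s \<noteq> 0 \<longrightarrow> t \<noteq> 0 \<longrightarrow> ract M (mat2 s 0 0 t) *\<^sub>v x = (s ^ a * t ^ b) \<cdot>\<^sub>v x)"
  by (simp add: weight_space_def mat_diag_mat2)

lemma mult_mat_zero_vec:
  fixes A :: "'a::semiring_0 mat"
  assumes "A \<in> carrier_mat n m"
  shows "A *\<^sub>v 0\<^sub>v m = 0\<^sub>v n"
proof (rule eq_vecI)
  fix i assume i: "i < dim_vec (0\<^sub>v n)"
  hence "row A i \<in> carrier_vec m" using assms by simp
  thus "(A *\<^sub>v 0\<^sub>v m) $ i = 0\<^sub>v n $ i" using i assms by simp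
qed (use assms in simp)

lemma ract_mult_vec:
  assumes "polynomial_module M" "g \<in> GL2" "h \<in> GL2" "x \<in> rspace M"
  shows "ract M (g * h) *\<^sub>v x = ract M g *\<^sub>v (ract M h *\<^sub>v x)"
  using assms by (simp add: ract_mult assoc_mult_mat_vec[OF ract_carrier ract_carrier])

lemma ract_vec_carrier:
  assumes "polynomial_module M" "g \<in> GL2" "x \<in> rspace M"
  shows "ract M g *\<^sub>v x \<in> rspace M"
  by (rule mult_mat_vec_carrier[OF ract_carrier[OF assms(1,2)] assms(3)])

lemma ract_inverse_vec:
  assumes "polynomial_module M" "g \<in> GL2" "h \<in> GL2" "g * h = 1\<^sub>m 2" "x \<in> rspace M"
  shows "ract M g *\<^sub>v (ract M h *\<^sub>v x) = x"
  using assms by (simp flip: ract_mult_vec add: ract_one)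

text \<open>On diagonal matrices only monomials free of the off-diagonal entries survive. The bound
  may be any D above \<open>D0\<close>, so that finitely many matrix entries can share one.\<close>

lemma polynomial_fun_torus:
  fixes f :: "'a::field mat \<Rightarrow> 'a"
  assumes "polynomial_fun f"
  shows "\<exists>D0 c. \<forall>D\<ge>D0. \<forall>s t. s \<noteq> 0 \<longrightarrow> t \<noteq> 0 \<longrightarrow>
    f (mat2 s 0 0 t) = (\<Sum>a\<le>D. \<Sum>b\<le>D. s ^ a * (t ^ b * c a b))"
proof -
  obtain S k where S: "finite S" and f: "\<And>x. x \<in> GL2 \<Longrightarrow> f x = (\<Sum>(i, j, l, m)\<in>S. k (i, j, l, m) *
        x $$ (0,0) ^ i * x $$ (0,1) ^ j * x $$ (1,0) ^ l * x $$ (1,1) ^ m)"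
    using assms unfolding polynomial_fun_def by blast
  define c where "c a b = (if (a, 0, 0, b) \<in> S then k (a, 0, 0, b) else 0)" for a b :: nat
  define D0 where "D0 = Max (insert 0 ((\<lambda>(i, j, l, m). max i m) ` S))"
  have D0: "i \<le> D0 \<and> m \<le> D0" if "(i, j, l, m) \<in> S" for i j l m
  proof -
    have "max i m \<le> D0" unfolding D0_def using S that by (intro Max_ge) force+
    thus ?thesis by simp
  qed
  have "f (mat2 s 0 0 t) = (\<Sum>a\<le>D. \<Sum>b\<le>D. s ^ a * (t ^ b * c a b))"
    if D: "D \<ge> D0" and st: "s \<noteq> 0" "t \<noteq> 0" for D s t
  proof -
    let ?e = "\<lambda>(a, b). (a, 0, 0, b)" and ?T = "{..D} \<times> {..D}"
    have inj: "inj_on ?e A" for A by (auto simp: inj_on_def)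
    have "f (mat2 s 0 0 t) = (\<Sum>(i, j, l, m)\<in>S. k (i, j, l, m) * s ^ i * 0 ^ j * 0 ^ l * t ^ m)"
      using st by (subst f) auto
    also have "\<dots> = (\<Sum>(i, j, l, m)\<in>S \<inter> ?e ` ?T. k (i, j, l, m) * s ^ i * 0 ^ j * 0 ^ l * t ^ m)"
    proof (rule sum.mono_neutral_right[OF S])
      show "\<forall>x\<in>S - S \<inter> ?e ` ?T. (case x of (i, j, l, m) \<Rightarrow> k (i, j, l, m) * s ^ i * 0 ^ j * 0 ^ l * t ^ m) = 0"
      proof
        fix x assume x: "x \<in> S - S \<inter> ?e ` ?T"
        obtain i j l m where xe: "x = (i, j, l, m)" by (cases x)
        have *: "(i, j, l, m) \<in> S" "(i, j, l, m) \<notin> ?e ` ?T" using x xe by auto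
        have "j \<noteq> 0 \<or> l \<noteq> 0"
        proof (rule ccontr)
          assume "\<not> (j \<noteq> 0 \<or> l \<noteq> 0)"
          hence "(i, j, l, m) = ?e (i, m)" "(i, m) \<in> ?T" using D0[OF *(1)] D by auto
          thus False using *(2) by blast
        qed
        thus "(case x of (i, j, l, m) \<Rightarrow> k (i, j, l, m) * s ^ i * 0 ^ j * 0 ^ l * t ^ m) = 0"
          by (auto simp: xe power_0_left)
      qed
    qed auto
    also have "\<dots> = (\<Sum>(i, j, l, m)\<in>?e ` ?T. (if (i, j, l, m) \<in> S then k (i, j, l, m) else 0) * s ^ i * 0 ^ j * 0 ^ l * t ^ m)"
      by (rule sum.mono_neutral_cong_left) (auto split: if_splits)
    also have "\<dots> = (\<Sum>(a, b)\<in>?T. s ^ a * (t ^ b * c a b))"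
      by (subst sum.reindex[OF inj]) (auto simp: c_def intro!: sum.cong)
    finally show ?thesis by (simp add: sum.cartesian_product)
  qed
  thus ?thesis by blast
qed

text \<open>The \<open>P a b\<close> are the projections to the weight spaces. Both eigenvalue
  equations come from multiplicativity: expand the action of a product of two torus elements in two
  ways and compare coefficients.\<close>

lemma torus_expansion:
  fixes M :: "'a::alg_closed_field gl2_rep"
  assumes M: "polynomial_module M"
  shows "\<exists>D P. (\<forall>a b. P a b \<in> carrier_mat (rdim M) (rdim M)) \<and>
    (\<forall>s t i j. s \<noteq> 0 \<longrightarrow> t \<noteq> 0 \<longrightarrow> i < rdim M \<longrightarrow> j < rdim M \<longrightarrow>
      ract M (mat2 s 0 0 t) $$ (i, j) = (\<Sum>a\<le>D. \<Sum>b\<le>D. s ^ a * (t ^ b * P a b $$ (i, j)))) \<and>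
    (\<forall>s t a b. s \<noteq> 0 \<longrightarrow> t \<noteq> 0 \<longrightarrow> a \<le> D \<longrightarrow> b \<le> D \<longrightarrow>
      ract M (mat2 s 0 0 t) * P a b = (s ^ a * t ^ b) \<cdot>\<^sub>m P a b \<and>
      P a b * ract M (mat2 s 0 0 t) = (s ^ a * t ^ b) \<cdot>\<^sub>m P a b)"
proof -
  let ?n = "rdim M"
  have "\<exists>h. \<forall>i j. i < ?n \<longrightarrow> j < ?n \<longrightarrow> (\<forall>D\<ge>fst (h i j). \<forall>s t. s \<noteq> 0 \<longrightarrow> t \<noteq> 0 \<longrightarrow>
    ract M (mat2 s 0 0 t) $$ (i, j) = (\<Sum>a\<le>D. \<Sum>b\<le>D. s ^ a * (t ^ b * snd (h i j) a b)))"
  proof (rule choice, rule allI, rule choice, rule allI)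
    fix i j
    show "\<exists>y. i < ?n \<longrightarrow> j < ?n \<longrightarrow> (\<forall>D\<ge>fst y. \<forall>s t. s \<noteq> 0 \<longrightarrow> t \<noteq> 0 \<longrightarrow>
      ract M (mat2 s 0 0 t) $$ (i, j) = (\<Sum>a\<le>D. \<Sum>b\<le>D. s ^ a * (t ^ b * snd y a b)))"
    proof (cases "i < ?n \<and> j < ?n")
      case True
      then obtain D0 c where "\<forall>D\<ge>D0. \<forall>s t. s \<noteq> 0 \<longrightarrow> t \<noteq> 0 \<longrightarrow>
        ract M (mat2 s 0 0 t) $$ (i, j) = (\<Sum>a\<le>D. \<Sum>b\<le>D. s ^ a * (t ^ b * c a b))"
        using polynomial_fun_torus[OF ract_polynomial[OF M]] by blast
      thus ?thesis by (intro exI[of _ "(D0, c)"]) simp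
    qed auto
  qed
  then obtain h where h: "\<And>i j D s t. i < ?n \<Longrightarrow> j < ?n \<Longrightarrow> D \<ge> fst (h i j) \<Longrightarrow> s \<noteq> 0 \<Longrightarrow> t \<noteq> 0 \<Longrightarrow>
    ract M (mat2 s 0 0 t) $$ (i, j) = (\<Sum>a\<le>D. \<Sum>b\<le>D. s ^ a * (t ^ b * snd (h i j) a b))" by blast
  define D0 c where "D0 i j = fst (h i j)" and "c i j = snd (h i j)" for i j
  have c: "\<And>i j D s t. i < ?n \<Longrightarrow> j < ?n \<Longrightarrow> D \<ge> D0 i j \<Longrightarrow> s \<noteq> 0 \<Longrightarrow> t \<noteq> 0 \<Longrightarrow>
    ract M (mat2 s 0 0 t) $$ (i, j) = (\<Sum>a\<le>D. \<Sum>b\<le>D. s ^ a * (t ^ b * c i j a b))"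
    unfolding D0_def c_def by (rule h)
  \<comment> \<open>Inserting 0 keeps the maximum meaningful when \<open>rdim M = 0\<close>.\<close>
  define D where "D = Max (insert 0 ((\<lambda>(i, j). D0 i j) ` ({..<?n} \<times> {..<?n})))"
  have D: "D0 i j \<le> D" if "i < ?n" "j < ?n" for i j
    unfolding D_def using that by (intro Max_ge) force+
  define P where "P a b = mat ?n ?n (\<lambda>(i, j). c i j a b)" for a b
  have P: "P a b \<in> carrier_mat ?n ?n" for a b by (simp add: P_def)
  have expand: "ract M (mat2 s 0 0 t) $$ (i, j) = (\<Sum>a\<le>D. \<Sum>b\<le>D. s ^ a * (t ^ b * P a b $$ (i, j)))"
    if "s \<noteq> 0" "t \<noteq> 0" "i < ?n" "j < ?n" for s t i j
    using c[OF that(3,4) D[OF that(3,4)] that(1,2)] that by (simp add: P_def)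
  have unique: "c1 a b = c2 a b"
    if eq: "\<And>s t. s \<noteq> 0 \<Longrightarrow> t \<noteq> 0 \<Longrightarrow> (\<Sum>a\<le>D. \<Sum>b\<le>D. s ^ a * (t ^ b * c1 a b)) = (\<Sum>a\<le>D. \<Sum>b\<le>D. s ^ a * (t ^ b * c2 a b))"
      and ab: "a \<le> D" "b \<le> D" for c1 c2 :: "nat \<Rightarrow> nat \<Rightarrow> 'a" and a b
  proof -
    have inner: "(\<Sum>b\<le>D. t ^ b * c1 a b) = (\<Sum>b\<le>D. t ^ b * c2 a b)" if t: "t \<noteq> 0" for t
      by (rule power_sum_coeff_eqI[OF infinite_nonzero _ ab(1)])
         (use t eq[of _ t] in \<open>simp add: sum_distrib_left\<close>)
    show ?thesis by (rule power_sum_coeff_eqI[OF infinite_nonzero _ ab(2)]) (rule inner, simp)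
  qed
  have act: "ract M (mat2 s 0 0 t) * P a b = (s ^ a * t ^ b) \<cdot>\<^sub>m P a b \<and>
      P a b * ract M (mat2 s 0 0 t) = (s ^ a * t ^ b) \<cdot>\<^sub>m P a b"
    if st: "s \<noteq> 0" "t \<noteq> 0" and ab: "a \<le> D" "b \<le> D" for s t a b
  proof -
    let ?R = "\<lambda>s t. ract M (mat2 s 0 0 t)"
    have Rc: "?R s t \<in> carrier_mat ?n ?n" if "s \<noteq> 0" "t \<noteq> 0" for s t
      using that by (intro ract_carrier[OF M]) simp
    have prod: "(?R s t * ?R s' t') $$ (i, j) = (\<Sum>a\<le>D. \<Sum>b\<le>D. s' ^ a * (t' ^ b * ((s ^ a * t ^ b) * P a b $$ (i, j))))"
      "(?R s' t' * ?R s t) $$ (i, j) = (\<Sum>a\<le>D. \<Sum>b\<le>D. s' ^ a * (t' ^ b * ((s ^ a * t ^ b) * P a b $$ (i, j))))"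
      if "s' \<noteq> 0" "t' \<noteq> 0" "i < ?n" "j < ?n" for i j s' t'
    proof -
      have "?R s t * ?R s' t' = ?R (s * s') (t * t')" "?R s' t' * ?R s t = ?R (s * s') (t * t')"
        using that st by (simp_all add: ract_mult[OF M, symmetric] mat2_mult mult.commute)
      thus "(?R s t * ?R s' t') $$ (i, j) = (\<Sum>a\<le>D. \<Sum>b\<le>D. s' ^ a * (t' ^ b * ((s ^ a * t ^ b) * P a b $$ (i, j))))"
        "(?R s' t' * ?R s t) $$ (i, j) = (\<Sum>a\<le>D. \<Sum>b\<le>D. s' ^ a * (t' ^ b * ((s ^ a * t ^ b) * P a b $$ (i, j))))"
        using that st by (simp_all only: expand mult_eq_0_iff) (simp_all add: expand power_mult_distrib mult_ac)
    qed
    have left: "(?R s t * ?R s' t') $$ (i, j) = (\<Sum>a\<le>D. \<Sum>b\<le>D. s' ^ a * (t' ^ b * (?R s t * P a b) $$ (i, j)))"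
      if "s' \<noteq> 0" "t' \<noteq> 0" "i < ?n" "j < ?n" for i j s' t'
    proof -
      have "(?R s t * ?R s' t') $$ (i, j) = (\<Sum>l<?n. \<Sum>a\<le>D. \<Sum>b\<le>D. s' ^ a * (t' ^ b * (?R s t $$ (i, l) * P a b $$ (l, j))))"
        using that by (subst mult_index_sum[OF Rc[OF st] Rc[OF that(1,2)]])
          (auto simp: expand[of s' t'] sum_distrib_left mult_ac intro!: sum.cong)
      also have "\<dots> = (\<Sum>a\<le>D. \<Sum>b\<le>D. \<Sum>l<?n. s' ^ a * (t' ^ b * (?R s t $$ (i, l) * P a b $$ (l, j))))"
        by (rule trans[OF sum.swap], rule sum.cong[OF refl], rule sum.swap)
      also have "\<dots> = (\<Sum>a\<le>D. \<Sum>b\<le>D. s' ^ a * (t' ^ b * (?R s t * P a b) $$ (i, j)))"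
        using that by (subst mult_index_sum[OF Rc[OF st] P]) (auto simp: sum_distrib_left)
      finally show ?thesis .
    qed
    have right: "(?R s' t' * ?R s t) $$ (i, j) = (\<Sum>a\<le>D. \<Sum>b\<le>D. s' ^ a * (t' ^ b * (P a b * ?R s t) $$ (i, j)))"
      if "s' \<noteq> 0" "t' \<noteq> 0" "i < ?n" "j < ?n" for i j s' t'
    proof -
      have "(?R s' t' * ?R s t) $$ (i, j) = (\<Sum>l<?n. \<Sum>a\<le>D. \<Sum>b\<le>D. s' ^ a * (t' ^ b * (P a b $$ (i, l) * ?R s t $$ (l, j))))"
        using that by (subst mult_index_sum[OF Rc[OF that(1,2)] Rc[OF st]])
          (auto simp: expand[of s' t'] sum_distrib_left sum_distrib_right mult_ac intro!: sum.cong)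
      also have "\<dots> = (\<Sum>a\<le>D. \<Sum>b\<le>D. \<Sum>l<?n. s' ^ a * (t' ^ b * (P a b $$ (i, l) * ?R s t $$ (l, j))))"
        by (rule trans[OF sum.swap], rule sum.cong[OF refl], rule sum.swap)
      also have "\<dots> = (\<Sum>a\<le>D. \<Sum>b\<le>D. s' ^ a * (t' ^ b * (P a b * ?R s t) $$ (i, j)))"
        using that by (subst mult_index_sum[OF P Rc[OF st]]) (auto simp: sum_distrib_left)
      finally show ?thesis .
    qed
    have "(?R s t * P a b) $$ (i, j) = (s ^ a * t ^ b) * P a b $$ (i, j)"
      "(P a b * ?R s t) $$ (i, j) = (s ^ a * t ^ b) * P a b $$ (i, j)" if ij: "i < ?n" "j < ?n" for i j
      using unique[of "\<lambda>a b. (?R s t * P a b) $$ (i, j)" "\<lambda>a b. (s ^ a * t ^ b) * P a b $$ (i, j)", OF _ ab]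
        unique[of "\<lambda>a b. (P a b * ?R s t) $$ (i, j)" "\<lambda>a b. (s ^ a * t ^ b) * P a b $$ (i, j)", OF _ ab]
        left[OF _ _ ij] right[OF _ _ ij] prod[OF _ _ ij] by presburger+
    thus ?thesis using carrier_matD[OF P] carrier_matD[OF Rc[OF st]]
      by (auto intro!: eq_matI simp del: index_mult_mat(1))
  qed
  show ?thesis
  proof (rule exI[of _ D], rule exI[of _ P], intro conjI allI impI)
    fix s t :: 'a and a b :: nat assume *: "s \<noteq> 0" "t \<noteq> 0" "a \<le> D" "b \<le> D"
    show "ract M (mat2 s 0 0 t) * P a b = (s ^ a * t ^ b) \<cdot>\<^sub>m P a b"
      "P a b * ract M (mat2 s 0 0 t) = (s ^ a * t ^ b) \<cdot>\<^sub>m P a b"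
      using act[OF *] by simp_all
  qed (rule P, erule (3) expand)
qed

text \<open>\<open>Q a\<close> is the component of weight (a, l1 + l2 - a), and the range of the sum
  records that all weights lie between (l2, l1) and (l1, l2). The later degree bounds use the
  highest weight in this form, which passes to the contravariant dual by transposing
  \<open>Q\<close>.\<close>

definition torus_split :: "'a::field gl2_rep \<Rightarrow> nat \<Rightarrow> nat \<Rightarrow> (nat \<Rightarrow> 'a mat) \<Rightarrow> bool" where
  "torus_split M l1 l2 Q \<longleftrightarrow> l2 \<le> l1 \<and> (\<forall>a. Q a \<in> carrier_mat (rdim M) (rdim M)) \<and>
    (\<forall>s t. s \<noteq> 0 \<longrightarrow> t \<noteq> 0 \<longrightarrow>
      ract M (mat2 s 0 0 t) = mat_sum (rdim M) (rdim M) (\<lambda>a. (s ^ a * t ^ (l1 + l2 - a)) \<cdot>\<^sub>m Q a) {l2..l1} \<and>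
      (\<forall>a\<in>{l2..l1}. ract M (mat2 s 0 0 t) * Q a = (s ^ a * t ^ (l1 + l2 - a)) \<cdot>\<^sub>m Q a))"

text \<open>A nonzero column of a projection is a weight vector, so a is at most l1. The Weyl
  element exchanges the two entries of a weight, which bounds the second entry by l1 and hence a
  below by l2.\<close>

lemma torus_split_exists:
  fixes M :: "'a::alg_closed_field gl2_rep"
  assumes M: "polynomial_module M" and hw: "highest_weight M (l1, l2)" and l: "l2 \<le> l1"
  obtains Q where "torus_split M l1 l2 Q" "torus_split (contravariant_dual M) l1 l2 (\<lambda>a. transpose_mat (Q a))"
proof -
  let ?n = "rdim M"
  obtain D P where PD: "\<forall>a b. P a b \<in> carrier_mat ?n ?n"
    "\<forall>s t i j. s \<noteq> 0 \<longrightarrow> t \<noteq> 0 \<longrightarrow> i < ?n \<longrightarrow> j < ?n \<longrightarrow>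
      ract M (mat2 s 0 0 t) $$ (i, j) = (\<Sum>a\<le>D. \<Sum>b\<le>D. s ^ a * (t ^ b * P a b $$ (i, j)))"
    "\<forall>s t a b. s \<noteq> 0 \<longrightarrow> t \<noteq> 0 \<longrightarrow> a \<le> D \<longrightarrow> b \<le> D \<longrightarrow>
      ract M (mat2 s 0 0 t) * P a b = (s ^ a * t ^ b) \<cdot>\<^sub>m P a b \<and>
      P a b * ract M (mat2 s 0 0 t) = (s ^ a * t ^ b) \<cdot>\<^sub>m P a b"
    using torus_expansion[OF M] by (elim exE conjE) (rule that)
  note P = PD(1)[rule_format] and expand = PD(2)[rule_format] and act = PD(3)[rule_format]
  have wt: "a + b = l1 + l2 \<and> a \<in> {l2..l1}"
    if ab: "a \<le> D" "b \<le> D" and ij: "i < ?n" "j < ?n" and nz: "P a b $$ (i, j) \<noteq> 0" for a b i j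
  proof -
    define x where "x = col (P a b) j"
    have x: "x \<in> rspace M" using P ij by (simp add: x_def)
    have "x $ i \<noteq> 0" using nz ij carrier_matD[OF P] by (simp add: x_def)
    hence x0: "x \<noteq> 0\<^sub>v ?n" using ij by auto
    have xw: "ract M (mat2 s 0 0 t) *\<^sub>v x = (s ^ a * t ^ b) \<cdot>\<^sub>v x" if st: "s \<noteq> 0" "t \<noteq> 0" for s t
    proof -
      have "mat2 s 0 0 t \<in> GL2" using st by simp
      hence "ract M (mat2 s 0 0 t) *\<^sub>v x = col (ract M (mat2 s 0 0 t) * P a b) j"
        unfolding x_def by (rule col_mult2[OF ract_carrier[OF M] P ij(2), symmetric])
      also have "\<dots> = (s ^ a * t ^ b) \<cdot>\<^sub>v x"
        using act[OF st ab] carrier_matD[OF P] ij by (simp add: x_def)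
      finally show ?thesis .
    qed
    have "is_weight M (a, b)" unfolding is_weight_def
      using x x0 xw by (intro bexI[of _ x]) (auto simp: weight_space_iff)
    hence "dominance_le (a, b) (l1, l2)" using hw unfolding highest_weight_def by blast
    hence 1: "a + b = l1 + l2" "a \<le> l1" by (simp_all add: dominance_le_def)
    define y where "y = ract M weyl *\<^sub>v x"
    have yc: "y \<in> rspace M" unfolding y_def by (rule ract_vec_carrier[OF M _ x]) simp
    have ww: "ract M weyl *\<^sub>v y = x" unfolding y_def
      by (rule ract_inverse_vec[OF M]) (simp_all add: mat2_mult mat2_one x)
    have "ract M weyl *\<^sub>v 0\<^sub>v ?n = 0\<^sub>v ?n"
      by (rule mult_mat_zero_vec[OF ract_carrier[OF M]]) simp
    hence y0: "y \<noteq> 0\<^sub>v ?n" using ww x0 by auto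
    have yw: "ract M (mat2 s 0 0 t) *\<^sub>v y = (s ^ b * t ^ a) \<cdot>\<^sub>v y" if st: "s \<noteq> 0" "t \<noteq> 0" for s t
    proof -
      have "ract M (mat2 s 0 0 t) *\<^sub>v y = ract M (mat2 s 0 0 t * weyl) *\<^sub>v x"
        using st x by (simp add: y_def ract_mult_vec[OF M])
      also have "mat2 s 0 0 t * weyl = weyl * mat2 t 0 0 s" by (simp add: mat2_mult)
      also have "ract M (weyl * mat2 t 0 0 s) *\<^sub>v x = ract M weyl *\<^sub>v ((t ^ a * s ^ b) \<cdot>\<^sub>v x)"
        using st x by (subst ract_mult_vec[OF M]) (simp_all add: xw)
      also have "\<dots> = (s ^ b * t ^ a) \<cdot>\<^sub>v y"
        unfolding y_def by (subst mult_mat_vec[OF ract_carrier[OF M] x]) (simp_all add: mult.commute)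
      finally show ?thesis .
    qed
    have "is_weight M (b, a)" unfolding is_weight_def
      using yc y0 yw by (intro bexI[of _ y]) (auto simp: weight_space_iff)
    hence "dominance_le (b, a) (l1, l2)" using hw unfolding highest_weight_def by blast
    hence "b \<le> l1" by (simp add: dominance_le_def)
    thus ?thesis using 1 by auto
  qed
  \<comment> \<open>Outside the range of the expansion there is no such weight, so 0 is the right
    value.\<close>
  define Q where "Q a = (if a \<le> D \<and> l1 + l2 - a \<le> D then P a (l1 + l2 - a) else 0\<^sub>m ?n ?n)" for a
  have Q: "Q a \<in> carrier_mat ?n ?n" for a using P by (simp add: Q_def)
  have split: "ract M (mat2 s 0 0 t) = mat_sum ?n ?n (\<lambda>a. (s ^ a * t ^ (l1 + l2 - a)) \<cdot>\<^sub>m Q a) {l2..l1}"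
    if st: "s \<noteq> 0" "t \<noteq> 0" for s t
  proof (rule eq_matI)
    fix i j assume "i < dim_row (mat_sum ?n ?n (\<lambda>a. (s ^ a * t ^ (l1 + l2 - a)) \<cdot>\<^sub>m Q a) {l2..l1})"
      "j < dim_col (mat_sum ?n ?n (\<lambda>a. (s ^ a * t ^ (l1 + l2 - a)) \<cdot>\<^sub>m Q a) {l2..l1})"
    hence ij: "i < ?n" "j < ?n" by auto
    let ?h = "\<lambda>(a, b). s ^ a * (t ^ b * P a b $$ (i, j))"
    let ?e = "\<lambda>a. (a, l1 + l2 - a)"
    let ?T = "{a \<in> {l2..l1}. a \<le> D \<and> l1 + l2 - a \<le> D}"
    have "ract M (mat2 s 0 0 t) $$ (i, j) = (\<Sum>x\<in>{..D} \<times> {..D}. ?h x)"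
      by (simp add: expand[OF st ij] sum.cartesian_product)
    also have "\<dots> = (\<Sum>x\<in>?e ` ?T. ?h x)"
    proof (rule sum.mono_neutral_right)
      show "\<forall>x\<in>{..D} \<times> {..D} - ?e ` ?T. ?h x = 0"
      proof
        fix x assume x: "x \<in> {..D} \<times> {..D} - ?e ` ?T"
        obtain a b where xe: "x = (a, b)" by (cases x)
        have ab: "a \<le> D" "b \<le> D" "(a, b) \<notin> ?e ` ?T" using x xe by auto
        have "P a b $$ (i, j) = 0"
        proof (rule ccontr)
          assume nz: "P a b $$ (i, j) \<noteq> 0"
          have "a + b = l1 + l2" "a \<in> {l2..l1}" using wt[OF ab(1,2) ij nz] by auto
          hence "(a, b) = ?e a" "a \<in> ?T" using ab by auto
          thus False using ab(3) by blast
        qed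
        thus "?h x = 0" by (simp add: xe)
      qed
    qed auto
    also have "\<dots> = (\<Sum>a\<in>?T. s ^ a * (t ^ (l1 + l2 - a) * P a (l1 + l2 - a) $$ (i, j)))"
      by (subst sum.reindex) (auto simp: inj_on_def)
    also have "\<dots> = (\<Sum>a\<in>{l2..l1}. (s ^ a * t ^ (l1 + l2 - a)) * Q a $$ (i, j))"
      using ij by (intro sum.mono_neutral_cong_left) (auto simp: Q_def mult.assoc)
    finally show "ract M (mat2 s 0 0 t) $$ (i, j) =
      mat_sum ?n ?n (\<lambda>a. (s ^ a * t ^ (l1 + l2 - a)) \<cdot>\<^sub>m Q a) {l2..l1} $$ (i, j)"
      using ij carrier_matD[OF Q] by simp
  qed (use st in \<open>simp_all add: ract_dim[OF M]\<close>)
  have Qact: "ract M (mat2 s 0 0 t) * Q a = (s ^ a * t ^ (l1 + l2 - a)) \<cdot>\<^sub>m Q a"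
    "Q a * ract M (mat2 s 0 0 t) = (s ^ a * t ^ (l1 + l2 - a)) \<cdot>\<^sub>m Q a" if st: "s \<noteq> 0" "t \<noteq> 0" for s t a
    using act[OF st, of a "l1 + l2 - a"] st ract_carrier[OF M, of "mat2 s 0 0 t"] by (auto simp: Q_def)
  show ?thesis
  proof
    show "torus_split M l1 l2 Q" unfolding torus_split_def using l Q split Qact by auto
    show "torus_split (contravariant_dual M) l1 l2 (\<lambda>a. transpose_mat (Q a))"
      unfolding torus_split_def
    proof (intro conjI allI impI ballI)
      fix s t :: 'a assume st: "s \<noteq> 0" "t \<noteq> 0"
      show "ract (contravariant_dual M) (mat2 s 0 0 t) = mat_sum (rdim (contravariant_dual M)) (rdim (contravariant_dual M))
        (\<lambda>a. (s ^ a * t ^ (l1 + l2 - a)) \<cdot>\<^sub>m transpose_mat (Q a)) {l2..l1}"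
        using Q by (simp add: split[OF st] transpose_mat_sum transpose_smult)
      fix a
      have "transpose_mat (Q a * ract M (mat2 s 0 0 t)) = transpose_mat (ract M (mat2 s 0 0 t)) * transpose_mat (Q a)"
        using st by (intro transpose_mult[OF Q ract_carrier[OF M]]) simp
      thus "ract (contravariant_dual M) (mat2 s 0 0 t) * transpose_mat (Q a) =
        (s ^ a * t ^ (l1 + l2 - a)) \<cdot>\<^sub>m transpose_mat (Q a)"
        by (simp add: Qact[OF st] transpose_smult)
    qed (use l Q in auto)
  qed
qed

text \<open>L(1/z) is the conjugate of L(1) by diag(1, z), so the weights control its growth: each
  term carries z to the difference of two first weight entries, which is at least -(l1 - l2). This
  is the bound that makes the norm vanish on modules whose highest weight has a small difference of
  entries.\<close>

lemma lower_unip_degree: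
  fixes M :: "'a::alg_closed_field gl2_rep"
  assumes M: "polynomial_module M" and Q: "torus_split M l1 l2 Q" and ij: "i < rdim M" "j < rdim M"
  shows "\<exists>c. \<forall>z. ract M (lower_unip z) $$ (i, j) = (\<Sum>k\<le>l1 - l2. z ^ k * c k)"
proof -
  let ?n = "rdim M" and ?N = "l1 + l2" and ?L = "ract M (lower_unip 1)"
  have l: "l2 \<le> l1" and Qc: "Q a \<in> carrier_mat ?n ?n" for a using Q by (auto simp: torus_split_def)
  have split: "ract M (mat2 s 0 0 t) = mat_sum ?n ?n (\<lambda>a. (s ^ a * t ^ (?N - a)) \<cdot>\<^sub>m Q a) {l2..l1}"
    if "s \<noteq> 0" "t \<noteq> 0" for s t using Q that by (auto simp: torus_split_def)
  have Lc: "?L \<in> carrier_mat ?n ?n" by (rule ract_carrier[OF M]) simp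
  note [simp] = carrier_matD[OF Qc] carrier_matD[OF Lc]
  define X where "X a a' = (Q a * (?L * Q a')) $$ (i, j)" for a a'
  define g where "g z = (\<Sum>a\<in>{l2..l1}. \<Sum>a'\<in>{l2..l1}. z ^ (l1 - l2 + a - a') * X a a')" for z
  have f: "poly_fun (\<lambda>z. ract M (lower_unip z) $$ (i, j))"
    using ract_poly_mat[OF M, of "\<lambda>z. 1" "\<lambda>z. 0" "\<lambda>z. z" "\<lambda>z. 1"] ij
    by (auto simp: poly_mat_def intro: poly_fun_intros)
  show ?thesis
  proof (rule poly_fun_bounded_degree[OF f])
    show "poly_fun g" unfolding g_def by (intro poly_fun_intros)
    fix z :: 'a assume z: "z \<noteq> 0"
    have "lower_unip (inverse z) = mat2 1 0 0 (inverse z) * (lower_unip 1 * mat2 1 0 0 z)"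
      using z by (simp add: mat2_mult)
    hence "ract M (lower_unip (inverse z)) =
      ract M (mat2 1 0 0 (inverse z)) * (?L * ract M (mat2 1 0 0 z))"
      using z by (simp add: ract_mult[OF M] GL2_mult)
    also have "\<dots> = mat_sum ?n ?n (\<lambda>a. (inverse z ^ (?N - a)) \<cdot>\<^sub>m (Q a * mat_sum ?n ?n (\<lambda>a'. (z ^ (?N - a')) \<cdot>\<^sub>m (?L * Q a')) {l2..l1})) {l2..l1}"
      using z Qc
      by (simp add: split mult_mat_sum[OF Lc] mat_sum_mult[OF mat_sum_carrier] smult_mult_mat_dims)
    finally have "ract M (lower_unip (inverse z)) $$ (i, j) =
      (\<Sum>a\<in>{l2..l1}. inverse z ^ (?N - a) * (Q a * mat_sum ?n ?n (\<lambda>a'. (z ^ (?N - a')) \<cdot>\<^sub>m (?L * Q a')) {l2..l1}) $$ (i, j))"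
      using ij by simp
    also have "\<dots> = (\<Sum>a\<in>{l2..l1}. inverse z ^ (?N - a) * (\<Sum>a'\<in>{l2..l1}. z ^ (?N - a') * X a a'))"
    proof (intro sum.cong refl arg_cong2[of _ _ _ _ "(*)"])
      fix a
      have "Q a * mat_sum ?n ?n (\<lambda>a'. (z ^ (?N - a')) \<cdot>\<^sub>m (?L * Q a')) {l2..l1} =
        mat_sum ?n ?n (\<lambda>a'. (z ^ (?N - a')) \<cdot>\<^sub>m (Q a * (?L * Q a'))) {l2..l1}"
        using Lc Qc by (subst mult_mat_sum[OF Qc]) (auto simp: smult_mult_mat_dims intro!: mult_carrier_mat)
      thus "(Q a * mat_sum ?n ?n (\<lambda>a'. (z ^ (?N - a')) \<cdot>\<^sub>m (?L * Q a')) {l2..l1}) $$ (i, j) =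
        (\<Sum>a'\<in>{l2..l1}. z ^ (?N - a') * X a a')"
        using ij by (simp add: X_def)
    qed
    finally have "z ^ (l1 - l2) * ract M (lower_unip (inverse z)) $$ (i, j) =
      (\<Sum>a\<in>{l2..l1}. \<Sum>a'\<in>{l2..l1}. z ^ (l1 - l2) * (inverse z ^ (?N - a) * z ^ (?N - a')) * X a a')"
      by (simp add: sum_distrib_left mult.assoc)
    also have "\<dots> = g z" unfolding g_def
    proof (intro sum.cong refl)
      fix a a' assume "a \<in> {l2..l1}" "a' \<in> {l2..l1}"
      hence "(?N - a) + (l1 - l2 + a - a') = (l1 - l2) + (?N - a')" using l by auto
      hence "z ^ (?N - a) * z ^ (l1 - l2 + a - a') = z ^ (l1 - l2) * z ^ (?N - a')"
        by (metis power_add)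
      hence "z ^ (l1 - l2 + a - a') = z ^ (l1 - l2) * (inverse z ^ (?N - a) * z ^ (?N - a'))"
        using z by (simp add: field_simps power_inverse)
      thus "z ^ (l1 - l2) * (inverse z ^ (?N - a) * z ^ (?N - a')) * X a a' = z ^ (l1 - l2 + a - a') * X a a'"
        by simp
    qed
    finally show "g z = z ^ (l1 - l2) * ract M (lower_unip (inverse z)) $$ (i, j)" ..
  qed
qed

text \<open>The same scaling, now by diag(z, 1) and on a vector of known weight: the degree is at
  most the number of steps from a up to l1.\<close>

lemma upper_unip_degree:
  fixes M :: "'a::alg_closed_field gl2_rep"
  assumes M: "polynomial_module M" and Q: "torus_split M l1 l2 Q" and i: "i < rdim M"
    and x: "x \<in> weight_space M (a, b)" and a: "a \<le> l1"
  shows "\<exists>c. \<forall>z. (ract M (upper_unip z) *\<^sub>v x) $ i = (\<Sum>k\<le>l1 - a. z ^ k * c k)"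
proof -
  let ?n = "rdim M" and ?N = "l1 + l2"
  define u where "u = ract M (upper_unip 1) *\<^sub>v x"
  have xc: "x \<in> rspace M" using x by (simp add: weight_space_iff)
  have uc: "u \<in> rspace M" unfolding u_def by (rule ract_vec_carrier[OF M _ xc]) simp
  have Qc: "Q a \<in> carrier_mat ?n ?n" for a using Q by (auto simp: torus_split_def)
  have split: "ract M (mat2 s 0 0 t) = mat_sum ?n ?n (\<lambda>a. (s ^ a * t ^ (?N - a)) \<cdot>\<^sub>m Q a) {l2..l1}"
    if "s \<noteq> 0" "t \<noteq> 0" for s t using Q that by (auto simp: torus_split_def)
  define g where "g z = (\<Sum>a'\<in>{l2..l1}. z ^ (l1 - a') * (Q a' *\<^sub>v u) $ i)" for z
  have Uc: "ract M (upper_unip z) \<in> carrier_mat ?n ?n" for z by (rule ract_carrier[OF M]) simp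
  have "(\<lambda>z. (ract M (upper_unip z) *\<^sub>v x) $ i) = (\<lambda>z. \<Sum>l<?n. ract M (upper_unip z) $$ (i, l) * x $ l)"
    using i carrier_matD[OF Uc] xc by (auto simp: scalar_prod_def atLeast0LessThan)
  moreover have "poly_fun \<dots>"
    using ract_poly_mat[OF M, of "\<lambda>z. 1" "\<lambda>z. z" "\<lambda>z. 0" "\<lambda>z. 1"] i
    by (intro poly_fun_intros) (auto simp: poly_mat_def intro: poly_fun_intros)
  ultimately have f: "poly_fun (\<lambda>z. (ract M (upper_unip z) *\<^sub>v x) $ i)" by simp
  show ?thesis
  proof (rule poly_fun_bounded_degree[OF f])
    show "poly_fun g" unfolding g_def by (intro poly_fun_intros)
    fix z :: 'a assume z: "z \<noteq> 0"
    have "upper_unip (inverse z) = mat2 (inverse z) 0 0 1 * (upper_unip 1 * mat2 z 0 0 1)"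
      using z by (simp add: mat2_mult)
    hence "ract M (upper_unip (inverse z)) *\<^sub>v x =
      ract M (mat2 (inverse z) 0 0 1) *\<^sub>v (ract M (upper_unip 1) *\<^sub>v (ract M (mat2 z 0 0 1) *\<^sub>v x))"
      using z xc ract_vec_carrier[OF M _ xc] by (simp add: ract_mult_vec[OF M] GL2_mult del: mat2_mult)
    also have "ract M (mat2 z 0 0 1) *\<^sub>v x = z ^ a \<cdot>\<^sub>v x" using x z by (simp add: weight_space_iff)
    also have "ract M (upper_unip 1) *\<^sub>v (z ^ a \<cdot>\<^sub>v x) = z ^ a \<cdot>\<^sub>v u"
      unfolding u_def by (rule mult_mat_vec[OF Uc xc])
    also have "ract M (mat2 (inverse z) 0 0 1) *\<^sub>v (z ^ a \<cdot>\<^sub>v u) = z ^ a \<cdot>\<^sub>v (ract M (mat2 (inverse z) 0 0 1) *\<^sub>v u)"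
      using z by (intro mult_mat_vec[OF ract_carrier[OF M] uc]) simp
    finally have "(ract M (upper_unip (inverse z)) *\<^sub>v x) $ i = z ^ a * (ract M (mat2 (inverse z) 0 0 1) *\<^sub>v u) $ i"
      using i z by (simp add: ract_dim[OF M])
    also have "(ract M (mat2 (inverse z) 0 0 1) *\<^sub>v u) $ i =
      (\<Sum>l<?n. (\<Sum>a'\<in>{l2..l1}. inverse z ^ a' * Q a' $$ (i, l)) * u $ l)"
      using i z uc carrier_matD[OF Qc] by (auto simp: split scalar_prod_def atLeast0LessThan intro!: sum.cong)
    also have "\<dots> = (\<Sum>a'\<in>{l2..l1}. inverse z ^ a' * (\<Sum>l<?n. Q a' $$ (i, l) * u $ l))"
      by (simp add: sum_distrib_right sum_distrib_left mult.assoc) (rule sum.swap)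
    also have "\<dots> = (\<Sum>a'\<in>{l2..l1}. inverse z ^ a' * (Q a' *\<^sub>v u) $ i)"
      using i uc carrier_matD[OF Qc] by (auto simp: scalar_prod_def atLeast0LessThan intro!: sum.cong)
    finally have "z ^ (l1 - a) * (ract M (upper_unip (inverse z)) *\<^sub>v x) $ i =
      (\<Sum>a'\<in>{l2..l1}. (z ^ (l1 - a) * z ^ a * inverse z ^ a') * (Q a' *\<^sub>v u) $ i)"
      by (simp add: sum_distrib_left mult.assoc)
    also have "\<dots> = g z" unfolding g_def
    proof (intro sum.cong refl)
      fix a' assume "a' \<in> {l2..l1}"
      hence "z ^ (l1 - a) * z ^ a = z ^ (l1 - a') * z ^ a'" using a by (simp flip: power_add)
      thus "(z ^ (l1 - a) * z ^ a * inverse z ^ a') * (Q a' *\<^sub>v u) $ i = z ^ (l1 - a') * (Q a' *\<^sub>v u) $ i"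
        using z by (simp add: power_inverse)
    qed
    finally show "g z = z ^ (l1 - a) * (ract M (upper_unip (inverse z)) *\<^sub>v x) $ i" ..
  qed
qed

lemma upper_unip_zero:
  assumes "polynomial_module M" "x \<in> rspace M"
  shows "ract M (upper_unip 0) *\<^sub>v x = x"
  using assms by (simp add: mat2_one ract_one)

lemma highest_weight_vector_fixed:
  fixes M :: "'a::alg_closed_field gl2_rep"
  assumes M: "polynomial_module M" and Q: "torus_split M l1 l2 Q" and x: "x \<in> weight_space M (l1, b)"
  shows "ract M (upper_unip z) *\<^sub>v x = x"
proof (rule eq_vecI)
  have xc: "x \<in> rspace M" using x by (simp add: weight_space_iff)
  fix i assume "i < dim_vec x"
  hence i: "i < rdim M" using xc by simp
  obtain c where c: "\<And>z. (ract M (upper_unip z) *\<^sub>v x) $ i = (\<Sum>k\<le>l1 - l1. z ^ k * c k)"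
    using upper_unip_degree[OF M Q i x] by blast
  have "(ract M (upper_unip z) *\<^sub>v x) $ i = (ract M (upper_unip 0) *\<^sub>v x) $ i" unfolding c by simp
  thus "(ract M (upper_unip z) *\<^sub>v x) $ i = x $ i" using upper_unip_zero[OF M xc] by simp
next
  show "dim_vec (ract M (upper_unip z) *\<^sub>v x) = dim_vec x"
    using x by (auto simp: weight_space_iff ract_dim[OF M])
qed

text \<open>One step below the top the action of U(z) is linear in z. Its slope \<open>v\<close> is
  the image of x under the raising operator; moving the torus past U(1) shows that it has the
  highest weight.\<close>

lemma subhighest_weight_vector:
  fixes M :: "'a::alg_closed_field gl2_rep"
  assumes M: "polynomial_module M" and Q: "torus_split M (Suc a) l2 Q" and x: "x \<in> weight_space M (a, Suc b)"
  defines "v \<equiv> ract M (upper_unip 1) *\<^sub>v x - x"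
  shows "v \<in> weight_space M (Suc a, b)" "ract M (upper_unip z) *\<^sub>v x = x + z \<cdot>\<^sub>v v"
proof -
  have xc: "x \<in> rspace M" using x by (simp add: weight_space_iff)
  have Uc: "ract M (upper_unip z) \<in> carrier_mat (rdim M) (rdim M)" for z by (rule ract_carrier[OF M]) simp
  have Uxc: "ract M (upper_unip z) *\<^sub>v x \<in> rspace M" for z by (rule mult_mat_vec_carrier[OF Uc xc])
  have vc: "v \<in> rspace M" unfolding v_def using xc Uxc by simp
  show unip: "ract M (upper_unip z) *\<^sub>v x = x + z \<cdot>\<^sub>v v" for z
  proof (rule eq_vecI)
    fix i assume "i < dim_vec (x + z \<cdot>\<^sub>v v)"
    hence i: "i < rdim M" using vc by simp
    obtain c where c: "\<And>z. (ract M (upper_unip z) *\<^sub>v x) $ i = (\<Sum>k\<le>Suc a - a. z ^ k * c k)"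
      using upper_unip_degree[OF M Q i x] by auto
    have c': "(ract M (upper_unip z) *\<^sub>v x) $ i = c 0 + z * c 1" for z unfolding c by (simp add: Suc_diff_le)
    have "c 0 = x $ i" using c'[of 0] upper_unip_zero[OF M xc] by simp
    moreover have "v $ i = c 1" using c'[of 1] \<open>c 0 = x $ i\<close> i xc unfolding v_def by simp
    ultimately show "(ract M (upper_unip z) *\<^sub>v x) $ i = (x + z \<cdot>\<^sub>v v) $ i"
      using i xc vc by (simp add: c')
  qed (use carrier_matD[OF Uc] vc in simp)
  have "ract M (mat2 s 0 0 t) *\<^sub>v v = (s ^ Suc a * t ^ b) \<cdot>\<^sub>v v" if st: "s \<noteq> 0" "t \<noteq> 0" for s t
  proof -
    let ?d = "mat2 s 0 0 t" and ?w = "s ^ a * t ^ Suc b"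
    have dc: "ract M ?d \<in> carrier_mat (rdim M) (rdim M)" using st by (intro ract_carrier[OF M]) simp
    have dx: "ract M ?d *\<^sub>v x = ?w \<cdot>\<^sub>v x" using x st by (simp add: weight_space_iff)
    have "ract M ?d *\<^sub>v v = ract M ?d *\<^sub>v (ract M (upper_unip 1) *\<^sub>v x) - ract M ?d *\<^sub>v x"
      unfolding v_def by (rule mult_minus_distrib_mat_vec[OF dc Uxc xc])
    also have "ract M ?d *\<^sub>v (ract M (upper_unip 1) *\<^sub>v x) = ract M (?d * upper_unip 1) *\<^sub>v x"
      using st xc by (simp add: ract_mult_vec[OF M])
    also have "?d * upper_unip 1 = upper_unip (s / t) * ?d" using st by (simp add: mat2_mult)
    also have "ract M \<dots> *\<^sub>v x = ract M (upper_unip (s / t)) *\<^sub>v (?w \<cdot>\<^sub>v x)"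
      using st xc by (subst ract_mult_vec[OF M]) (simp_all add: dx)
    also have "\<dots> = ?w \<cdot>\<^sub>v (x + (s / t) \<cdot>\<^sub>v v)" by (simp add: mult_mat_vec[OF Uc xc] unip)
    finally have "ract M ?d *\<^sub>v v = ?w \<cdot>\<^sub>v (x + (s / t) \<cdot>\<^sub>v v) - ?w \<cdot>\<^sub>v x" by (simp add: dx)
    also have "\<dots> = (s ^ Suc a * t ^ b) \<cdot>\<^sub>v v"
      using xc vc st by (intro eq_vecI) (auto simp: field_simps)
    finally show ?thesis .
  qed
  thus "v \<in> weight_space M (Suc a, b)" using vc by (simp add: weight_space_iff)
qed

text \<open>The Weyl element carries a highest weight vector, which is fixed by the upper
  unipotents, to a vector fixed by the lower ones.\<close>

lemma lower_unip_fixed_vector: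
  fixes M :: "'a::alg_closed_field gl2_rep"
  assumes M: "polynomial_module M" and hw: "highest_weight M (l1, l2)" and Q: "torus_split M l1 l2 Q"
  obtains x where "x \<in> rspace M" "x \<noteq> 0\<^sub>v (rdim M)" "\<And>z. ract M (lower_unip z) *\<^sub>v x = x"
proof -
  obtain v where v: "v \<in> weight_space M (l1, l2)" "v \<noteq> 0\<^sub>v (rdim M)"
    using hw unfolding highest_weight_def is_weight_def by blast
  have vc: "v \<in> rspace M" using v(1) by (simp add: weight_space_iff)
  define x where "x = ract M weyl *\<^sub>v v"
  have xc: "x \<in> rspace M" unfolding x_def by (rule ract_vec_carrier[OF M _ vc]) simp
  have wx: "ract M weyl *\<^sub>v x = v" unfolding x_def
    by (rule ract_inverse_vec[OF M]) (simp_all add: mat2_mult mat2_one vc)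
  have "ract M weyl *\<^sub>v 0\<^sub>v (rdim M) = 0\<^sub>v (rdim M)"
    by (rule mult_mat_zero_vec[OF ract_carrier[OF M]]) simp
  hence x0: "x \<noteq> 0\<^sub>v (rdim M)" using wx v(2) by auto
  have "ract M (lower_unip z) *\<^sub>v x = x" for z
  proof -
    have "ract M (lower_unip z) *\<^sub>v x = ract M (lower_unip z * weyl) *\<^sub>v v"
      using vc by (simp add: x_def ract_mult_vec[OF M])
    also have "lower_unip z * weyl = weyl * upper_unip z" by (simp add: mat2_mult)
    also have "ract M \<dots> *\<^sub>v v = x"
      using vc by (subst ract_mult_vec[OF M]) (simp_all add: highest_weight_vector_fixed[OF M Q v(1)] x_def)
    finally show ?thesis .
  qed
  thus ?thesis using xc x0 by (intro that)
qed

text \<open>With these coefficients the combination of the torus elements diag(s, 1) is the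
  projection to first weight entry a among entries up to m. A projection made of group elements is
  compatible with module homomorphisms. The node 0 is excluded because diag(0, 1) is
  singular.\<close>

lemma lagrange_coefficients:
  assumes "a \<le> m"
  obtains S and c :: "'a::alg_closed_field \<Rightarrow> 'a" where "finite S" "0 \<notin> S"
    "\<And>b. b \<le> m \<Longrightarrow> (\<Sum>s\<in>S. c s * s ^ b) = (if b = a then 1 else 0)"
proof -
  obtain S :: "'a set" where S: "finite S" "card S = Suc m" "S \<subseteq> {x. x \<noteq> 0}"
    using infinite_arbitrarily_large[OF infinite_nonzero, of "Suc m"] by blast
  define l where "l s = (\<Prod>r\<in>S - {s}. Polynomial.smult (inverse (s - r)) [:-r, 1:])" for s
  have deg: "degree (l s) \<le> m" if "s \<in> S" for s
  proof -
    have "degree (l s) \<le> (\<Sum>r\<in>S - {s}. degree (Polynomial.smult (inverse (s - r)) [:-r, 1:]))"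
      unfolding l_def
      by (rule order_trans[OF degree_prod_sum_le[OF finite_Diff[OF S(1)]]]) (simp only: o_def order_refl)
    also have "\<dots> \<le> (\<Sum>r\<in>S - {s}. 1)" by (intro sum_mono) auto
    also have "\<dots> = m" using S that by simp
    finally show ?thesis .
  qed
  have eval: "poly (l s) r = (if r = s then 1 else 0)" if "s \<in> S" "r \<in> S" for s r
  proof (cases "r = s")
    case True
    have "poly (l s) s = (\<Prod>r\<in>S - {s}. 1)"
      unfolding l_def poly_prod
    proof (intro prod.cong refl)
      fix r assume "r \<in> S - {s}"
      hence "s - r \<noteq> 0" by auto
      hence "inverse (s - r) * (s - r) = 1" by (rule left_inverse)
      thus "poly (Polynomial.smult (inverse (s - r)) [:-r, 1:]) s = 1" by (simp add: algebra_simps)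
    qed
    thus ?thesis using True by simp
  next
    case False
    thus ?thesis unfolding l_def poly_prod using that S(1)
      by (auto intro!: prod_zero bexI[of _ r])
  qed
  define c where "c s = coeff (l s) a" for s
  have "(\<Sum>s\<in>S. c s * s ^ b) = (if b = a then 1 else 0)" if b: "b \<le> m" for b
  proof -
    \<comment> \<open>Interpolation of X^b in m + 1 nodes is exact for b at most m; the claim is its
      coefficient at X^a.\<close>
    have "monom 1 b = (\<Sum>s\<in>S. Polynomial.smult (s ^ b) (l s))"
    proof (rule poly_eqI_degree[of S])
      fix r assume r: "r \<in> S"
      have "poly (\<Sum>s\<in>S. Polynomial.smult (s ^ b) (l s)) r = (\<Sum>s\<in>S. if s = r then r ^ b else 0)"
        unfolding poly_sum using r by (intro sum.cong) (auto simp: eval)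
      thus "poly (monom 1 b) r = poly (\<Sum>s\<in>S. Polynomial.smult (s ^ b) (l s)) r"
        using r S(1) by (simp add: poly_monom)
    next
      show "card S > degree (monom (1::'a) b)" using S b by (simp add: degree_monom_eq)
      have "degree (\<Sum>s\<in>S. Polynomial.smult (s ^ b) (l s)) \<le> m"
        using S(1) deg by (intro degree_sum_le) (auto intro: order_trans[OF degree_smult_le])
      thus "card S > degree (\<Sum>s\<in>S. Polynomial.smult (s ^ b) (l s))" using S by simp
    qed
    hence "coeff (monom 1 b) a = coeff (\<Sum>s\<in>S. Polynomial.smult (s ^ b) (l s)) a" by simp
    thus ?thesis by (simp add: coeff_sum c_def mult.commute)
  qed
  thus ?thesis using S by (intro that[of S c]) auto
qed

section \<open>Weyl modules\<close>

lemma power_exponent_unique: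
  assumes "\<And>s::'a::alg_closed_field. s \<noteq> 0 \<Longrightarrow> s ^ a = s ^ b"
  shows "a = b"
proof -
  have "monom (1::'a) a = monom 1 b"
    by (rule poly_eqI_infinite[OF infinite_nonzero]) (simp add: poly_monom assms)
  thus ?thesis by (metis degree_monom_eq one_neq_zero)
qed

text \<open>
  A vector of weight \<open>(m + 1, 0)\<close> in \<open>\<nabla>(l)\<close> is the function \<open>g \<mapsto> c g\<^sub>1\<^sub>1\<^sup>m\<^sup>+\<^sup>1\<close>, and if \<open>c \<noteq> 0\<close> then
  \<open>l = (m + 1, 0)\<close>; the vector \<open>y\<close> is \<open>g \<mapsto> c g\<^sub>1\<^sub>1\<^sup>m g\<^sub>1\<^sub>2\<close>.
\<close>
lemma dual_Weyl_subhighest: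
  fixes N :: "'a::alg_closed_field gl2_rep"
  assumes N: "is_dual_Weyl l N" and x: "x \<in> weight_space N (Suc m, 0)"
  shows "\<exists>y\<in>weight_space N (m, 1). \<forall>z. ract N (upper_unip z) *\<^sub>v y = y + z \<cdot>\<^sub>v x"
proof -
  obtain l1 l2 where l: "l = (l1, l2)" by (cases l)
  have pm: "polynomial_module N" using N by (simp add: is_dual_Weyl_def)
  obtain \<Phi> where bij: "bij_betw \<Phi> (rspace N) (induced_space l)"
    and add: "\<And>u v g. u \<in> rspace N \<Longrightarrow> v \<in> rspace N \<Longrightarrow> \<Phi> (u + v) g = \<Phi> u g + \<Phi> v g"
    and smult: "\<And>c v g. v \<in> rspace N \<Longrightarrow> \<Phi> (c \<cdot>\<^sub>v v) g = c * \<Phi> v g"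
    and act: "\<And>g v h. g \<in> GL2 \<Longrightarrow> v \<in> rspace N \<Longrightarrow> h \<in> GL2 \<Longrightarrow> \<Phi> (ract N g *\<^sub>v v) h = \<Phi> v (h * g)"
    using N unfolding is_dual_Weyl_def by blast
  have range: "\<Phi> v \<in> induced_space l" if "v \<in> rspace N" for v using bij that by (auto simp: bij_betw_def)
  have ext: "u = v" if "u \<in> rspace N" "v \<in> rspace N" "\<And>g. g \<in> GL2 \<Longrightarrow> \<Phi> u g = \<Phi> v g" for u v
  proof -
    have "\<Phi> u g = \<Phi> v g" for g
      using that(3) range[OF that(1)] range[OF that(2)] by (cases "g \<in> GL2") (auto simp: induced_space_def)
    hence "\<Phi> u = \<Phi> v" by (simp add: fun_eq_iff)
    thus ?thesis using bij that(1,2) by (auto simp: bij_betw_def inj_on_def)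
  qed
  have xc: "x \<in> rspace N" and xw: "\<And>s t. s \<noteq> 0 \<Longrightarrow> t \<noteq> 0 \<Longrightarrow> ract N (mat2 s 0 0 t) *\<^sub>v x = s ^ Suc m \<cdot>\<^sub>v x"
    using x by (simp_all add: weight_space_iff)
  define F where "F = \<Phi> x"
  have F: "F \<in> induced_space l" unfolding F_def by (rule range[OF xc])
  have Fb: "F (mat2 a 0 b d * g) = a ^ l1 * d ^ l2 * F g" if "a \<noteq> 0" "d \<noteq> 0" "g \<in> GL2" for a b d g
  proof -
    have "mat2 a 0 b d \<in> lower_Borel" using that by (simp add: lower_Borel_def)
    hence "F (mat2 a 0 b d * g) = mat2 a 0 b d $$ (0,0) ^ fst l * mat2 a 0 b d $$ (1,1) ^ snd l * F g"
      using F that(3) unfolding induced_space_def by blast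
    thus ?thesis by (simp add: l)
  qed
  have Ft: "F (g * mat2 s 0 0 t) = s ^ Suc m * F g" if "s \<noteq> 0" "t \<noteq> 0" "g \<in> GL2" for s t g
    using act[of "mat2 s 0 0 t" x g] that xw[OF that(1,2)] smult[OF xc] xc by (simp add: F_def)
  \<comment> \<open>A regular function has a power of the determinant as denominator, which is
    constant along a curve of constant determinant.\<close>
  have Fpoly: "poly_fun (\<lambda>z. F (mat2 (a z) (b z) (c z) (d z)))"
    if "poly_fun a" "poly_fun b" "poly_fun c" "poly_fun d" and k: "k \<noteq> 0" "\<And>z. a z * d z - b z * c z = k" for a b c d k
  proof -
    obtain q e where q: "polynomial_fun q" and Fq: "\<And>g. g \<in> GL2 \<Longrightarrow> F g = q g / det g ^ e"
      using F unfolding induced_space_def regular_fun_def by blast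
    have "poly_fun (\<lambda>z. q (mat2 (a z) (b z) (c z) (d z)) * inverse (k ^ e))"
      using q that by (intro poly_fun_intros polynomial_fun_poly_fun) auto
    moreover have "F (mat2 (a z) (b z) (c z) (d z)) = q (mat2 (a z) (b z) (c z) (d z)) * inverse (k ^ e)" for z
      using k by (subst Fq) (auto simp: divide_inverse)
    ultimately show ?thesis by simp
  qed
  define h where "h z = F (upper_unip z)" for z
  have h: "poly_fun h" unfolding h_def by (rule Fpoly[of _ _ _ _ 1]) (auto intro: poly_fun_intros)
  have ht: "h z = t ^ l2 * h (z * t)" if "t \<noteq> 0" for z t
  proof -
    have "upper_unip z * mat2 1 0 0 t = mat2 1 0 0 t * upper_unip (z * t)"
      using that by (simp add: mat2_mult)
    thus ?thesis using Ft[of 1 t "upper_unip z"] Fb[of 1 t "upper_unip (z * t)" 0] that by (simp add: h_def)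
  qed
  \<comment> \<open>Both sides are polynomials in t, so the torus identity extends to t = 0. If l2 >
    0 this gives h 1 = 0 and then h = 0; if l2 = 0 it says that h is constant.\<close>
  have h1: "h 1 = t ^ l2 * h t" for t
    by (rule poly_fun_eqI[of "\<lambda>t. h 1" "\<lambda>t. t ^ l2 * h t", OF poly_fun_const
          poly_fun_mult[OF poly_fun_power[OF poly_fun_ident] h] infinite_nonzero]) (use ht[of _ 1] in simp)
  define c where "c = h 1"
  have hc: "h z = c" for z
  proof (cases "l2 = 0")
    case True
    thus ?thesis using h1[of z] by (simp add: c_def)
  next
    case False
    hence "c = 0" using h1[of 0] by (simp add: c_def)
    have h0: "h t = 0" if "t \<noteq> 0" for t using h1[of t] \<open>c = 0\<close> that by (simp add: c_def)
    have "h z = 0" by (rule poly_fun_eqI[OF h poly_fun_const infinite_nonzero]) (simp add: h0)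
    thus ?thesis using \<open>c = 0\<close> by simp
  qed
  have l_eq: "l2 = 0 \<and> l1 = Suc m" if c: "c \<noteq> 0"
  proof
    show "l2 = 0" using h1[of 0] c by (auto simp: c_def power_0_left split: if_splits)
    have "s ^ l1 = s ^ Suc m" if s: "s \<noteq> 0" for s :: 'a
      using Ft[of s 1 "upper_unip 0"] Fb[of s 1 "upper_unip 0" 0] s c hc[of 0]
      by (simp add: h_def mat2_mult)
    thus "l1 = Suc m" by (rule power_exponent_unique)
  qed
  have F1: "F g = c * g $$ (0,0) ^ Suc m" if g: "g \<in> GL2" and a0: "g $$ (0,0) \<noteq> 0" for g
  proof -
    obtain a b c' d where gm: "g = mat2 a b c' d" and det: "a * d - b * c' \<noteq> 0" using g by (rule GL2_cases)
    have a: "a \<noteq> 0" using a0 gm by simp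
    have "g = mat2 a 0 c' ((a * d - b * c') / a) * upper_unip (b / a)"
      using a by (simp add: gm mat2_mult field_simps)
    hence "F g = a ^ l1 * ((a * d - b * c') / a) ^ l2 * c"
      using Fb[of a "(a * d - b * c') / a" "upper_unip (b / a)" c'] a det hc[of "b / a"] by (simp add: h_def)
    thus ?thesis using l_eq by (cases "c = 0") (auto simp: gm)
  qed
  have F_eq: "F g = c * g $$ (0,0) ^ Suc m" if g: "g \<in> GL2" for g
  proof (cases "g $$ (0,0) = 0")
    case True
    obtain a b c' d where gm: "g = mat2 a b c' d" and det: "a * d - b * c' \<noteq> 0" using g by (rule GL2_cases)
    have a: "a = 0" "b \<noteq> 0" "c' \<noteq> 0" using True gm det by auto
    have FG: "poly_fun (\<lambda>z. F (mat2 (b * z) b (c' + d * z) d))"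
      by (rule Fpoly[of _ _ _ _ "- (b * c')"])
         (use a in \<open>simp_all add: poly_fun_intros algebra_simps\<close>)
    have cG: "poly_fun (\<lambda>z. c * (b * z) ^ Suc m)"
      by (intro poly_fun_mult poly_fun_power poly_fun_const poly_fun_ident)
    have "F (mat2 (b * 0) b (c' + d * 0) d) = c * (b * 0) ^ Suc m"
    proof (rule poly_fun_eqI[OF FG cG infinite_nonzero])
      fix z :: 'a assume "z \<in> {x. x \<noteq> 0}"
      thus "F (mat2 (b * z) b (c' + d * z) d) = c * (b * z) ^ Suc m"
        using a by (subst F1) (auto simp: algebra_simps)
    qed
    thus ?thesis by (simp add: gm a)
  qed (use F1 g in auto)
  show ?thesis
  proof (cases "c = 0")
    case True
    \<comment> \<open>In this case the statement is satisfied by y = 0.\<close>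
    have "x = 0\<^sub>v (rdim N)"
    proof (rule ext[OF xc])
      fix g :: "'a mat" assume "g \<in> GL2"
      have "0\<^sub>v (rdim N) = 0 \<cdot>\<^sub>v x" using xc by (intro eq_vecI) auto
      hence "\<Phi> (0\<^sub>v (rdim N)) g = 0" using smult[OF xc, of 0 g] by simp
      thus "\<Phi> x g = \<Phi> (0\<^sub>v (rdim N)) g" using F_eq[OF \<open>g \<in> GL2\<close>] True by (simp add: F_def)
    qed simp
    moreover have "ract N g *\<^sub>v 0\<^sub>v (rdim N) = 0\<^sub>v (rdim N)" if "g \<in> GL2" for g
      by (rule mult_mat_zero_vec[OF ract_carrier[OF pm that]])
    ultimately show ?thesis by (intro bexI[of _ "0\<^sub>v (rdim N)"]) (auto simp: weight_space_iff intro!: eq_vecI)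
  next
    case False
    define Y :: "'a mat \<Rightarrow> 'a" where "Y g = (if g \<in> GL2 then c * g $$ (0,0) ^ m * g $$ (0,1) else 0)" for g
    have "polynomial_fun Y" unfolding polynomial_fun_def
      by (rule exI[of _ "{(m, 1, 0, 0)}"], rule exI[of _ "\<lambda>_. c"]) (simp add: Y_def)
    hence reg: "regular_fun Y" unfolding regular_fun_def by (intro exI[of _ Y] exI[of _ 0]) simp
    have "Y (b * g) = b $$ (0,0) ^ fst l * b $$ (1,1) ^ snd l * Y g" if b: "b \<in> lower_Borel" and g: "g \<in> GL2" for b g
    proof -
      have bG: "b \<in> GL2" "b $$ (0,1) = 0" using b by (auto simp: lower_Borel_def)
      obtain b1 b2 b3 b4 where bm: "b = mat2 b1 b2 b3 b4" using bG(1) by (rule GL2_cases)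
      obtain g1 g2 g3 g4 where gm: "g = mat2 g1 g2 g3 g4" using g by (rule GL2_cases)
      have "b * g \<in> GL2" by (rule GL2_mult[OF bG(1) g])
      thus ?thesis using bG g l_eq[OF False] by (simp add: Y_def l bm gm mat2_mult power_mult_distrib)
    qed
    hence "Y \<in> induced_space l" using reg by (auto simp: induced_space_def Y_def)
    then obtain y where yc: "y \<in> rspace N" and y: "\<Phi> y = Y"
      using bij unfolding bij_betw_def by (metis imageE)
    have "ract N (mat2 s 0 0 t) *\<^sub>v y = (s ^ m * t ^ 1) \<cdot>\<^sub>v y" if st: "s \<noteq> 0" "t \<noteq> 0" for s t
    proof (rule ext)
      show "ract N (mat2 s 0 0 t) *\<^sub>v y \<in> rspace N" using st by (intro ract_vec_carrier[OF pm _ yc]) simp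
      fix g :: "'a mat" assume g: "g \<in> GL2"
      obtain g1 g2 g3 g4 where gm: "g = mat2 g1 g2 g3 g4" using g by (rule GL2_cases)
      have "g * mat2 s 0 0 t \<in> GL2" using g st by (intro GL2_mult) auto
      thus "\<Phi> (ract N (mat2 s 0 0 t) *\<^sub>v y) g = \<Phi> ((s ^ m * t ^ 1) \<cdot>\<^sub>v y) g"
        using act[of "mat2 s 0 0 t" y g] st g smult[OF yc] yc
        by (simp add: y Y_def gm mat2_mult power_mult_distrib)
    qed (use yc in simp)
    hence "y \<in> weight_space N (m, 1)" using yc by (simp add: weight_space_iff)
    moreover have "ract N (upper_unip z) *\<^sub>v y = y + z \<cdot>\<^sub>v x" for z
    proof (rule ext)
      show "ract N (upper_unip z) *\<^sub>v y \<in> rspace N" by (intro ract_vec_carrier[OF pm _ yc]) simp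
      fix g :: "'a mat" assume g: "g \<in> GL2"
      obtain g1 g2 g3 g4 where gm: "g = mat2 g1 g2 g3 g4" using g by (rule GL2_cases)
      have "g * upper_unip z \<in> GL2" using g by (intro GL2_mult) auto
      thus "\<Phi> (ract N (upper_unip z) *\<^sub>v y) g = \<Phi> (y + z \<cdot>\<^sub>v x) g"
        using act[of "upper_unip z" y g] g smult[OF xc] yc xc add[of y "z \<cdot>\<^sub>v x"] F_eq[OF g]
        by (simp add: y Y_def F_def gm mat2_mult algebra_simps)
    qed (use yc xc in simp)
    ultimately show ?thesis by blast
  qed
qed

section \<open>The contravariant pairing and Weyl modules\<close>

lemma contravariant_adjoint:
  assumes "polynomial_module M" "g \<in> GL2" "x \<in> rspace M" "y \<in> rspace M"
  shows "(ract (contravariant_dual M) g *\<^sub>v y) \<bullet> x = y \<bullet> (ract M (transpose_mat g) *\<^sub>v x)"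
proof -
  have "ract M (transpose_mat g) \<in> carrier_mat (rdim M) (rdim M)"
    using assms by (intro ract_carrier) auto
  from transpose_vec_mult_scalar[OF this assms(3,4)] show ?thesis
    using assms by simp
qed

lemma weight_spaces_orthogonal:
  fixes M :: "'a::alg_closed_field gl2_rep"
  assumes M: "polynomial_module M" and y: "y \<in> weight_space (contravariant_dual M) (a, b)"
    and x: "x \<in> weight_space M (a', b')" and ne: "a \<noteq> a'"
  shows "y \<bullet> x = 0"
proof (rule ccontr)
  assume nz: "y \<bullet> x \<noteq> 0"
  have xc: "x \<in> rspace M" and yc: "y \<in> rspace M" using x y by (simp_all add: weight_space_iff)
  have "s ^ a = s ^ a'" if s: "s \<noteq> 0" for s :: 'a
  proof -
    let ?d = "mat2 s 0 0 1"
    have "(ract (contravariant_dual M) ?d *\<^sub>v y) \<bullet> x = y \<bullet> (ract M (transpose_mat ?d) *\<^sub>v x)"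
      using s by (intro contravariant_adjoint[OF M _ xc yc]) simp
    moreover have "ract (contravariant_dual M) ?d *\<^sub>v y = s ^ a \<cdot>\<^sub>v y"
      using y s unfolding weight_space_iff by (metis mult.right_neutral one_neq_zero power_one)
    moreover have "ract M (transpose_mat ?d) *\<^sub>v x = s ^ a' \<cdot>\<^sub>v x"
      using x s by (simp add: weight_space_iff)
    ultimately show ?thesis using nz xc yc by simp
  qed
  thus False using power_exponent_unique ne by blast
qed

text \<open>The weight projections sum to the identity, so some row of one of them pairs
  nontrivially with x. That row is a weight vector of the contravariant dual; the nonzero pairing
  forces its weight to be that of x, and the result for dual Weyl modules applies to it.\<close>

lemma Weyl_subhighest:
  fixes N :: "'a::alg_closed_field gl2_rep"
  assumes N: "is_Weyl l N" and x: "x \<in> weight_space N (Suc m, 0)" "x \<noteq> 0\<^sub>v (rdim N)"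
  shows "\<exists>y\<in>weight_space (contravariant_dual N) (m, 1). \<exists>x'\<in>rspace N. x' \<bullet> x \<noteq> 0 \<and>
    (\<forall>z. ract (contravariant_dual N) (upper_unip z) *\<^sub>v y = y + z \<cdot>\<^sub>v x')"
proof -
  let ?n = "rdim N"
  have pm: "polynomial_module N" and dual: "is_dual_Weyl l (contravariant_dual N)" using N by (auto simp: is_Weyl_def)
  obtain D P where DP: "\<forall>a b. P a b \<in> carrier_mat ?n ?n"
    "\<forall>s t i j. s \<noteq> 0 \<longrightarrow> t \<noteq> 0 \<longrightarrow> i < ?n \<longrightarrow> j < ?n \<longrightarrow>
      ract N (mat2 s 0 0 t) $$ (i, j) = (\<Sum>a\<le>D. \<Sum>b\<le>D. s ^ a * (t ^ b * P a b $$ (i, j)))"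
    "\<forall>s t a b. s \<noteq> 0 \<longrightarrow> t \<noteq> 0 \<longrightarrow> a \<le> D \<longrightarrow> b \<le> D \<longrightarrow>
      ract N (mat2 s 0 0 t) * P a b = (s ^ a * t ^ b) \<cdot>\<^sub>m P a b \<and>
      P a b * ract N (mat2 s 0 0 t) = (s ^ a * t ^ b) \<cdot>\<^sub>m P a b"
    using torus_expansion[OF pm] by (elim exE conjE) (rule that)
  note P = DP(1)[rule_format] and expand = DP(2)[rule_format] and act = DP(3)[rule_format]
  have xc: "x \<in> rspace N" and xw: "\<And>s t. s \<noteq> 0 \<Longrightarrow> t \<noteq> 0 \<Longrightarrow> ract N (mat2 s 0 0 t) *\<^sub>v x = s ^ Suc m \<cdot>\<^sub>v x"
    using x by (simp_all add: weight_space_iff)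
  obtain i where i: "i < ?n" "x $ i \<noteq> 0" using x(2) xc by (metis carrier_vecD eq_vecI index_zero_vec)
  \<comment> \<open>Evaluating the torus expansion at the identity writes x as the sum of its
    components \<open>P a b\<close> applied to x.\<close>
  have "x $ i = (ract N (mat2 1 0 0 1) *\<^sub>v x) $ i" using pm xc by (simp add: mat2_one ract_one)
  also have "\<dots> = (\<Sum>j<?n. (\<Sum>a\<le>D. \<Sum>b\<le>D. P a b $$ (i, j)) * x $ j)"
    using i xc by (auto simp: scalar_prod_def atLeast0LessThan expand ract_dim[OF pm] intro!: sum.cong)
  also have "\<dots> = (\<Sum>j<?n. \<Sum>a\<le>D. \<Sum>b\<le>D. P a b $$ (i, j) * x $ j)"
    by (simp add: sum_distrib_right)
  also have "\<dots> = (\<Sum>a\<le>D. \<Sum>b\<le>D. \<Sum>j<?n. P a b $$ (i, j) * x $ j)"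
    by (rule trans[OF sum.swap], rule sum.cong[OF refl], rule sum.swap)
  finally have "(\<Sum>a\<le>D. \<Sum>b\<le>D. \<Sum>j<?n. P a b $$ (i, j) * x $ j) \<noteq> 0" using i by simp
  then obtain a b where ab: "a \<le> D" "b \<le> D" and "(\<Sum>j<?n. P a b $$ (i, j) * x $ j) \<noteq> 0"
    by (metis (no_types, lifting) atMost_iff sum.not_neutral_contains_not_neutral)
  moreover define x' where "x' = row (P a b) i"
  ultimately have x'x: "x' \<bullet> x \<noteq> 0"
    using i xc carrier_matD[OF P] by (simp add: scalar_prod_def atLeast0LessThan)
  have x'c: "x' \<in> rspace N" unfolding x'_def by (rule row_carrier_vec[OF i(1) P])
  have x'w: "ract (contravariant_dual N) (mat2 s 0 0 t) *\<^sub>v x' = (s ^ a * t ^ b) \<cdot>\<^sub>v x'" if st: "s \<noteq> 0" "t \<noteq> 0" for s t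
  proof (rule eq_vecI)
    have dc: "ract N (mat2 s 0 0 t) \<in> carrier_mat ?n ?n" using st by (intro ract_carrier[OF pm]) simp
    fix j assume "j < dim_vec ((s ^ a * t ^ b) \<cdot>\<^sub>v x')"
    hence j: "j < ?n" using x'c by simp
    have "(ract (contravariant_dual N) (mat2 s 0 0 t) *\<^sub>v x') $ j = (P a b * ract N (mat2 s 0 0 t)) $$ (i, j)"
      using i j carrier_matD[OF P] carrier_matD[OF dc] x'c col_carrier_vec[OF j dc]
      by (simp add: x'_def comm_scalar_prod[of _ ?n])
    thus "(ract (contravariant_dual N) (mat2 s 0 0 t) *\<^sub>v x') $ j = ((s ^ a * t ^ b) \<cdot>\<^sub>v x') $ j"
      using act[OF st ab] i j carrier_matD[OF P] by (simp add: x'_def)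
  qed (use st x'c in \<open>simp add: ract_dim[OF pm]\<close>)
  have weights: "s ^ a * t ^ b = s ^ Suc m" if st: "s \<noteq> 0" "t \<noteq> 0" for s t :: 'a
  proof -
    let ?d = "mat2 s 0 0 t"
    have "(ract (contravariant_dual N) ?d *\<^sub>v x') \<bullet> x = x' \<bullet> (ract N (transpose_mat ?d) *\<^sub>v x)"
      using st by (intro contravariant_adjoint[OF pm _ xc x'c]) simp
    moreover have "ract N (transpose_mat ?d) *\<^sub>v x = s ^ Suc m \<cdot>\<^sub>v x" using xw[OF st] by simp
    ultimately show ?thesis unfolding x'w[OF st] using xc x'c x'x by simp
  qed
  have "x' \<in> weight_space (contravariant_dual N) (Suc m, 0)"
    using x'c x'w weights unfolding weight_space_iff by simp
  from dual_Weyl_subhighest[OF dual this] show ?thesis using x'c x'x by blast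
qed

section \<open>Filtrations\<close>

lemma
  assumes "submodule_of M W"
  shows submodule_subset: "W \<subseteq> rspace M"
    and submodule_zero: "0\<^sub>v (rdim M) \<in> W"
    and submodule_add: "u \<in> W \<Longrightarrow> v \<in> W \<Longrightarrow> u + v \<in> W"
    and submodule_smult: "v \<in> W \<Longrightarrow> c \<cdot>\<^sub>v v \<in> W"
    and submodule_act: "g \<in> GL2 \<Longrightarrow> v \<in> W \<Longrightarrow> ract M g *\<^sub>v v \<in> W"
  using assms unfolding submodule_of_def VectorSpace.subspace_def submodule_def
  by (auto simp: module_vec_simps)

definition module_hom_on :: "'a::field gl2_rep \<Rightarrow> 'a gl2_rep \<Rightarrow> 'a vec set \<Rightarrow> ('a vec \<Rightarrow> 'a vec) \<Rightarrow> bool" where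
  "module_hom_on M N W f \<longleftrightarrow> (\<forall>u\<in>W. \<forall>v\<in>W. f (u + v) = f u + f v) \<and>
    (\<forall>c. \<forall>v\<in>W. f (c \<cdot>\<^sub>v v) = c \<cdot>\<^sub>v f v) \<and>
    (\<forall>g\<in>GL2. \<forall>v\<in>W. f (ract M g *\<^sub>v v) = ract N g *\<^sub>v f v) \<and> f ` W = rspace N"

lemma
  assumes "module_hom_on M N W f"
  shows module_hom_add: "u \<in> W \<Longrightarrow> v \<in> W \<Longrightarrow> f (u + v) = f u + f v"
    and module_hom_smult: "v \<in> W \<Longrightarrow> f (c \<cdot>\<^sub>v v) = c \<cdot>\<^sub>v f v"
    and module_hom_act: "g \<in> GL2 \<Longrightarrow> v \<in> W \<Longrightarrow> f (ract M g *\<^sub>v v) = ract N g *\<^sub>v f v"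
    and module_hom_image: "f ` W = rspace N"
    and module_hom_carrier: "v \<in> W \<Longrightarrow> f v \<in> rspace N"
  using assms unfolding module_hom_on_def by auto

lemma module_hom_zero:
  fixes M N :: "'a::field gl2_rep"
  assumes W: "submodule_of M W" and f: "module_hom_on M N W f"
  shows "f (0\<^sub>v (rdim M)) = 0\<^sub>v (rdim N)"
proof -
  have "(0::'a) \<cdot>\<^sub>v 0\<^sub>v (rdim M) = 0\<^sub>v (rdim M)" by (rule eq_vecI) auto
  hence "f (0\<^sub>v (rdim M)) = 0 \<cdot>\<^sub>v f (0\<^sub>v (rdim M))"
    using module_hom_smult[OF f submodule_zero[OF W], of 0] by simp
  also have "\<dots> = 0\<^sub>v (rdim N)"
    using module_hom_carrier[OF f submodule_zero[OF W]] by (intro eq_vecI) auto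
  finally show ?thesis .
qed

lemma module_hom_weight:
  assumes W: "submodule_of M W" and f: "module_hom_on M N W f" and v: "v \<in> W" "v \<in> weight_space M (a, b)"
  shows "f v \<in> weight_space N (a, b)"
  unfolding weight_space_iff
proof (intro conjI allI impI)
  show "f v \<in> rspace N" by (rule module_hom_carrier[OF f v(1)])
  fix s t :: 'a assume st: "s \<noteq> 0" "t \<noteq> 0"
  have "ract N (mat2 s 0 0 t) *\<^sub>v f v = f (ract M (mat2 s 0 0 t) *\<^sub>v v)"
    using st by (intro module_hom_act[OF f _ v(1), symmetric]) simp
  also have "\<dots> = (s ^ a * t ^ b) \<cdot>\<^sub>v f v"
    using v st by (simp add: weight_space_iff module_hom_smult[OF f])
  finally show "ract N (mat2 s 0 0 t) *\<^sub>v f v = (s ^ a * t ^ b) \<cdot>\<^sub>v f v" .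
qed

lemma quotient_iso_iff:
  "quotient_iso M W U N \<longleftrightarrow> (\<exists>f. module_hom_on M N W f \<and> {v \<in> W. f v = 0\<^sub>v (rdim N)} = U)"
  by (simp add: quotient_iso_def module_hom_on_def conj_assoc)

text \<open>Take the first member of the filtration that contains v: the preceding one does not, so
  v survives in the factor.\<close>

lemma filtration_factor:
  assumes filt: "has_filtration F M" and v: "v \<in> rspace M" "v \<noteq> 0\<^sub>v (rdim M)"
  obtains W N f where "F N" "submodule_of M W" "module_hom_on M N W f" "v \<in> W" "f v \<noteq> 0\<^sub>v (rdim N)"
proof -
  obtain n :: nat and V where V: "V 0 = {0\<^sub>v (rdim M)}" "V n = rspace M"
    and sub': "\<forall>i\<le>n. submodule_of M (V i)"
    and quot': "\<forall>i<n. V i \<subseteq> V (Suc i) \<and> (\<exists>N. F N \<and> quotient_iso M (V (Suc i)) (V i) N)"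
    using filt unfolding has_filtration_def by (elim exE conjE) (rule that)
  have sub: "submodule_of M (V i)" if "i \<le> n" for i using sub' that by simp
  have quot: "\<exists>N. F N \<and> quotient_iso M (V (Suc i)) (V i) N" if "i < n" for i using quot' that by simp
  define i where "i = (LEAST i. v \<in> V i)"
  have vi: "v \<in> V i" unfolding i_def by (rule LeastI[of _ n]) (simp add: V v)
  have "i \<le> n" unfolding i_def by (rule Least_le) (simp add: V v)
  have "i \<noteq> 0" using vi v(2) V(1) by (metis singletonD)
  then obtain j where j: "i = Suc j" by (cases i) auto
  have vj: "v \<notin> V j" using not_less_Least[of j "\<lambda>i. v \<in> V i"] j unfolding i_def by simp
  obtain N where N: "F N" "quotient_iso M (V i) (V j) N" using quot[of j] \<open>i \<le> n\<close> unfolding j by (auto simp: Suc_le_eq)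
  obtain f where f: "module_hom_on M N (V i) f" "{v \<in> V i. f v = 0\<^sub>v (rdim N)} = V j"
    using N(2) unfolding quotient_iso_iff by (elim exE conjE) (rule that)
  show ?thesis using that[OF N(1) sub[OF \<open>i \<le> n\<close>] f(1) vi] vi vj f(2) by blast
qed

text \<open>With Lagrange coefficients this projects to a weight space by means of group elements
  only. It therefore makes sense in M and in a filtration factor at once and commutes with the map
  between them, whereas the matrices of \<open>torus_split\<close> belong to a single
  module.\<close>

definition torus_comb :: "'a::field gl2_rep \<Rightarrow> 'a set \<Rightarrow> ('a \<Rightarrow> 'a) \<Rightarrow> 'a vec \<Rightarrow> 'a vec" where
  "torus_comb M S c x = vec (rdim M) (\<lambda>i. \<Sum>s\<in>S. c s * (ract M (mat2 s 0 0 1) *\<^sub>v x) $ i)"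

lemma torus_comb_carrier [simp]: "torus_comb M S c x \<in> rspace M"
  by (simp add: torus_comb_def)

lemma torus_comb_scalar_prod:
  assumes M: "polynomial_module M" and S: "0 \<notin> S" and x: "x \<in> rspace M" and y: "y \<in> rspace M"
  shows "y \<bullet> torus_comb M S c x = (\<Sum>s\<in>S. c s * (y \<bullet> (ract M (mat2 s 0 0 1) *\<^sub>v x)))"
proof -
  have d: "dim_vec (ract M (mat2 s 0 0 1) *\<^sub>v x) = rdim M" if "s \<in> S" for s
  proof -
    have "s \<noteq> 0" using S that by auto
    thus ?thesis by (simp add: ract_dim[OF M])
  qed
  have "y \<bullet> torus_comb M S c x = (\<Sum>i<rdim M. \<Sum>s\<in>S. c s * (y $ i * (ract M (mat2 s 0 0 1) *\<^sub>v x) $ i))"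
    by (simp add: scalar_prod_def torus_comb_def atLeast0LessThan sum_distrib_left mult.left_commute)
  also have "\<dots> = (\<Sum>s\<in>S. \<Sum>i<rdim M. c s * (y $ i * (ract M (mat2 s 0 0 1) *\<^sub>v x) $ i))"
    by (rule sum.swap)
  also have "\<dots> = (\<Sum>s\<in>S. c s * (y \<bullet> (ract M (mat2 s 0 0 1) *\<^sub>v x)))"
    using d unfolding scalar_prod_def atLeast0LessThan sum_distrib_left by (intro sum.cong) auto
  finally show ?thesis .
qed

lemma torus_comb_adjoint:
  assumes M: "polynomial_module M" and S: "0 \<notin> S" and x: "x \<in> rspace M" and y: "y \<in> rspace M"
  shows "torus_comb (contravariant_dual M) S c y \<bullet> x = y \<bullet> torus_comb M S c x"
proof -
  have "torus_comb (contravariant_dual M) S c y \<bullet> x = x \<bullet> torus_comb (contravariant_dual M) S c y"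
    by (rule comm_scalar_prod[OF _ x]) (metis torus_comb_carrier contravariant_dual_simps(1))
  also have "\<dots> = (\<Sum>s\<in>S. c s * (x \<bullet> (ract (contravariant_dual M) (mat2 s 0 0 1) *\<^sub>v y)))"
    by (rule torus_comb_scalar_prod[OF polynomial_module_contravariant_dual[OF M] S]) (simp_all add: x y)
  also have "\<dots> = (\<Sum>s\<in>S. c s * (y \<bullet> (ract M (mat2 s 0 0 1) *\<^sub>v x)))"
  proof (rule sum.cong[OF refl])
    fix s assume "s \<in> S"
    hence g: "mat2 s 0 0 1 \<in> GL2" using S by auto
    have "x \<bullet> (ract (contravariant_dual M) (mat2 s 0 0 1) *\<^sub>v y) =
      (ract (contravariant_dual M) (mat2 s 0 0 1) *\<^sub>v y) \<bullet> x"
      using ract_vec_carrier[OF polynomial_module_contravariant_dual[OF M] g, of y] y x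
      by (intro comm_scalar_prod[of _ "rdim M"]) (simp_all del: contravariant_dual_simps(2))
    thus "c s * (x \<bullet> (ract (contravariant_dual M) (mat2 s 0 0 1) *\<^sub>v y)) =
      c s * (y \<bullet> (ract M (mat2 s 0 0 1) *\<^sub>v x))"
      using contravariant_adjoint[OF M g x y] by simp
  qed
  also have "\<dots> = y \<bullet> torus_comb M S c x" by (rule torus_comb_scalar_prod[OF M S x y, symmetric])
  finally show ?thesis .
qed

lemma torus_comb_hom:
  assumes M: "polynomial_module M" and N: "polynomial_module N"
    and W: "submodule_of M W" and f: "module_hom_on M N W f" and x: "x \<in> W"
    and S: "finite S" "0 \<notin> S"
  shows "torus_comb M S c x \<in> W \<and> f (torus_comb M S c x) = torus_comb N S c (f x)"
  using S
proof (induction S rule: finite_induct)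
  case empty
  have "torus_comb R {} c z = 0\<^sub>v (rdim R)" for R and z :: "'a vec" by (simp add: torus_comb_def zero_vec_def)
  thus ?case using submodule_zero[OF W] module_hom_zero[OF W f] by simp
next
  case (insert s S)
  have g: "mat2 s 0 0 1 \<in> GL2" using insert.prems by auto
  have step: "torus_comb R (insert s S) c z = c s \<cdot>\<^sub>v (ract R (mat2 s 0 0 1) *\<^sub>v z) + torus_comb R S c z"
    if "polynomial_module R" for R and z :: "'a vec"
    using insert.hyps ract_dim[OF that g] by (intro eq_vecI) (auto simp: torus_comb_def)
  have IH: "torus_comb M S c x \<in> W" "f (torus_comb M S c x) = torus_comb N S c (f x)"
    using insert by auto
  have gx: "c s \<cdot>\<^sub>v (ract M (mat2 s 0 0 1) *\<^sub>v x) \<in> W"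
    by (intro submodule_smult[OF W] submodule_act[OF W g x])
  have "f (torus_comb M (insert s S) c x) = f (c s \<cdot>\<^sub>v (ract M (mat2 s 0 0 1) *\<^sub>v x)) + f (torus_comb M S c x)"
    unfolding step[OF M] by (rule module_hom_add[OF f gx IH(1)])
  also have "f (c s \<cdot>\<^sub>v (ract M (mat2 s 0 0 1) *\<^sub>v x)) = c s \<cdot>\<^sub>v (ract N (mat2 s 0 0 1) *\<^sub>v f x)"
    using module_hom_smult[OF f submodule_act[OF W g x]] module_hom_act[OF f g x] by simp
  finally show ?case unfolding step[OF M] step[OF N] using submodule_add[OF W gx IH(1)] IH(2) by simp
qed

lemma torus_comb_weight_vector:
  fixes M :: "'a::alg_closed_field gl2_rep"
  assumes M: "polynomial_module M" and S: "0 \<notin> S" and x: "x \<in> weight_space M (a, b)"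
    and c: "(\<Sum>s\<in>S. c s * s ^ a) = 1"
  shows "torus_comb M S c x = x"
proof (rule eq_vecI)
  have xc: "x \<in> rspace M" using x by (simp add: weight_space_iff)
  fix i assume "i < dim_vec x"
  hence i: "i < rdim M" using xc by simp
  have "torus_comb M S c x $ i = (\<Sum>s\<in>S. c s * s ^ a * x $ i)"
    unfolding torus_comb_def index_vec[OF i]
  proof (rule sum.cong[OF refl])
    fix s assume "s \<in> S"
    hence "s \<noteq> 0" using S by auto
    hence "ract M (mat2 s 0 0 1) *\<^sub>v x = s ^ a \<cdot>\<^sub>v x" using x by (simp add: weight_space_iff)
    thus "c s * (ract M (mat2 s 0 0 1) *\<^sub>v x) $ i = c s * s ^ a * x $ i" using i xc by simp
  qed
  thus "torus_comb M S c x $ i = x $ i" using c by (simp flip: sum_distrib_right)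
qed (use x in \<open>auto simp: torus_comb_def weight_space_iff\<close>)

text \<open>The combination coincides with \<open>Q a\<close>: all first weight entries of M are at
  most l1, and there the coefficients sum to 1 at a and to 0 elsewhere.\<close>

lemma torus_comb_in_weight_space:
  fixes M :: "'a::alg_closed_field gl2_rep"
  assumes M: "polynomial_module M" and Q: "torus_split M l1 l2 Q" and S: "0 \<notin> S" and x: "x \<in> rspace M"
    and a: "a \<in> {l2..l1}" and c: "\<And>b. b \<le> l1 \<Longrightarrow> (\<Sum>s\<in>S. c s * s ^ b) = (if b = a then 1 else 0)"
  shows "torus_comb M S c x \<in> weight_space M (a, l1 + l2 - a)"
proof -
  let ?n = "rdim M"
  have Qc: "Q b \<in> carrier_mat ?n ?n" for b using Q by (auto simp: torus_split_def)
  have split: "ract M (mat2 s 0 0 1) = mat_sum ?n ?n (\<lambda>b. (s ^ b * 1 ^ (l1 + l2 - b)) \<cdot>\<^sub>m Q b) {l2..l1}"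
    if "s \<noteq> 0" for s
    using Q[unfolded torus_split_def, THEN conjunct2, THEN conjunct2, rule_format, of s 1, THEN conjunct1] that
    by simp
  have "torus_comb M S c x = Q a *\<^sub>v x"
  proof (rule eq_vecI)
    fix i assume "i < dim_vec (Q a *\<^sub>v x)"
    hence i: "i < ?n" using Qc by (metis carrier_matD(1) dim_mult_mat_vec)
    have "torus_comb M S c x $ i = (\<Sum>s\<in>S. \<Sum>l<?n. \<Sum>b\<in>{l2..l1}. c s * s ^ b * (Q b $$ (i, l) * x $ l))"
      unfolding torus_comb_def index_vec[OF i]
    proof (rule sum.cong[OF refl])
      fix s assume "s \<in> S"
      hence s: "s \<noteq> 0" using S by auto
      have "(ract M (mat2 s 0 0 1) *\<^sub>v x) $ i = (\<Sum>l<?n. (\<Sum>b\<in>{l2..l1}. s ^ b * Q b $$ (i, l)) * x $ l)"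
        using i x carrier_matD[OF Qc] by (auto simp: split[OF s] scalar_prod_def atLeast0LessThan intro!: sum.cong)
      thus "c s * (ract M (mat2 s 0 0 1) *\<^sub>v x) $ i = (\<Sum>l<?n. \<Sum>b\<in>{l2..l1}. c s * s ^ b * (Q b $$ (i, l) * x $ l))"
        by (simp add: sum_distrib_left sum_distrib_right mult.assoc)
    qed
    also have "\<dots> = (\<Sum>l<?n. \<Sum>b\<in>{l2..l1}. \<Sum>s\<in>S. c s * s ^ b * (Q b $$ (i, l) * x $ l))"
      by (rule trans[OF sum.swap], rule sum.cong[OF refl], rule sum.swap)
    also have "\<dots> = (\<Sum>l<?n. \<Sum>b\<in>{l2..l1}. if b = a then Q b $$ (i, l) * x $ l else 0)"
      by (intro sum.cong refl) (simp add: c flip: sum_distrib_right)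
    also have "\<dots> = (\<Sum>l<?n. Q a $$ (i, l) * x $ l)" using a by simp
    also have "\<dots> = (Q a *\<^sub>v x) $ i"
      using i x carrier_matD[OF Qc] by (auto simp: scalar_prod_def atLeast0LessThan intro!: sum.cong)
    finally show "torus_comb M S c x $ i = (Q a *\<^sub>v x) $ i" .
  qed (use carrier_matD[OF Qc] in \<open>simp add: torus_comb_def\<close>)
  moreover have "ract M (mat2 s 0 0 t) *\<^sub>v (Q a *\<^sub>v x) = (s ^ a * t ^ (l1 + l2 - a)) \<cdot>\<^sub>v (Q a *\<^sub>v x)"
    if st: "s \<noteq> 0" "t \<noteq> 0" for s t
  proof -
    have dc: "ract M (mat2 s 0 0 t) \<in> carrier_mat ?n ?n" using st by (intro ract_carrier[OF M]) simp
    have "ract M (mat2 s 0 0 t) *\<^sub>v (Q a *\<^sub>v x) = (ract M (mat2 s 0 0 t) * Q a) *\<^sub>v x"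
      by (rule assoc_mult_mat_vec[OF dc Qc x, symmetric])
    also have "ract M (mat2 s 0 0 t) * Q a = (s ^ a * t ^ (l1 + l2 - a)) \<cdot>\<^sub>m Q a"
      using Q st a unfolding torus_split_def by blast
    also have "\<dots> *\<^sub>v x = (s ^ a * t ^ (l1 + l2 - a)) \<cdot>\<^sub>v (Q a *\<^sub>v x)"
      using x carrier_matD[OF Qc] by (intro eq_vecI) auto
    finally show ?thesis .
  qed
  ultimately show ?thesis
    using torus_comb_carrier[of M S c x] unfolding weight_space_iff by auto
qed

text \<open>The highest weight vector \<open>v0\<close> survives in some dual Weyl factor, which has
  a vector that is raised to its image. A preimage, projected to the weight (m, 1), is
  \<open>w\<close>, and raising \<open>w\<close> gives \<open>v\<close>. This \<open>v\<close> has
  the same image as \<open>v0\<close>, so it is nonzero, but it may differ from \<open>v0\<close> by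
  an element of the kernel.\<close>

lemma dual_Weyl_filtration_raising:
  fixes M :: "'a::alg_closed_field gl2_rep"
  assumes M: "polynomial_module M" and Q: "torus_split M (Suc m) 0 Q"
    and filt: "has_filtration (\<lambda>N. \<exists>m. \<exists>l\<in>Lambda_plus m. is_dual_Weyl l N) M"
    and v0: "v0 \<in> weight_space M (Suc m, 0)" "v0 \<noteq> 0\<^sub>v (rdim M)"
  obtains w v where "w \<in> weight_space M (m, 1)" "v \<in> weight_space M (Suc m, 0)" "v \<noteq> 0\<^sub>v (rdim M)"
    "\<And>z. ract M (upper_unip z) *\<^sub>v w = w + z \<cdot>\<^sub>v v"
proof -
  have v0c: "v0 \<in> rspace M" using v0(1) by (simp add: weight_space_iff)
  obtain W N f where "\<exists>m. \<exists>l\<in>Lambda_plus m. is_dual_Weyl l N" and W: "submodule_of M W"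
    and f: "module_hom_on M N W f" and v0W: "v0 \<in> W" and fv0: "f v0 \<noteq> 0\<^sub>v (rdim N)"
    by (rule filtration_factor[OF filt v0c v0(2)]) (rule that)
  then obtain l where N: "is_dual_Weyl l N" by blast
  hence pN: "polynomial_module N" by (simp add: is_dual_Weyl_def)
  have fv0w: "f v0 \<in> weight_space N (Suc m, 0)" by (rule module_hom_weight[OF W f v0W v0(1)])
  obtain y where y: "y \<in> weight_space N (m, 1)" and yU: "\<And>z. ract N (upper_unip z) *\<^sub>v y = y + z \<cdot>\<^sub>v f v0"
    using dual_Weyl_subhighest[OF N fv0w] by blast
  have yc: "y \<in> rspace N" using y by (simp add: weight_space_iff)
  then obtain y0 where y0: "y0 \<in> W" "f y0 = y" using module_hom_image[OF f] by (metis imageE)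
  obtain S c where S: "finite S" "0 \<notin> S"
    and c: "\<And>b. b \<le> Suc m \<Longrightarrow> (\<Sum>s\<in>S. c s * s ^ b) = (if b = m then 1 else (0::'a))"
    using lagrange_coefficients[of m "Suc m"] by auto
  define w where "w = torus_comb M S c y0"
  have wW: "w \<in> W" and "f w = torus_comb N S c (f y0)"
    using torus_comb_hom[OF M pN W f y0(1) S] by (simp_all add: w_def)
  moreover have "torus_comb N S c y = y"
    by (rule torus_comb_weight_vector[OF pN S(2) y]) (simp add: c)
  ultimately have fw: "f w = y" by (simp add: y0(2))
  have y0c: "y0 \<in> rspace M" using y0(1) submodule_subset[OF W] by blast
  have w: "w \<in> weight_space M (m, Suc 0)"
    using torus_comb_in_weight_space[OF M Q S(2) y0c, of m c] c by (simp add: w_def)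
  define v where "v = ract M (upper_unip 1) *\<^sub>v w - w"
  have v: "v \<in> weight_space M (Suc m, 0)" "ract M (upper_unip z) *\<^sub>v w = w + z \<cdot>\<^sub>v v" for z
    unfolding v_def by (rule subhighest_weight_vector[OF M Q w])+
  have "v \<noteq> 0\<^sub>v (rdim M)"
  proof
    assume v0: "v = 0\<^sub>v (rdim M)"
    have wc: "w \<in> rspace M" using w by (simp add: weight_space_iff)
    have "ract M (upper_unip 1) *\<^sub>v w = w" using v(2)[of 1] v0 wc by simp
    hence "f w = ract N (upper_unip 1) *\<^sub>v f w" using module_hom_act[OF f _ wW, of "upper_unip 1"] by simp
    hence eq: "y + f v0 = y" using yU[of 1] by (simp add: fw)
    have fc: "f v0 \<in> rspace N" by (rule module_hom_carrier[OF f v0W])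
    have "f v0 $ i = 0" if "i < rdim N" for i
    proof -
      have "(y + f v0) $ i = y $ i" by (simp only: eq)
      thus ?thesis using that yc fc by simp
    qed
    hence "f v0 = 0\<^sub>v (rdim N)" using fc by (intro eq_vecI) auto
    thus False using fv0 by simp
  qed
  thus ?thesis using that[of w v] v w by simp
qed

text \<open>A factor is a quotient of a submodule, so functionals on it are not functionals on M.
  The functional on the factor serves only to detect that the component \<open>u\<close> of weight
  (m, 1) of L(1) v is nonzero. A coordinate functional of M that does not vanish on
  \<open>u\<close>, projected to the same weight, is then \<open>w'\<close>, and the pairing of
  \<open>v'\<close> with v is the value of that coordinate at \<open>u\<close>.\<close>

lemma Weyl_filtration_lowering:
  fixes M :: "'a::alg_closed_field gl2_rep"
  assumes M: "polynomial_module M" and Q: "torus_split (contravariant_dual M) (Suc m) 0 Q"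
    and filt: "has_filtration (\<lambda>N. \<exists>m. \<exists>l\<in>Lambda_plus m. is_Weyl l N) M"
    and v: "v \<in> weight_space M (Suc m, 0)" "v \<noteq> 0\<^sub>v (rdim M)"
  obtains w' v' where "w' \<in> weight_space (contravariant_dual M) (m, 1)"
    "v' \<in> weight_space (contravariant_dual M) (Suc m, 0)" "v' \<bullet> v \<noteq> 0"
    "\<And>z. ract (contravariant_dual M) (upper_unip z) *\<^sub>v w' = w' + z \<cdot>\<^sub>v v'"
proof -
  note M' = polynomial_module_contravariant_dual[OF M]
  have vc: "v \<in> rspace M" using v(1) by (simp add: weight_space_iff)
  obtain W N f where "\<exists>m. \<exists>l\<in>Lambda_plus m. is_Weyl l N" and W: "submodule_of M W"
    and f: "module_hom_on M N W f" and vW: "v \<in> W" and fv: "f v \<noteq> 0\<^sub>v (rdim N)"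
    by (rule filtration_factor[OF filt vc v(2)]) (rule that)
  then obtain l where N: "is_Weyl l N" by blast
  hence pN: "polynomial_module N" by (simp add: is_Weyl_def)
  have fvw: "f v \<in> weight_space N (Suc m, 0)" by (rule module_hom_weight[OF W f vW v(1)])
  have fvc: "f v \<in> rspace N" using fvw by (simp add: weight_space_iff)
  obtain y x' where y: "y \<in> weight_space (contravariant_dual N) (m, 1)" and x': "x' \<in> rspace N" "x' \<bullet> f v \<noteq> 0"
    and yU: "\<And>z. ract (contravariant_dual N) (upper_unip z) *\<^sub>v y = y + z \<cdot>\<^sub>v x'"
    using Weyl_subhighest[OF N fvw fv] by blast
  have yc: "y \<in> rspace N" using y by (simp add: weight_space_iff)
  obtain S c where S: "finite S" "0 \<notin> S"
    and c: "\<And>b. b \<le> Suc m \<Longrightarrow> (\<Sum>s\<in>S. c s * s ^ b) = (if b = m then 1 else (0::'a))"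
    using lagrange_coefficients[of m "Suc m"] by auto
  define L where "L = (lower_unip 1 :: 'a mat)"
  have L [simp]: "L \<in> GL2" "transpose_mat (upper_unip 1) = L" by (simp_all add: L_def)
  define u where "u = torus_comb M S c (ract M L *\<^sub>v v)"
  have Lv: "ract M L *\<^sub>v v \<in> W" by (rule submodule_act[OF W L(1) vW])
  have Lfc: "ract N L *\<^sub>v f v \<in> rspace N" by (rule ract_vec_carrier[OF pN L(1) fvc])
  have fu: "f u = torus_comb N S c (ract N L *\<^sub>v f v)"
    using torus_comb_hom[OF M pN W f Lv S] module_hom_act[OF f L(1) vW] by (simp add: u_def)
  \<comment> \<open>Moving the projection and then L(1) to the other side of the pairing replaces
    \<open>y\<close> by \<open>y\<close> raised, that is y + x'. The part of \<open>y\<close> pairs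
    to 0 by weights, so the value is that of x' on the image of v.\<close>
  have "y \<bullet> f u = torus_comb (contravariant_dual N) S c y \<bullet> (ract N L *\<^sub>v f v)"
    unfolding fu by (rule torus_comb_adjoint[OF pN S(2) Lfc yc, symmetric])
  also have "torus_comb (contravariant_dual N) S c y = y"
    by (rule torus_comb_weight_vector[OF polynomial_module_contravariant_dual[OF pN] S(2) y]) (simp add: c)
  also have "y \<bullet> (ract N L *\<^sub>v f v) = (ract (contravariant_dual N) (upper_unip 1) *\<^sub>v y) \<bullet> f v"
    using contravariant_adjoint[OF pN _ fvc yc, of "upper_unip 1"] by (simp add: L_def)
  also have "\<dots> = y \<bullet> f v + x' \<bullet> f v"
    unfolding yU using yc x'(1) fvc by (simp add: add_scalar_prod_distrib[of _ "rdim N"])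
  also have "y \<bullet> f v = 0" by (rule weight_spaces_orthogonal[OF pN y fvw]) simp
  finally have yfu: "y \<bullet> f u \<noteq> 0" using x'(2) by simp
  have "u \<noteq> 0\<^sub>v (rdim M)"
  proof
    assume "u = 0\<^sub>v (rdim M)"
    hence "f u = 0\<^sub>v (rdim N)" using module_hom_zero[OF W f] by simp
    thus False using yfu yc by simp
  qed
  moreover have uc: "u \<in> rspace M" by (simp add: u_def)
  ultimately obtain i where i: "i < rdim M" "u $ i \<noteq> 0" by (metis carrier_vecD eq_vecI index_zero_vec)
  define w' where "w' = torus_comb (contravariant_dual M) S c (unit_vec (rdim M) i)"
  have w': "w' \<in> weight_space (contravariant_dual M) (m, Suc 0)"
    using torus_comb_in_weight_space[OF M' Q S(2), of "unit_vec (rdim M) i" m c] c by (simp add: w'_def)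
  have w'c: "w' \<in> rspace M" using w' by (simp add: weight_space_iff)
  define v' where "v' = ract (contravariant_dual M) (upper_unip 1) *\<^sub>v w' - w'"
  have v': "v' \<in> weight_space (contravariant_dual M) (Suc m, 0)"
    "ract (contravariant_dual M) (upper_unip z) *\<^sub>v w' = w' + z \<cdot>\<^sub>v v'" for z
    unfolding v'_def by (rule subhighest_weight_vector[OF M' Q w'])+
  have v'c: "v' \<in> rspace M" using v'(1) by (simp add: weight_space_iff)
  have "w' \<bullet> v + v' \<bullet> v = (ract (contravariant_dual M) (upper_unip 1) *\<^sub>v w') \<bullet> v"
    unfolding v'(2) using w'c v'c vc by (simp add: add_scalar_prod_distrib[of _ "rdim M"])
  also have "\<dots> = w' \<bullet> (ract M L *\<^sub>v v)"
    using contravariant_adjoint[OF M _ vc w'c, of "upper_unip 1"] by (simp add: L_def)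
  also have "\<dots> = unit_vec (rdim M) i \<bullet> u"
    unfolding w'_def u_def by (rule torus_comb_adjoint[OF M S(2) ract_vec_carrier[OF M L(1) vc]]) simp
  also have "\<dots> = u $ i" using i uc by simp
  also have "w' \<bullet> v = 0" by (rule weight_spaces_orthogonal[OF M w' v(1)]) simp
  finally have "v' \<bullet> v \<noteq> 0" using i(2) by simp
  thus ?thesis using that[of w' v'] v' w' by simp
qed

section \<open>Projectivity over the unipotent group\<close>

lemma polynomial_module_natural: "polynomial_module (natural_module :: 'a::field gl2_rep)"
proof -
  have *: "polynomial_fun (\<lambda>g::'a mat. g $$ (i, j))" if "i < 2" "j < 2" for i j
  proof -
    have entry: "polynomial_fun (\<lambda>g::'a mat. g $$ (i, j))"
      if "\<And>g::'a mat. g $$ (i, j) = (\<Sum>(i, j, k, l)\<in>{x}. 1 * g $$ (0,0) ^ i * g $$ (0,1) ^ j * g $$ (1,0) ^ k * g $$ (1,1) ^ l)" for x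
      unfolding polynomial_fun_def by (rule exI[of _ "{x}"], rule exI[of _ "\<lambda>_. 1"]) (use that in auto)
    consider "i = 0" "j = 0" | "i = 0" "j = 1" | "i = 1" "j = 0" | "i = 1" "j = 1"
      using \<open>i < 2\<close> \<open>j < 2\<close> by (auto simp: less_2_cases_iff)
    thus ?thesis
      by cases (rule entry[of "(1,0,0,0)"], simp, rule entry[of "(0,1,0,0)"], simp,
          rule entry[of "(0,0,1,0)"], simp, rule entry[of "(0,0,0,1)"], simp)
  qed
  show ?thesis unfolding polynomial_module_def natural_module_def
    using * by (auto simp: GL2_carrier)
qed

lemma polynomial_module_trivial: "polynomial_module (trivial_module :: 'a::field gl2_rep)"
proof -
  have "polynomial_fun (\<lambda>g::'a mat. 1)" unfolding polynomial_fun_def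
    by (rule exI[of _ "{(0,0,0,0)}"], rule exI[of _ "\<lambda>_. 1"]) simp
  thus ?thesis unfolding polynomial_module_def trivial_module_def by auto
qed

text \<open>Higman's criterion in matrix form: for q a power of the characteristic the L(t) form a
  finite group with inverses L(-t), and the identity is a relative trace from its trivial
  subgroup.\<close>

definition unipotent_projective :: "nat \<Rightarrow> 'a::field gl2_rep \<Rightarrow> bool" where
  "unipotent_projective q M \<longleftrightarrow> (\<exists>\<theta>\<in>carrier_mat (rdim M) (rdim M). 1\<^sub>m (rdim M) =
    mat_sum (rdim M) (rdim M) (\<lambda>t. ract M (lower_unip t) * \<theta> * ract M (lower_unip (-t))) {t. t ^ q = t})"

text \<open>The functional enters as the transpose of \<open>V'\<close>, and
  \<open>S_transpose\<close> turns the condition on \<open>V'\<close> in the contravariant dual into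
  the condition on that functional. The resulting endomorphism multiplies v by k, so
  indecomposability makes it invertible, and its inverse can be absorbed into the matrix whose
  conjugates are summed.\<close>

lemma unipotent_projective_criterion:
  fixes M S :: "'a::alg_closed_field gl2_rep"
  assumes M: "polynomial_module M" and indec: "indecomposable M" and S: "polynomial_module S"
    and q: "CHAR('a) = p" "p > 0" "q = p ^ s" "q > 1" "e = q - 1"
    and V: "V \<in> carrier_mat (rdim M) (rdim S)" and V': "V' \<in> carrier_mat (rdim M) (rdim S)"
    and V_eig: "\<And>a b d. a \<noteq> 0 \<Longrightarrow> d \<noteq> 0 \<Longrightarrow>
      ract M (mat2 a b 0 d) * V = a ^ e \<cdot>\<^sub>m (V * ract S (mat2 a b 0 d))"
    and V'_eig: "\<And>a b d. a \<noteq> 0 \<Longrightarrow> d \<noteq> 0 \<Longrightarrow>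
      ract (contravariant_dual M) (mat2 a b 0 d) * V' = a ^ e \<cdot>\<^sub>m (V' * ract S (mat2 a b 0 d))"
    and S_transpose: "\<And>g. g \<in> GL2 \<Longrightarrow> transpose_mat (ract S g) = ract S (transpose_mat g)"
    and v: "v \<in> rspace M" "v \<noteq> 0\<^sub>v (rdim M)" "\<And>z. ract M (upper_unip z) *\<^sub>v v = v"
    and fixed: "\<And>z. ract S (upper_unip z) *\<^sub>v (transpose_mat V' *\<^sub>v v) = transpose_mat V' *\<^sub>v v"
    and eig: "V *\<^sub>v (transpose_mat V' *\<^sub>v v) = k \<cdot>\<^sub>v v" "k \<noteq> 0"
  shows "unipotent_projective q M"
proof -
  let ?n = "rdim M"
  have "s \<noteq> 0" using q by (metis less_numeral_extra(4) power_0)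
  moreover have "(of_nat p :: 'a) = 0" unfolding q(1)[symmetric] by (rule of_nat_CHAR)
  ultimately have of_q: "(of_nat q :: 'a) = 0" unfolding q(3) of_nat_power by simp
  have binom: "(of_nat (e choose i) :: 'a) = (-1) ^ i" if "i \<le> e" for i
    using binomial_prime_power_minus_one[OF q(1-3), of i] that q(5) by simp
  have \<Phi>_eig: "transpose_mat V' * ract M (mat2 a 0 b d) = a ^ e \<cdot>\<^sub>m (ract S (mat2 a 0 b d) * transpose_mat V')"
    if "a \<noteq> 0" "d \<noteq> 0" for a b d
  proof -
    have g: "mat2 a 0 b d \<in> GL2" "mat2 a b 0 d \<in> GL2" using that by simp_all
    have rc: "ract M (mat2 a 0 b d) \<in> carrier_mat ?n ?n" by (rule ract_carrier[OF M g(1)])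
    have "transpose_mat V' * ract M (mat2 a 0 b d) = transpose_mat (transpose_mat (ract M (mat2 a 0 b d)) * V')"
      using V' rc by (subst transpose_mult[of _ ?n ?n _ "rdim S"]) simp_all
    also have "transpose_mat (ract M (mat2 a 0 b d)) * V' = a ^ e \<cdot>\<^sub>m (V' * ract S (mat2 a b 0 d))"
      using V'_eig[OF that, of b] by simp
    also have "transpose_mat \<dots> = a ^ e \<cdot>\<^sub>m (transpose_mat (ract S (mat2 a b 0 d)) * transpose_mat V')"
      using transpose_mult[OF V' ract_carrier[OF S g(2)]] by (simp add: transpose_smult)
    finally show ?thesis using S_transpose[OF g(2)] by simp
  qed
  have \<Phi>: "transpose_mat V' \<in> carrier_mat (rdim S) ?n" using V' by simp
  obtain A \<theta> where A: "A \<in> carrier_mat ?n ?n" and \<theta>: "\<theta> \<in> carrier_mat ?n ?n"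
    and comm: "\<And>g. g \<in> GL2 \<Longrightarrow> A * ract M g = ract M g * A"
    and trace: "A = mat_sum ?n ?n (\<lambda>t. ract M (lower_unip t) * \<theta> * ract M (lower_unip (-t))) {t. t ^ q = t}"
    and app: "\<And>x. x \<in> carrier_vec ?n \<Longrightarrow>
      (\<And>z. transpose_mat V' *\<^sub>v (ract M (upper_unip z) *\<^sub>v x) = ract S (upper_unip z) *\<^sub>v (transpose_mat V' *\<^sub>v x)) \<Longrightarrow>
      A *\<^sub>v x = V *\<^sub>v (transpose_mat V' *\<^sub>v x)"
  proof (rule steinberg_factorization[OF M S q(4) of_q q(5) binom V \<Phi> V_eig \<Phi>_eig], goal_cases)
    case (6 A \<theta>)
    show ?case by (rule that[OF 6(2-6)])
  qed
  have "A *\<^sub>v v = k \<cdot>\<^sub>v v" using app[OF v(1)] v(3) fixed eig(1) by simp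
  from indecomposable_endomorphism_invertible[OF M indec A comm v(1,2) this eig(2)]
  obtain A' where A': "A' \<in> carrier_mat ?n ?n" "A' * A = 1\<^sub>m ?n" "\<forall>g\<in>GL2. A' * ract M g = ract M g * A'" by blast
  note dims = carrier_matD[OF A] carrier_matD[OF A'(1)] carrier_matD[OF \<theta>]
  have rc: "ract M (lower_unip t) \<in> carrier_mat ?n ?n" for t by (rule ract_carrier[OF M]) simp
  \<comment> \<open>The left inverse commutes with the group action, so it moves inside each
    conjugate and stops in front of \<open>\<theta>\<close>.\<close>
  have "1\<^sub>m ?n = A' * mat_sum ?n ?n (\<lambda>t. ract M (lower_unip t) * \<theta> * ract M (lower_unip (-t))) {t. t ^ q = t}"
    using A'(2) trace by simp
  also have "\<dots> = mat_sum ?n ?n (\<lambda>t. A' * (ract M (lower_unip t) * \<theta> * ract M (lower_unip (-t)))) {t. t ^ q = t}"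
    using rc \<theta> by (intro mult_mat_sum[OF A'(1)] mult_carrier_mat)
  also have "\<dots> = mat_sum ?n ?n (\<lambda>t. ract M (lower_unip t) * (A' * \<theta>) * ract M (lower_unip (-t))) {t. t ^ q = t}"
  proof (rule mat_sum_cong[OF refl])
    fix t :: 'a
    have "A' * (ract M (lower_unip t) * \<theta> * ract M (lower_unip (-t))) =
      (A' * ract M (lower_unip t)) * (\<theta> * ract M (lower_unip (-t)))"
      by (simp add: mat_assoc dims carrier_matD[OF rc])
    also have "A' * ract M (lower_unip t) = ract M (lower_unip t) * A'" using A'(3) by simp
    finally show "A' * (ract M (lower_unip t) * \<theta> * ract M (lower_unip (-t))) =
      ract M (lower_unip t) * (A' * \<theta>) * ract M (lower_unip (-t))"
      by (simp add: mat_assoc dims carrier_matD[OF rc])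
  qed
  finally show ?thesis unfolding unipotent_projective_def using A'(1) \<theta> by (intro bexI[of _ "A' * \<theta>"]) auto
qed

text \<open>The linear map from E to M that sends the first basis vector to v and the second to w;
  the order matches the weights (1, 0) and (0, 1) of E.\<close>

definition two_cols :: "nat \<Rightarrow> 'a vec \<Rightarrow> 'a vec \<Rightarrow> 'a mat" where
  "two_cols n v w = mat n 2 (\<lambda>(i, j). if j = 0 then v $ i else w $ i)"

lemma two_cols_carrier [simp]: "two_cols n v w \<in> carrier_mat n 2"
  by (simp add: two_cols_def)

text \<open>An upper triangular matrix is U(b/d) times its diagonal. The scalar \<open>c\<close> is
  1 for a vector that is raised to v and 0 for a vector fixed by the upper unipotents.\<close>

lemma borel_act_weight_vector:
  fixes M :: "'a::field gl2_rep"
  assumes M: "polynomial_module M" and w: "w \<in> weight_space M (a', b')" and v: "v \<in> rspace M"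
    and U: "\<And>z. ract M (upper_unip z) *\<^sub>v w = w + (z * c) \<cdot>\<^sub>v v" and ad: "a \<noteq> 0" "d \<noteq> 0"
  shows "ract M (mat2 a b 0 d) *\<^sub>v w = (a ^ a' * d ^ b') \<cdot>\<^sub>v (w + (b / d * c) \<cdot>\<^sub>v v)"
proof -
  have wc: "w \<in> rspace M" using w by (simp add: weight_space_iff)
  have "mat2 a b 0 d = upper_unip (b / d) * mat2 a 0 0 d" using ad by (simp add: mat2_mult)
  hence "ract M (mat2 a b 0 d) *\<^sub>v w = ract M (upper_unip (b / d)) *\<^sub>v ((a ^ a' * d ^ b') \<cdot>\<^sub>v w)"
    using ad w wc by (simp add: ract_mult_vec[OF M] weight_space_iff)
  also have "\<dots> = (a ^ a' * d ^ b') \<cdot>\<^sub>v (ract M (upper_unip (b / d)) *\<^sub>v w)"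
    by (rule mult_mat_vec[OF ract_carrier[OF M] wc]) simp
  finally show ?thesis by (simp add: U)
qed

text \<open>On v and w the Borel acts as on E, twisted by the character a^e: the weights are (e, 0)
  + (1, 0) and (e, 0) + (0, 1), and w is raised to v just as the second basis vector of E is raised
  to the first.\<close>

lemma two_cols_eigenvector:
  fixes M :: "'a::field gl2_rep"
  assumes M: "polynomial_module M" and w: "w \<in> weight_space M (e, 1)" and v: "v \<in> weight_space M (Suc e, 0)"
    and Uw: "\<And>z. ract M (upper_unip z) *\<^sub>v w = w + z \<cdot>\<^sub>v v" and Uv: "\<And>z. ract M (upper_unip z) *\<^sub>v v = v"
    and ad: "a \<noteq> 0" "d \<noteq> 0"
  shows "ract M (mat2 a b 0 d) * two_cols (rdim M) v w =
    a ^ e \<cdot>\<^sub>m (two_cols (rdim M) v w * ract natural_module (mat2 a b 0 d))"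
proof -
  let ?n = "rdim M" and ?B = "mat2 a b 0 d"
  have Bc: "ract M ?B \<in> carrier_mat ?n ?n" using ad by (intro ract_carrier[OF M]) simp
  have wc: "w \<in> rspace M" and vc: "v \<in> rspace M" using w v by (simp_all add: weight_space_iff)
  have Bw: "ract M ?B *\<^sub>v w = (a ^ e * d) \<cdot>\<^sub>v (w + (b / d) \<cdot>\<^sub>v v)"
    using borel_act_weight_vector[OF M w vc, of 1 a d b] Uw ad by simp
  have Uv0: "ract M (upper_unip z) *\<^sub>v v = v + (z * 0) \<cdot>\<^sub>v v" for z unfolding Uv using vc by (intro eq_vecI) auto
  have Bv: "ract M ?B *\<^sub>v v = a ^ Suc e \<cdot>\<^sub>v v"
    using borel_act_weight_vector[OF M v vc, of 0 a d b] Uv0 ad vc by (auto intro!: eq_vecI)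
  show ?thesis
  proof (rule eq_matI)
    fix i j assume "i < dim_row (a ^ e \<cdot>\<^sub>m (two_cols ?n v w * ract natural_module ?B))"
      "j < dim_col (a ^ e \<cdot>\<^sub>m (two_cols ?n v w * ract natural_module ?B))"
    hence i: "i < ?n" and j: "j = 0 \<or> j = 1" by (auto simp: natural_module_def two_cols_def)
    have col: "col (two_cols ?n v w) 0 = v" "col (two_cols ?n v w) (Suc 0) = w"
      using vc wc by (auto simp: two_cols_def)
    have "(ract M ?B * two_cols ?n v w) $$ (i, j) = (ract M ?B *\<^sub>v col (two_cols ?n v w) j) $ i"
      using i j Bc by (auto simp: two_cols_def)
    also have "\<dots> = a ^ e * (two_cols ?n v w * ?B) $$ (i, j)"
      using j
    proof
      assume j: "j = 0"
      have "(two_cols ?n v w * ?B) $$ (i, 0) = v $ i * a"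
        using i by (subst mult_index_sum[of _ ?n 2 _ 2]) (auto simp: two_cols_def numeral_2_eq_2)
      thus ?thesis using i vc by (simp add: j col Bv)
    next
      assume j: "j = 1"
      have "(two_cols ?n v w * ?B) $$ (i, 1) = v $ i * b + w $ i * d"
        using i by (subst mult_index_sum[of _ ?n 2 _ 2]) (auto simp: two_cols_def numeral_2_eq_2)
      thus ?thesis using i vc wc ad by (simp add: j col Bw field_simps)
    qed
    finally show "(ract M ?B * two_cols ?n v w) $$ (i, j) =
      (a ^ e \<cdot>\<^sub>m (two_cols ?n v w * ract natural_module ?B)) $$ (i, j)"
      using i j by (auto simp: natural_module_def two_cols_def)
  qed (use Bc in \<open>auto simp: natural_module_def two_cols_def\<close>)
qed

text \<open>\<open>T(q)\<close> is a summand of \<open>St \<otimes> E\<close>.\<close>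
lemma tilting_unipotent_projective:
  fixes M :: "'a::alg_closed_field gl2_rep"
  assumes P: "is_P (q, 0) M" and q: "CHAR('a) = p" "p > 0" "q = p ^ s" "q > 1"
  shows "unipotent_projective q M"
proof -
  let ?n = "rdim M"
  obtain e where e: "q = Suc e" using q(4) by (cases q) auto
  have M: "polynomial_module M" and indec: "indecomposable M" and hw: "highest_weight M (Suc e, 0)"
    and filt: "has_filtration (\<lambda>N. \<exists>m. \<exists>l\<in>Lambda_plus m. is_Weyl l N) M"
      "has_filtration (\<lambda>N. \<exists>m. \<exists>l\<in>Lambda_plus m. is_dual_Weyl l N) M"
    using P unfolding is_P_def tilting_def e by auto
  note M' = polynomial_module_contravariant_dual[OF M]
  obtain Q where Q: "torus_split M (Suc e) 0 Q" "torus_split (contravariant_dual M) (Suc e) 0 (\<lambda>a. transpose_mat (Q a))"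
    by (rule torus_split_exists[OF M hw]) simp
  obtain v0 where v0: "v0 \<in> weight_space M (Suc e, 0)" "v0 \<noteq> 0\<^sub>v ?n"
    using hw unfolding highest_weight_def is_weight_def by blast
  obtain w v where w: "w \<in> weight_space M (e, 1)" and v: "v \<in> weight_space M (Suc e, 0)" "v \<noteq> 0\<^sub>v ?n"
    and Uw: "\<And>z. ract M (upper_unip z) *\<^sub>v w = w + z \<cdot>\<^sub>v v"
    using dual_Weyl_filtration_raising[OF M Q(1) filt(2) v0] by metis
  \<comment> \<open>The functional is built for the vector \<open>v\<close> found by raising and not
    for \<open>v0\<close>, because one vector has to serve in \<open>V\<close> and in the
    nonvanishing pairing.\<close>
  obtain w' v' where w': "w' \<in> weight_space (contravariant_dual M) (e, 1)"
    and v': "v' \<in> weight_space (contravariant_dual M) (Suc e, 0)" "v' \<bullet> v \<noteq> 0"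
    and Uw': "\<And>z. ract (contravariant_dual M) (upper_unip z) *\<^sub>v w' = w' + z \<cdot>\<^sub>v v'"
    using Weyl_filtration_lowering[OF M Q(2) filt(1) v] by metis
  have vc: "v \<in> rspace M" "v' \<in> rspace M" "w \<in> rspace M" "w' \<in> rspace M"
    using v v' w w' by (simp_all add: weight_space_iff)
  define V V' where "V = two_cols ?n v w" and "V' = two_cols ?n v' w'"
  \<comment> \<open>\<open>w'\<close> and \<open>v\<close> have different weights, so
    \<open>v\<close> goes to a multiple of the first basis vector of E, which the upper unipotents
    fix and \<open>V\<close> sends back to a multiple of \<open>v\<close>.\<close>
  have \<Phi>v: "transpose_mat V' *\<^sub>v v = vec 2 (\<lambda>i. if i = 0 then v' \<bullet> v else 0)"
  proof (rule eq_vecI)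
    fix i assume "i < dim_vec (vec 2 (\<lambda>i. if i = 0 then v' \<bullet> v else 0))"
    hence i: "i = 0 \<or> i = 1" by auto
    have "col V' 0 = v'" "col V' (Suc 0) = w'" using vc by (auto simp: V'_def two_cols_def)
    moreover have "w' \<bullet> v = 0" by (rule weight_spaces_orthogonal[OF M w' v(1)]) simp
    ultimately show "(transpose_mat V' *\<^sub>v v) $ i = vec 2 (\<lambda>i. if i = 0 then v' \<bullet> v else 0) $ i"
      using i by (auto simp: V'_def two_cols_def)
  qed (simp add: V'_def two_cols_def)
  show ?thesis
  proof (rule unipotent_projective_criterion[OF M indec polynomial_module_natural q])
    show "e = q - 1" by (simp add: e)
    show "V \<in> carrier_mat ?n (rdim (natural_module :: 'a gl2_rep))" "V' \<in> carrier_mat ?n (rdim (natural_module :: 'a gl2_rep))"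
      by (simp_all add: V_def V'_def natural_module_def)
    show "ract M (mat2 a b 0 d) * V = a ^ e \<cdot>\<^sub>m (V * ract natural_module (mat2 a b 0 d))"
      if "a \<noteq> 0" "d \<noteq> 0" for a b d
      unfolding V_def by (rule two_cols_eigenvector[OF M w v(1) Uw highest_weight_vector_fixed[OF M Q(1) v(1)] that])
    show "ract (contravariant_dual M) (mat2 a b 0 d) * V' = a ^ e \<cdot>\<^sub>m (V' * ract natural_module (mat2 a b 0 d))"
      if "a \<noteq> 0" "d \<noteq> 0" for a b d
      using two_cols_eigenvector[OF M' w' v'(1) Uw' highest_weight_vector_fixed[OF M' Q(2) v'(1)] that]
      by (simp add: V'_def)
    show "transpose_mat (ract natural_module g) = ract natural_module (transpose_mat g)" for g :: "'a mat"
      by (simp add: natural_module_def)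
    show "v \<in> rspace M" "v \<noteq> 0\<^sub>v ?n" by fact+
    show "ract M (upper_unip z) *\<^sub>v v = v" for z by (rule highest_weight_vector_fixed[OF M Q(1) v(1)])
    show "ract natural_module (upper_unip z) *\<^sub>v (transpose_mat V' *\<^sub>v v) = transpose_mat V' *\<^sub>v v" for z
      unfolding \<Phi>v natural_module_def
      by (rule eq_vecI) (auto simp: less_2_cases_iff scalar_prod_def numeral_2_eq_2 mat2_def)
    show "V *\<^sub>v (transpose_mat V' *\<^sub>v v) = (v' \<bullet> v) \<cdot>\<^sub>v v"
      unfolding \<Phi>v V_def using vc
      by (intro eq_vecI) (auto simp: two_cols_def scalar_prod_def numeral_2_eq_2)
    show "v' \<bullet> v \<noteq> 0" by fact
  qed
qed

section \<open>The Steinberg case, with the trivial module in place of E\<close>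

definition one_col :: "nat \<Rightarrow> 'a vec \<Rightarrow> 'a mat" where
  "one_col n v = mat n 1 (\<lambda>(i, j). v $ i)"

lemma one_col_eigenvector:
  fixes M :: "'a::field gl2_rep"
  assumes M: "polynomial_module M" and v: "v \<in> weight_space M (e, 0)"
    and Uv: "\<And>z. ract M (upper_unip z) *\<^sub>v v = v" and ad: "a \<noteq> 0" "d \<noteq> 0"
  shows "ract M (mat2 a b 0 d) * one_col (rdim M) v =
    a ^ e \<cdot>\<^sub>m (one_col (rdim M) v * ract trivial_module (mat2 a b 0 d))"
proof -
  let ?n = "rdim M" and ?B = "mat2 a b 0 d"
  have Bc: "ract M ?B \<in> carrier_mat ?n ?n" using ad by (intro ract_carrier[OF M]) simp
  have vc: "v \<in> rspace M" using v by (simp add: weight_space_iff)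
  have Uv0: "ract M (upper_unip z) *\<^sub>v v = v + (z * 0) \<cdot>\<^sub>v v" for z unfolding Uv using vc by (intro eq_vecI) auto
  have Bv: "ract M ?B *\<^sub>v v = a ^ e \<cdot>\<^sub>v v"
    using borel_act_weight_vector[OF M v vc, of 0 a d b] Uv0 ad vc by (auto intro!: eq_vecI)
  have one: "one_col ?n v * ract trivial_module ?B = one_col ?n v"
    by (simp add: trivial_module_def one_col_def)
  show ?thesis unfolding one
  proof (rule eq_matI)
    fix i j assume "i < dim_row (a ^ e \<cdot>\<^sub>m one_col ?n v)" "j < dim_col (a ^ e \<cdot>\<^sub>m one_col ?n v)"
    hence ij: "i < ?n" "j = 0" by (auto simp: one_col_def)
    have "col (one_col ?n v) 0 = v" using vc by (auto simp: one_col_def)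
    hence "(ract M ?B * one_col ?n v) $$ (i, j) = (ract M ?B *\<^sub>v v) $ i"
      using ij Bc by (auto simp: one_col_def)
    thus "(ract M ?B * one_col ?n v) $$ (i, j) = (a ^ e \<cdot>\<^sub>m one_col ?n v) $$ (i, j)"
      using ij vc by (simp add: Bv one_col_def)
  qed (use Bc in \<open>auto simp: one_col_def\<close>)
qed

text \<open>A highest weight vector spans a line on which the Borel acts by a^(q - 1), which is all
  that a map from St to M needs.\<close>

lemma steinberg_unipotent_projective:
  fixes M :: "'a::alg_closed_field gl2_rep"
  assumes P: "is_P (e, 0) M" and q: "CHAR('a) = p" "p > 0" "q = p ^ s" "q > 1" "e = q - 1"
  shows "unipotent_projective q M"
proof -
  let ?n = "rdim M"
  have M: "polynomial_module M" and indec: "indecomposable M" and hw: "highest_weight M (e, 0)"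
    using P unfolding is_P_def tilting_def by auto
  note M' = polynomial_module_contravariant_dual[OF M]
  obtain Q where Q: "torus_split M e 0 Q" "torus_split (contravariant_dual M) e 0 (\<lambda>a. transpose_mat (Q a))"
    by (rule torus_split_exists[OF M hw]) simp
  obtain v where v: "v \<in> weight_space M (e, 0)" "v \<noteq> 0\<^sub>v ?n"
    using hw unfolding highest_weight_def is_weight_def by blast
  have vc: "v \<in> rspace M" using v(1) by (simp add: weight_space_iff)
  then obtain i where i: "i < ?n" "v $ i \<noteq> 0" using v(2) by (metis carrier_vecD eq_vecI index_zero_vec)
  obtain S c where S: "finite S" "0 \<notin> S"
    and c: "\<And>b. b \<le> e \<Longrightarrow> (\<Sum>s\<in>S. c s * s ^ b) = (if b = e then 1 else (0::'a))"
    using lagrange_coefficients[of e e] by auto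
  \<comment> \<open>A coordinate functional that is nonzero on \<open>v\<close>, projected to the
    highest weight; by adjointness the projection does not change its value on
    \<open>v\<close>.\<close>
  define v' where "v' = torus_comb (contravariant_dual M) S c (unit_vec ?n i)"
  have v': "v' \<in> weight_space (contravariant_dual M) (e, 0)"
    using torus_comb_in_weight_space[OF M' Q(2) S(2), of "unit_vec ?n i" e c] c by (simp add: v'_def)
  have v'c: "v' \<in> rspace M" using v' by (simp add: weight_space_iff)
  have "v' \<bullet> v = unit_vec ?n i \<bullet> torus_comb M S c v"
    unfolding v'_def by (rule torus_comb_adjoint[OF M S(2) vc]) simp
  also have "torus_comb M S c v = v" by (rule torus_comb_weight_vector[OF M S(2) v(1)]) (simp add: c)
  also have "unit_vec ?n i \<bullet> v = v $ i" using i vc by simp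
  finally have v'v: "v' \<bullet> v \<noteq> 0" using i(2) by simp
  define V V' where "V = one_col ?n v" and "V' = one_col ?n v'"
  have \<Phi>v: "transpose_mat V' *\<^sub>v v = vec 1 (\<lambda>i. v' \<bullet> v)"
  proof (rule eq_vecI)
    have "col V' 0 = v'" using v'c by (auto simp: V'_def one_col_def)
    thus "(transpose_mat V' *\<^sub>v v) $ i = vec 1 (\<lambda>i. v' \<bullet> v) $ i" if "i < dim_vec (vec 1 (\<lambda>i. v' \<bullet> v))" for i
      using that by (simp add: V'_def one_col_def)
  qed (simp add: V'_def one_col_def)
  show ?thesis
  proof (rule unipotent_projective_criterion[OF M indec polynomial_module_trivial q])
    show "V \<in> carrier_mat ?n (rdim (trivial_module :: 'a gl2_rep))" "V' \<in> carrier_mat ?n (rdim (trivial_module :: 'a gl2_rep))"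
      by (simp_all add: V_def V'_def one_col_def trivial_module_def)
    show "ract M (mat2 a b 0 d) * V = a ^ e \<cdot>\<^sub>m (V * ract trivial_module (mat2 a b 0 d))"
      if "a \<noteq> 0" "d \<noteq> 0" for a b d
      unfolding V_def by (rule one_col_eigenvector[OF M v(1) highest_weight_vector_fixed[OF M Q(1) v(1)] that])
    show "ract (contravariant_dual M) (mat2 a b 0 d) * V' = a ^ e \<cdot>\<^sub>m (V' * ract trivial_module (mat2 a b 0 d))"
      if "a \<noteq> 0" "d \<noteq> 0" for a b d
      using one_col_eigenvector[OF M' v' highest_weight_vector_fixed[OF M' Q(2) v'] that]
      by (simp add: V'_def)
    show "transpose_mat (ract trivial_module g) = ract trivial_module (transpose_mat g)" for g :: "'a mat"
      by (simp add: trivial_module_def)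
    show "v \<in> rspace M" "v \<noteq> 0\<^sub>v ?n" by fact+
    show "ract M (upper_unip z) *\<^sub>v v = v" for z by (rule highest_weight_vector_fixed[OF M Q(1) v(1)])
    show "ract trivial_module (upper_unip z) *\<^sub>v (transpose_mat V' *\<^sub>v v) = transpose_mat V' *\<^sub>v v" for z
      unfolding \<Phi>v trivial_module_def by simp
    show "V *\<^sub>v (transpose_mat V' *\<^sub>v v) = (v' \<bullet> v) \<cdot>\<^sub>v v"
      unfolding \<Phi>v V_def using vc by (intro eq_vecI) (auto simp: one_col_def scalar_prod_def)
    show "v' \<bullet> v \<noteq> 0" by fact
  qed
qed

section \<open>Tensor products and summands\<close>

lemma sum_div_mod:
  fixes f :: "nat \<Rightarrow> nat \<Rightarrow> 'a::comm_monoid_add"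
  shows "(\<Sum>l<a * b. f (l div b) (l mod b)) = (\<Sum>i<a. \<Sum>j<b. f i j)"
proof -
  have "(\<Sum>l<a * b. f (l div b) (l mod b)) = (\<Sum>i<a. \<Sum>l = i * b..<i * b + b. f (l div b) (l mod b))"
    by (rule sum.nat_group[symmetric])
  also have "\<dots> = (\<Sum>i<a. \<Sum>j<b. f i j)"
  proof (rule sum.cong[OF refl])
    fix i
    have "(\<Sum>l = i * b..<i * b + b. f (l div b) (l mod b)) =
      (\<Sum>j = 0..<b. f ((j + i * b) div b) ((j + i * b) mod b))"
      using sum.shift_bounds_nat_ivl[of "\<lambda>l. f (l div b) (l mod b)" 0 "i * b" b] by (simp add: add.commute)
    also have "\<dots> = (\<Sum>j<b. f i j)" unfolding atLeast0LessThan by (rule sum.cong) auto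
    finally show "(\<Sum>l = i * b..<i * b + b. f (l div b) (l mod b)) = (\<Sum>j<b. f i j)" .
  qed
  finally show ?thesis .
qed

lemma kronecker_dim [simp]:
  "dim_row (kronecker A B) = dim_row A * dim_row B" "dim_col (kronecker A B) = dim_col A * dim_col B"
  by (simp_all add: kronecker_def)

lemma kronecker_index:
  assumes "i < dim_row A * dim_row B" "j < dim_col A * dim_col B"
  shows "kronecker A B $$ (i, j) = A $$ (i div dim_row B, j div dim_col B) * B $$ (i mod dim_row B, j mod dim_col B)"
  using assms by (simp add: kronecker_def)

lemma div_mod_less:
  assumes "i < m * (n::nat)"
  shows "i div n < m" "i mod n < n"
proof -
  have "n > 0" using assms by (cases n) auto
  thus "i div n < m" "i mod n < n" using assms by (simp_all add: less_mult_imp_div_less)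
qed

lemma kronecker_mult:
  fixes A :: "'a::comm_ring_1 mat"
  assumes "dim_col A = dim_row A'" "dim_col B = dim_row B'"
  shows "kronecker A B * kronecker A' B' = kronecker (A * A') (B * B')"
proof (rule eq_matI)
  fix i j assume "i < dim_row (kronecker (A * A') (B * B'))" "j < dim_col (kronecker (A * A') (B * B'))"
  hence i: "i < dim_row A * dim_row B" and j: "j < dim_col A' * dim_col B'" by simp_all
  note id = div_mod_less[OF i] and jd = div_mod_less[OF j]
  let ?f = "\<lambda>a b. (A $$ (i div dim_row B, a) * A' $$ (a, j div dim_col B')) *
    (B $$ (i mod dim_row B, b) * B' $$ (b, j mod dim_col B'))"
  have "(kronecker A B * kronecker A' B') $$ (i, j) =
    (\<Sum>l<dim_row A' * dim_row B'. kronecker A B $$ (i, l) * kronecker A' B' $$ (l, j))"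
    by (rule mult_index_sum[OF _ _ i j]) (use assms in \<open>auto intro!: carrier_matI\<close>)
  also have "\<dots> = (\<Sum>l<dim_row A' * dim_row B'. ?f (l div dim_row B') (l mod dim_row B'))"
    using i j assms by (intro sum.cong) (auto simp: kronecker_index mult_ac)
  also have "\<dots> = (\<Sum>a<dim_row A'. \<Sum>b<dim_row B'. ?f a b)" by (rule sum_div_mod)
  also have "\<dots> = (A * A') $$ (i div dim_row B, j div dim_col B') * (B * B') $$ (i mod dim_row B, j mod dim_col B')"
    using id jd assms by (simp add: scalar_prod_def sum_product atLeast0LessThan)
  finally show "(kronecker A B * kronecker A' B') $$ (i, j) = kronecker (A * A') (B * B') $$ (i, j)"
    using i j by (simp add: kronecker_index)
qed (use assms in auto)

lemma kronecker_one: "kronecker (1\<^sub>m m) (1\<^sub>m n) = (1\<^sub>m (m * n) :: 'a::semiring_1 mat)"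
proof (rule eq_matI)
  fix i j assume "i < dim_row (1\<^sub>m (m * n) :: 'a mat)" "j < dim_col (1\<^sub>m (m * n) :: 'a mat)"
  hence ij: "i < m * n" "j < m * n" by simp_all
  note d = div_mod_less[OF ij(1)] div_mod_less[OF ij(2)]
  have "(i div n = j div n \<and> i mod n = j mod n) = (i = j)" by (metis div_mult_mod_eq)
  thus "kronecker (1\<^sub>m m) (1\<^sub>m n) $$ (i, j) = (1\<^sub>m (m * n) :: 'a mat) $$ (i, j)"
    using ij d by (auto simp: kronecker_index)
qed auto

text \<open>Relative traces involve the group action alone, so tensor products and tensor powers are
  handled as representations of the abstract group.\<close>

definition group_rep :: "'a::field gl2_rep \<Rightarrow> bool" where
  "group_rep M \<longleftrightarrow> (\<forall>g\<in>GL2. ract M g \<in> carrier_mat (rdim M) (rdim M)) \<and> ract M (1\<^sub>m 2) = 1\<^sub>m (rdim M) \<and>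
     (\<forall>g\<in>GL2. \<forall>h\<in>GL2. ract M (g * h) = ract M g * ract M h)"

lemma polynomial_module_group_rep: "polynomial_module M \<Longrightarrow> group_rep M"
  by (simp add: polynomial_module_def group_rep_def)

lemma group_rep_tensor:
  assumes "group_rep M" "group_rep N"
  shows "group_rep (tensor M N)"
proof -
  have dims: "dim_row (ract R g) = rdim R" "dim_col (ract R g) = rdim R"
    if "group_rep R" "g \<in> GL2" for R and g :: "'a mat"
    using that by (auto simp: group_rep_def)
  show ?thesis
    using assms dims[OF assms(1)] dims[OF assms(2)] unfolding group_rep_def tensor_def
    by (auto simp: kronecker_one kronecker_mult intro!: carrier_matI)
qed

lemma group_rep_tensor_power: "group_rep M \<Longrightarrow> group_rep (tensor_power M k)"
  by (induction k) (auto intro: group_rep_tensor polynomial_module_group_rep[OF polynomial_module_trivial])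

text \<open>Conjugating \<open>\<theta>\<close> (x) 1 by L(t) (x) L(t) changes the first factor
  only, so these conjugates sum to the Kronecker product of two identities.\<close>

lemma unipotent_projective_tensor:
  fixes M X :: "'a::field gl2_rep"
  assumes M: "group_rep M" "unipotent_projective q M" and X: "group_rep X"
  shows "unipotent_projective q (tensor M X)"
proof -
  let ?F = "{t::'a. t ^ q = t}"
  obtain \<theta> where \<theta>: "\<theta> \<in> carrier_mat (rdim M) (rdim M)" and tr: "1\<^sub>m (rdim M) =
    mat_sum (rdim M) (rdim M) (\<lambda>t. ract M (lower_unip t) * \<theta> * ract M (lower_unip (-t))) ?F"
    using M(2) unfolding unipotent_projective_def by blast
  define Y where "Y t = ract M (lower_unip t) * \<theta> * ract M (lower_unip (-t))" for t
  have rc: "ract M (lower_unip t) \<in> carrier_mat (rdim M) (rdim M)"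
    "ract X (lower_unip t) \<in> carrier_mat (rdim X) (rdim X)" for t
    using M(1) X unfolding group_rep_def by simp_all
  note dims = carrier_matD[OF rc(1)] carrier_matD[OF rc(2)] carrier_matD[OF \<theta>]
  have Y: "dim_row (Y t) = rdim M" "dim_col (Y t) = rdim M" for t by (simp_all add: Y_def dims)
  have XX: "ract X (lower_unip t) * ract X (lower_unip (-t)) = 1\<^sub>m (rdim X)" for t
  proof -
    have "ract X (lower_unip t) * ract X (lower_unip (-t)) = ract X (lower_unip t * lower_unip (-t))"
      using X unfolding group_rep_def by (metis diff_zero mat2_in_GL2 mult_1 mult_zero_left one_neq_zero)
    thus ?thesis using X unfolding group_rep_def by (simp add: mat2_mult mat2_one)
  qed
  have summand: "ract (tensor M X) (lower_unip t) * kronecker \<theta> (1\<^sub>m (rdim X)) * ract (tensor M X) (lower_unip (-t)) =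
    kronecker (Y t) (1\<^sub>m (rdim X))" for t
    by (simp add: tensor_def kronecker_mult dims XX Y_def right_mult_one_mat[OF rc(2)])
  have "1\<^sub>m (rdim (tensor M X)) = mat_sum (rdim (tensor M X)) (rdim (tensor M X))
    (\<lambda>t. kronecker (Y t) (1\<^sub>m (rdim X))) ?F"
  proof (rule eq_matI)
    fix i j assume "i < dim_row (mat_sum (rdim (tensor M X)) (rdim (tensor M X)) (\<lambda>t. kronecker (Y t) (1\<^sub>m (rdim X))) ?F)"
      "j < dim_col (mat_sum (rdim (tensor M X)) (rdim (tensor M X)) (\<lambda>t. kronecker (Y t) (1\<^sub>m (rdim X))) ?F)"
    hence ij: "i < rdim M * rdim X" "j < rdim M * rdim X" by (simp_all add: tensor_def)
    note d = div_mod_less[OF ij(1)] div_mod_less[OF ij(2)]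
    have "mat_sum (rdim (tensor M X)) (rdim (tensor M X)) (\<lambda>t. kronecker (Y t) (1\<^sub>m (rdim X))) ?F $$ (i, j) =
      (\<Sum>t\<in>?F. Y t $$ (i div rdim X, j div rdim X)) * (1\<^sub>m (rdim X) :: 'a mat) $$ (i mod rdim X, j mod rdim X)"
      using ij d by (simp add: tensor_def kronecker_index Y)
    also have "(\<Sum>t\<in>?F. Y t $$ (i div rdim X, j div rdim X)) = (1\<^sub>m (rdim M) :: 'a mat) $$ (i div rdim X, j div rdim X)"
      using d unfolding tr by (simp add: Y_def)
    also have "(1\<^sub>m (rdim M) :: 'a mat) $$ (i div rdim X, j div rdim X) * (1\<^sub>m (rdim X) :: 'a mat) $$ (i mod rdim X, j mod rdim X) =
      kronecker (1\<^sub>m (rdim M)) (1\<^sub>m (rdim X)) $$ (i, j)"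
      using ij by (simp add: kronecker_index)
    finally show "(1\<^sub>m (rdim (tensor M X)) :: 'a mat) $$ (i, j) =
      mat_sum (rdim (tensor M X)) (rdim (tensor M X)) (\<lambda>t. kronecker (Y t) (1\<^sub>m (rdim X))) ?F $$ (i, j)"
      by (simp add: tensor_def kronecker_one)
  qed (simp_all add: tensor_def)
  thus ?thesis unfolding unipotent_projective_def summand[symmetric]
    using \<theta> by (intro bexI[of _ "kronecker \<theta> (1\<^sub>m (rdim X))"]) (auto simp: tensor_def intro!: carrier_matI)
qed

text \<open>
  The norm \<open>\<Sum>\<^sub>t \<rho>(L t)\<close> over the finite field of \<open>q\<close> elements kills \<open>N\<close>, since the entries of \<open>\<rho>(L t)\<close> have
  degree less than \<open>q - 1\<close>; on a relatively projective module every fixed vector is a norm.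
\<close>
lemma no_summand_of_unipotent_projective:
  fixes M N :: "'a::alg_closed_field gl2_rep"
  assumes M: "group_rep M" "unipotent_projective q M"
    and N: "polynomial_module N" "highest_weight N (l1, l2)" "l2 \<le> l1" and d: "l1 - l2 < q - 1"
    and q: "q > 1" "(of_nat q :: 'a) = 0"
  shows "\<not> has_summand M N"
proof
  assume "has_summand M N"
  then obtain R T where R: "polynomial_module R" and dim: "rdim M = rdim (direct_sum N R)"
    and T: "T \<in> carrier_mat (rdim (direct_sum N R)) (rdim M)" "invertible_mat T"
    and TM: "\<forall>g\<in>GL2. T * ract M g = ract (direct_sum N R) g * T"
    unfolding has_summand_def rep_iso_def by blast
  let ?m = "rdim M" and ?n = "rdim N" and ?F = "{t::'a. t ^ q = t}"
  have m: "?m = ?n + rdim R" using dim by (simp add: direct_sum_def)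
  have Tc: "T \<in> carrier_mat ?m ?m" using T(1) dim by simp
  obtain T0 where T0: "T * T0 = 1\<^sub>m (dim_row T)" "T0 * T = 1\<^sub>m (dim_row T0)"
    using T(2) unfolding invertible_mat_def inverts_mat_def by blast
  \<comment> \<open>\<open>invertible_mat\<close> provides an inverse of unspecified shape; its
    dimensions are read off the two products.\<close>
  have T0c: "T0 \<in> carrier_mat ?m ?m"
  proof (rule carrier_matI)
    show "dim_col T0 = ?m" using arg_cong[OF T0(1), of dim_col] Tc by simp
    show "dim_row T0 = ?m" using arg_cong[OF T0(2), of dim_col] Tc by simp
  qed
  have inv: "T * T0 = 1\<^sub>m ?m" "T0 * T = 1\<^sub>m ?m" using T0 Tc T0c by simp_all
  obtain \<theta> where \<theta>: "\<theta> \<in> carrier_mat ?m ?m"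
    and tr: "1\<^sub>m ?m = mat_sum ?m ?m (\<lambda>t. ract M (lower_unip t) * \<theta> * ract M (lower_unip (-t))) ?F"
    using M(2) unfolding unipotent_projective_def by blast
  have rc: "ract M (lower_unip t) \<in> carrier_mat ?m ?m" for t using M(1) by (simp add: group_rep_def)
  define D where "D t = ract (direct_sum N R) (lower_unip t)" for t
  have Dc: "D t \<in> carrier_mat ?m ?m" for t
  proof -
    have "ract N (lower_unip t) \<in> carrier_mat ?n ?n" "ract R (lower_unip t) \<in> carrier_mat (rdim R) (rdim R)"
      by (simp_all add: ract_carrier[OF N(1)] ract_carrier[OF R])
    thus ?thesis by (simp add: D_def direct_sum_def m)
  qed
  note dims = carrier_matD[OF rc] carrier_matD[OF Dc] carrier_matD[OF Tc] carrier_matD[OF T0c] carrier_matD[OF \<theta>]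
  have TD: "T * ract M (lower_unip t) = D t * T" for t using TM by (simp add: D_def)
  have DT: "ract M (lower_unip t) * T0 = T0 * D t" for t
  proof -
    have "ract M (lower_unip t) * T0 = (T0 * T) * (ract M (lower_unip t) * T0)"
      by (simp add: inv dims)
    also have "\<dots> = T0 * ((T * ract M (lower_unip t)) * T0)" by (simp add: mat_assoc dims)
    also have "\<dots> = T0 * (D t * (T * T0))" unfolding TD by (simp add: mat_assoc dims)
    finally show ?thesis by (simp add: inv dims)
  qed
  define \<theta>' where "\<theta>' = T * \<theta> * T0"
  have \<theta>': "\<theta>' \<in> carrier_mat ?m ?m" using Tc T0c \<theta> by (simp add: \<theta>'_def)
  have conj: "T * (ract M (lower_unip t) * \<theta> * ract M (lower_unip (-t))) * T0 = D t * (\<theta>' * D (-t))" for t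
  proof -
    have "T * (ract M (lower_unip t) * \<theta> * ract M (lower_unip (-t))) * T0 =
      (T * ract M (lower_unip t)) * (\<theta> * (ract M (lower_unip (-t)) * T0))" by (simp add: mat_assoc dims)
    thus ?thesis unfolding TD DT by (simp add: mat_assoc dims \<theta>'_def)
  qed
  have "1\<^sub>m ?m = T * 1\<^sub>m ?m * T0" using Tc by (simp add: inv)
  also have "\<dots> = mat_sum ?m ?m (\<lambda>t. T * (ract M (lower_unip t) * \<theta> * ract M (lower_unip (-t))) * T0) ?F"
    unfolding tr using rc \<theta> Tc T0c
    by (subst mult_mat_sum[OF Tc]) (auto intro!: mat_sum_mult[OF T0c] mult_carrier_mat[of _ ?m ?m])
  finally have trD: "1\<^sub>m ?m = mat_sum ?m ?m (\<lambda>t. D t * (\<theta>' * D (-t))) ?F" by (simp only: conj)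
  obtain Q where "torus_split N l1 l2 Q" by (rule torus_split_exists[OF N])
  note Q = this
  obtain x where x: "x \<in> rspace N" "x \<noteq> 0\<^sub>v ?n" "\<And>z. ract N (lower_unip z) *\<^sub>v x = x"
    by (rule lower_unip_fixed_vector[OF N(1,2) Q]) (rule that)
  have norm: "(\<Sum>t\<in>?F. ract N (lower_unip t) $$ (i, j)) = 0" if ij: "i < ?n" "j < ?n" for i j
  proof -
    obtain c where c: "\<And>z. ract N (lower_unip z) $$ (i, j) = (\<Sum>k\<le>l1 - l2. z ^ k * c k)"
      using lower_unip_degree[OF N(1) Q ij] by blast
    have "(\<Sum>t\<in>?F. ract N (lower_unip t) $$ (i, j)) = (\<Sum>k\<le>l1 - l2. (\<Sum>t\<in>?F. t ^ k) * c k)"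
      unfolding c by (subst sum.swap) (simp add: sum_distrib_right)
    \<comment> \<open>All exponents stay strictly below q - 1, the first one with a nonzero power
      sum.\<close>
    also have "\<dots> = 0"
      using d by (intro sum.neutral) (auto simp: sum_powers_fixed_points[OF q])
    finally show ?thesis .
  qed
  \<comment> \<open>The fixed vector of N, padded with zeros, is a fixed vector of the direct
    sum.\<close>
  define X where "X = x @\<^sub>v 0\<^sub>v (rdim R)"
  have X: "X \<in> carrier_vec ?m" using x(1) by (simp add: X_def m)
  have DX: "D t *\<^sub>v X = X" for t
  proof (rule eq_vecI)
    have Nc: "ract N (lower_unip t) \<in> carrier_mat ?n ?n" and Rc: "ract R (lower_unip t) \<in> carrier_mat (rdim R) (rdim R)"
      by (simp_all add: ract_carrier[OF N(1)] ract_carrier[OF R])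
    fix i assume "i < dim_vec X"
    hence i: "i < ?n + rdim R" using X m by simp
    have "(D t *\<^sub>v X) $ i = (\<Sum>l<?m. D t $$ (i, l) * X $ l)"
      using i X dims by (auto simp: scalar_prod_def atLeast0LessThan m intro!: sum.cong)
    also have "\<dots> = (\<Sum>l<?n. D t $$ (i, l) * x $ l)"
      using x(1) m by (intro sum.mono_neutral_cong_right) (auto simp: X_def)
    also have "\<dots> = X $ i"
    proof (cases "i < ?n")
      case True
      have "(\<Sum>l<?n. D t $$ (i, l) * x $ l) = (ract N (lower_unip t) *\<^sub>v x) $ i"
        using True Nc Rc x(1) by (auto simp: D_def direct_sum_def scalar_prod_def atLeast0LessThan intro!: sum.cong)
      thus ?thesis using True x by (simp add: X_def)
    next
      case False
      thus ?thesis using Nc Rc x(1) i by (auto simp: D_def direct_sum_def X_def)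
    qed
    finally show "(D t *\<^sub>v X) $ i = X $ i" .
  qed (use dims X in simp)
  define y where "y = \<theta>' *\<^sub>v X"
  have y: "y \<in> carrier_vec ?m" unfolding y_def by (rule mult_mat_vec_carrier[OF \<theta>' X])
  have "x $ i = 0" if i: "i < ?n" for i
  proof -
    have im: "i < ?m" using i m by simp
    \<comment> \<open>The first rows of the direct sum consist of the action on N followed by zeros,
      so the norm vanishes in each of them, whatever the other summand is.\<close>
    have Dsum: "(\<Sum>t\<in>?F. D t $$ (i, l)) = 0" if l: "l < ?m" for l
    proof -
      have "D t $$ (i, l) = (if l < ?n then ract N (lower_unip t) $$ (i, l) else 0)" for t
      proof -
        have "ract N (lower_unip t) \<in> carrier_mat ?n ?n" "ract R (lower_unip t) \<in> carrier_mat (rdim R) (rdim R)"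
          by (simp_all add: ract_carrier[OF N(1)] ract_carrier[OF R])
        thus ?thesis using i l m by (auto simp: D_def direct_sum_def)
      qed
      thus ?thesis using norm[OF i, of l] by (cases "l < ?n") auto
    qed
    \<comment> \<open>Applying the sum of conjugates to the fixed vector \<open>X\<close> absorbs
      every D(-t) and leaves the norm of the single vector \<open>y\<close>; its first entries are
      those of x.\<close>
    have "x $ i = (1\<^sub>m ?m *\<^sub>v X) $ i" using i X x(1) by (simp add: X_def)
    also have "\<dots> = (\<Sum>l<?m. (\<Sum>t\<in>?F. (D t * (\<theta>' * D (-t))) $$ (i, l)) * X $ l)"
      unfolding trD using im X by (auto simp: scalar_prod_def atLeast0LessThan intro!: sum.cong simp del: index_mult_mat(1))
    also have "\<dots> = (\<Sum>t\<in>?F. \<Sum>l<?m. (D t * (\<theta>' * D (-t))) $$ (i, l) * X $ l)"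
      by (subst sum.swap) (simp add: sum_distrib_right)
    also have "\<dots> = (\<Sum>t\<in>?F. \<Sum>l<?m. D t $$ (i, l) * y $ l)"
    proof (rule sum.cong[OF refl])
      fix t
      have "(\<Sum>l<?m. (D t * (\<theta>' * D (-t))) $$ (i, l) * X $ l) = ((D t * (\<theta>' * D (-t))) *\<^sub>v X) $ i"
        using im X dims by (auto simp: scalar_prod_def[of _ X] atLeast0LessThan intro!: sum.cong simp del: index_mult_mat(1))
      also have "(D t * (\<theta>' * D (-t))) *\<^sub>v X = D t *\<^sub>v (\<theta>' *\<^sub>v (D (-t) *\<^sub>v X))"
        using X Dc \<theta>' by (simp add: assoc_mult_mat_vec[of _ ?m ?m _ ?m] mult_carrier_mat[of _ ?m ?m])
      also have "\<dots> = D t *\<^sub>v y" by (simp add: DX y_def)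
      also have "(D t *\<^sub>v y) $ i = (\<Sum>l<?m. D t $$ (i, l) * y $ l)"
        using im y dims by (auto simp: scalar_prod_def atLeast0LessThan intro!: sum.cong)
      finally show "(\<Sum>l<?m. (D t * (\<theta>' * D (-t))) $$ (i, l) * X $ l) = (\<Sum>l<?m. D t $$ (i, l) * y $ l)" .
    qed
    also have "\<dots> = (\<Sum>l<?m. (\<Sum>t\<in>?F. D t $$ (i, l)) * y $ l)"
      by (subst sum.swap) (simp add: sum_distrib_right)
    also have "\<dots> = 0" using Dsum by simp
    finally show ?thesis .
  qed
  hence "x = 0\<^sub>v ?n" using x(1) by (intro eq_vecI) auto
  thus False using x(2) by simp
qed

theorem mainTheorem4:
  fixes p r :: nat and lam :: "nat \<times> nat"
  assumes "CHAR('a::alg_closed_field) = p" and "p > 0"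
    and "r \<ge> 1" and "lam \<in> Lambda_plus r"
  shows "\<exists>a::nat. \<forall>mu \<in> Lambda_plus (r + 2 * a). degenerate mu \<longrightarrow>
    (\<forall>k\<ge>a. \<forall>M N :: 'a gl2_rep. is_P mu M \<longrightarrow> is_P (fst lam + k, snd lam + k) N \<longrightarrow>
       \<not> has_summand (tensor M (tensor_power natural_module (2 * (k - a)))) N)"
proof -
  have prime: "prime p" using prime_CHAR_semidom[where ?'a = 'a] assms(1,2) by simp
  \<comment> \<open>The choice s = r + 2 gives q \<ge> 2^s > r + 2, so that a is defined without
    truncation and all weights of N stay in the range of the norm argument.\<close>
  define s q where "s = r + 2" and "q = p ^ s"
  have "s < 2 ^ s" by (rule less_exp)
  also have "(2::nat) ^ s \<le> q" unfolding q_def by (rule power_mono) (use prime_ge_2_nat[OF prime] in auto)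
  finally have q_large: "r + 2 < q" by (simp add: s_def)
  have "(of_nat p :: 'a) = 0" using of_nat_CHAR[where ?'a = 'a] assms(1) by simp
  hence of_q: "(of_nat q :: 'a) = 0" unfolding q_def of_nat_power by (simp add: s_def)
  define a where "a = (q - r) div 2"
  \<comment> \<open>Halving rounds down: q - r even gives q, and q - r odd gives q - 1.\<close>
  have ra: "r + 2 * a = q \<or> r + 2 * a = q - 1" using q_large unfolding a_def by presburger
  show ?thesis
  proof (rule exI[of _ a], intro ballI impI allI)
    fix mu k and M N :: "'a gl2_rep"
    assume mu: "mu \<in> Lambda_plus (r + 2 * a)" "degenerate mu" and M: "is_P mu M"
      and N: "is_P (fst lam + k, snd lam + k) N"
    have mu_eq: "mu = (r + 2 * a, 0)" using mu by (auto simp: Lambda_plus_def degenerate_def)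
    have q1: "q > 1" using q_large by simp
    from ra have "unipotent_projective q M"
    proof
      assume "r + 2 * a = q"
      thus ?thesis using tilting_unipotent_projective[OF _ assms(1,2) q_def q1] M mu_eq by simp
    next
      assume "r + 2 * a = q - 1"
      thus ?thesis using steinberg_unipotent_projective[OF _ assms(1,2) q_def q1] M mu_eq by simp
    qed
    moreover have pM: "group_rep M" using M by (auto simp: is_P_def tilting_def intro: polynomial_module_group_rep)
    moreover have X: "group_rep (tensor_power (natural_module :: 'a gl2_rep) (2 * (k - a)))"
      by (intro group_rep_tensor_power polynomial_module_group_rep polynomial_module_natural)
    ultimately have proj: "unipotent_projective q (tensor M (tensor_power natural_module (2 * (k - a))))"
      by (intro unipotent_projective_tensor)
    have lam: "snd lam \<le> fst lam" "fst lam + snd lam = r" using assms(4) by (auto simp: Lambda_plus_def)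
    have pN: "polynomial_module N" "highest_weight N (fst lam + k, snd lam + k)"
      using N by (auto simp: is_P_def tilting_def)
    \<comment> \<open>The shift by k cancels, and the difference of the two parts is at most
      r.\<close>
    have "fst lam + k - (snd lam + k) < q - 1" using lam q_large by linarith
    thus "\<not> has_summand (tensor M (tensor_power natural_module (2 * (k - a)))) N"
      using lam(1) by (intro no_summand_of_unipotent_projective[OF group_rep_tensor[OF pM X] proj pN _ _ q1 of_q]) auto
  qed
qed

end
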